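(* Let $\{\mathcal T_h\}_{h\in(0,h_0)}$ be conforming triangulations of $\Omega$, let $u(x_1,x_2)=x_1^2+x_2^2$, let $\alpha\in[0,1]$, and for each $h$ let $U\in X_h$ be a discrete function coinciding on $\partial\Omega$ with the piecewise linear Lagrange interpolation of $u$, such that $|u-U|_{H^1(\Omega)}\le C(u)h^\alpha$ for all $h\in(0,h_0)$, with $C(u)$ independent of $h$. Let $\mathbb B=\bigcup_{b=1}^{N_{\mathcal B}}\mathcal B_b\subset\mathcal T_h$ be a union of disjoint bands $\mathcal B_b=(\bigcup_{i=0}^{N_b}K_i^b)\cup(\bigcup_{i=1}^{N_b}\tilde K_i^b)$ such that there exist constants $C_K,C_\alpha$ independent of $h$ such that for all $b=1,\dots,N_{\mathcal B}$ and $i=1,\dots,N_b$ $$|\tilde K_i^b|\le C_K|K_i^b|,\qquad |\tilde K_i^b|\le C_K|K_{i-1}^b|,\qquad \sin(\pi-\alpha_{i-1}^b)\le C_\alpha\sin(\pi-\tilde\alpha_i^b).$$ Finally, let $L_b\ge C_Lh^{2\alpha/5}$ for all $b=1,\dots,N_{\mathcal B}$, where $C_L$ is sufficiently large with respect to $C(u)$. Then $$|u-U|_{H^1(\mathbb B)}\ge\mathcal A_1-\mathcal A_2,$$ where the real numbers $\mathcal A_1,\mathcal A_2$ satisfy $$\mathcal A_1\ge C_1\Big(\sum_{b=1}^{N_{\mathcal B}}\min_{i=1,\dots,N_b}\frac{1}{\sin^2(\pi-\tilde\alpha_i^b)}\ \min_{i=1,\dots,N_b}|\tilde K_i^b|\,L_b^2N_b^{-1}\Big)^{1/2},\qquad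 |\mathcal A_2|\le C_2h^\alpha,$$ with constants $C_1,C_2>0$ independent of $h$, of the number of bands, and of the geometry of $\mathcal T_h$ and of the bands (they may depend on $\Omega$, $h_0$, $C(u)$, $C_K$, $C_\alpha$).
   Context: $\Omega\subset\mathbb R^2$ is a bounded polygonal domain with Lipschitz boundary; $h$ is the maximal diameter of elements of $\mathcal T_h$; $X_h\subset H^1(\Omega)$ is the space of globally continuous functions that are linear on every $K\in\mathcal T_h$. $|\cdot|_{H^1(M)}$ is the $H^1(M)$-seminorm, $|K|$ the area of $K$. Band: for $N\ge1$, a band $\mathcal B\subset\mathcal T_h$ is a union of distinct elements $K_0,\dots,K_N,\tilde K_1,\dots,\tilde K_N$ of $\mathcal T_h$ of the following form. There are consecutive points $P_0,\dots,P_{N+1}$ on a straight line and points $Q_0,\dots,Q_N$ on one side of it such that $K_i$ is the triangle $P_iP_{i+1}Q_i$, whose longest edge is $P_iP_{i+1}$ (so its maximum angle is at $Q_i$), and $\tilde K_i$ is the triangle $Q_{i-1}Q_iP_i$, whose maximum angle is at $P_i$. $\alpha_i,\tilde\alpha_i$ denote the maximum angles of $K_i,\tilde K_i$; $\Gamma=\bigcup_{i=0}^N P_iP_{i+1}$ is the edge of the band and $L$ its length. For the band $\mathcal B_b$ all these quantities carry the index $b$: $N_b$, $K_i^b$, $\tilde K_i^b$, $\alpha_i^b$, $\tilde\alpha_i^b$, $\Gamma_b$, $L_b$. Disjoint bands are bands having no element in common. "$C_L$ sufficiently large with respect to $C(u)$" means: larger than a threshold that depends only on $\Omega$, $h_0$,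 $\alpha$ and the constant $C(u)$ in the error estimate, and not on $h$, the triangulation or the bands. *)

theory Defs
  imports "HOL-Analysis.Analysis"
begin

type_synonym point = "real \<times> real"

definition lipschitz_boundary :: "point set \<Rightarrow> bool" where
  "lipschitz_boundary \<Omega> \<longleftrightarrow>
     (\<forall>x\<in>frontier \<Omega>. \<exists>r>0. \<exists>e n \<phi>.
        norm e = 1 \<and> norm n = 1 \<and> e \<bullet> n = 0 \<and> (\<exists>C. C-lipschitz_on UNIV \<phi>) \<and>
        \<Omega> \<inter> ball x r = {y \<in> ball x r. \<phi> (y \<bullet> e) < y \<bullet> n})"

definition polygonal_boundary :: "point set \<Rightarrow> bool" where
  "polygonal_boundary \<Omega> \<longleftrightarrow>
     (\<exists>E. finite E \<and> frontier \<Omega> = (\<Union>(a, b)\<in>E. closed_segment a b))"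

definition polygonal_lipschitz_domain :: "point set \<Rightarrow> bool" where
  "polygonal_lipschitz_domain \<Omega> \<longleftrightarrow>
     open \<Omega> \<and> connected \<Omega> \<and> \<Omega> \<noteq> {} \<and> bounded \<Omega> \<and>
     polygonal_boundary \<Omega> \<and> lipschitz_boundary \<Omega>"

(* Elements are closed triangles. The library predicate triangulation requires finiteness
   and that any two elements meet in a common (possibly empty) face, i.e. conformity. *)
definition conforming_triangulation :: "point set \<Rightarrow> point set set \<Rightarrow> bool" where
  "conforming_triangulation \<Omega> \<T> \<longleftrightarrow>
     triangulation \<T> \<and> (\<forall>K\<in>\<T>. 2 simplex K) \<and> \<Union>\<T> = closure \<Omega>"

definition mesh_size :: "point set set \<Rightarrow> real" where
  "mesh_size \<T> = Max (diameter ` \<T>)"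

(* Values outside the closure of the domain are irrelevant and left unconstrained. *)
definition fe_space :: "point set \<Rightarrow> point set set \<Rightarrow> (point \<Rightarrow> real) set" where
  "fe_space \<Omega> \<T> =
     {v. continuous_on (closure \<Omega>) v \<and> (\<forall>K\<in>\<T>. \<exists>a c. \<forall>x\<in>K. v x = a \<bullet> x + c)}"

definition lagrange_interpolant ::
    "point set \<Rightarrow> point set set \<Rightarrow> (point \<Rightarrow> real) \<Rightarrow> (point \<Rightarrow> real) \<Rightarrow> bool" where
  "lagrange_interpolant \<Omega> \<T> f v \<longleftrightarrow>
     v \<in> fe_space \<Omega> \<T> \<and> (\<forall>K\<in>\<T>. \<forall>x. x extreme_point_of K \<longrightarrow> v x = f x)"

definition quad_fun :: "point \<Rightarrow> real" where
  "quad_fun = (\<lambda>(x1, x2). x1\<^sup>2 + x2\<^sup>2)"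

(* phi is continuously differentiable with gradient psi and has compact support in S. *)
definition test_function :: "point set \<Rightarrow> (point \<Rightarrow> real) \<Rightarrow> (point \<Rightarrow> point) \<Rightarrow> bool" where
  "test_function S \<phi> \<psi> \<longleftrightarrow>
     (\<forall>x. (\<phi> has_derivative (\<lambda>y. \<psi> x \<bullet> y)) (at x)) \<and> continuous_on UNIV \<psi> \<and>
     compact (closure {x. \<phi> x \<noteq> 0}) \<and> closure {x. \<phi> x \<noteq> 0} \<subseteq> S"

definition weak_gradient :: "point set \<Rightarrow> (point \<Rightarrow> real) \<Rightarrow> (point \<Rightarrow> point) \<Rightarrow> bool" where
  "weak_gradient S v g \<longleftrightarrow>
     (\<forall>C. compact C \<and> C \<subseteq> S \<longrightarrow>
        set_integrable lborel C v \<and> set_integrable lborel C g) \<and>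
     (\<forall>\<phi> \<psi>. test_function S \<phi> \<psi> \<longrightarrow>
        (LINT x:S|lborel. v x *\<^sub>R \<psi> x) = - (LINT x:S|lborel. \<phi> x *\<^sub>R g x))"

(* A weak gradient is unique only up to null sets; the seminorm below does not depend on
   the representative chosen here. *)
definition weak_grad :: "point set \<Rightarrow> (point \<Rightarrow> real) \<Rightarrow> point \<Rightarrow> point" where
  "weak_grad S v = (SOME g. weak_gradient S v g)"

(* M need not be open: for a finite union of closed triangles, the Sobolev space on M is
   that on its interior, which differs from M by a null set. *)
definition h1_seminorm :: "point set \<Rightarrow> (point \<Rightarrow> real) \<Rightarrow> real" where
  "h1_seminorm M v =
     sqrt (LINT x:interior M|lborel. (norm (weak_grad (interior M) v x))\<^sup>2)"

abbreviation area :: "point set \<Rightarrow> real" where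
  "area \<equiv> measure lborel"

(* The angle at the second argument. *)
definition vertex_angle :: "point \<Rightarrow> point \<Rightarrow> point \<Rightarrow> real" where
  "vertex_angle a v b = arccos (((a - v) \<bullet> (b - v)) / (norm (a - v) * norm (b - v)))"

(* A band is encoded by N and the points P 0, ..., P (N + 1) and Q 0, ..., Q N;
   the values of P and Q at larger indices are irrelevant. *)

definition band_K :: "(nat \<Rightarrow> point) \<Rightarrow> (nat \<Rightarrow> point) \<Rightarrow> nat \<Rightarrow> point set" where
  "band_K P Q i = convex hull {P i, P (i + 1), Q i}"

definition band_Kt :: "(nat \<Rightarrow> point) \<Rightarrow> (nat \<Rightarrow> point) \<Rightarrow> nat \<Rightarrow> point set" where
  "band_Kt P Q i = convex hull {Q (i - 1), Q i, P i}"

definition band_alpha :: "(nat \<Rightarrow> point) \<Rightarrow> (nat \<Rightarrow> point) \<Rightarrow> nat \<Rightarrow> real" where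
  "band_alpha P Q i = vertex_angle (P i) (Q i) (P (i + 1))"

definition band_alphat :: "(nat \<Rightarrow> point) \<Rightarrow> (nat \<Rightarrow> point) \<Rightarrow> nat \<Rightarrow> real" where
  "band_alphat P Q i = vertex_angle (Q (i - 1)) (P i) (Q i)"

definition band_length :: "nat \<Rightarrow> (nat \<Rightarrow> point) \<Rightarrow> real" where
  "band_length N P = (\<Sum>i=0..N. dist (P i) (P (i + 1)))"

definition band_elements ::
    "nat \<Rightarrow> (nat \<Rightarrow> point) \<Rightarrow> (nat \<Rightarrow> point) \<Rightarrow> point set set" where
  "band_elements N P Q = band_K P Q ` {0..N} \<union> band_Kt P Q ` {1..N}"

definition is_band ::
    "point set set \<Rightarrow> nat \<Rightarrow> (nat \<Rightarrow> point) \<Rightarrow> (nat \<Rightarrow> point) \<Rightarrow> bool" where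
  "is_band \<T> N P Q \<longleftrightarrow>
     1 \<le> N \<and>
     band_elements N P Q \<subseteq> \<T> \<and>
     inj_on (band_K P Q) {0..N} \<and> inj_on (band_Kt P Q) {1..N} \<and>
     band_K P Q ` {0..N} \<inter> band_Kt P Q ` {1..N} = {} \<and>
     (\<exists>p d n t. d \<noteq> 0 \<and> n \<noteq> 0 \<and> d \<bullet> n = 0 \<and>
        strict_mono_on {0..N + 1} t \<and>
        (\<forall>i\<in>{0..N + 1}. P i = p + t i *\<^sub>R d) \<and>
        (\<forall>i\<in>{0..N}. (Q i - p) \<bullet> n > 0)) \<and>
     (\<forall>i\<in>{0..N}. dist (P i) (Q i) \<le> dist (P i) (P (i + 1)) \<and>
                  dist (P (i + 1)) (Q i) \<le> dist (P i) (P (i + 1))) \<and>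
     (\<forall>i\<in>{1..N}. vertex_angle (P i) (Q (i - 1)) (Q i) \<le> band_alphat P Q i \<and>
                  vertex_angle (P i) (Q i) (Q (i - 1)) \<le> band_alphat P Q i)"

end

(* For v = u - U, the gradient of v on a triangle K is 2x - A K, where A K is the constant gradient of U.
   Let s_i be the slopes of U along the edge of a band. A second difference of v with step L/3 along this
   edge equals 2 L^2/9 up to four times L times the total variation of the slopes. On the other hand v is
   small in L^2 on the edge: follow v in the normal direction until the boundary of the domain, where it is
   at most h^2, and apply Cauchy-Schwarz on each line. For L^5 >> h^(2 alpha) this forces
   sum |s_i - s_(i-1)| > L/36.

   By continuity of U, the gradient on the i-th flat triangle differs from the gradients on the two
   adjacent triangles of the band by vectors orthogonal to its short sides, which are almost parallel.
   Hence a jump s_i - s_(i-1) is amplified by 1 / sin (angle). All three gradients have to be close to the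
   same vector 2 P_i, so the amplified jumps are bounded by the error on the band, up to O(h). Summing with
   Cauchy-Schwarz gives the factor L^2 / N. *)
theory Submission
  imports Defs
begin

text \<open>The seminorm integrates a weak gradient selected by Hilbert choice, so it can be
  computed only after that choice is pinned down: the elementwise gradient \<open>G\<close> is shown
  to be a weak gradient, and weak gradients are shown to be unique almost everywhere. Bands may
  point in any direction, so the Fubini arguments run in rotated frames.

  The exponent in h^(2 alpha / 5) arises as follows. A second difference of size L^2 / 9, squared
  and integrated over a segment of length L / 3, gives L^5 / 243, which competes with an energy of
  order h^(2 alpha). Second differences remove an unknown affine function, so only the bending of
  \<open>U\<close> along the edge remains to be controlled.

  The constants must survive arbitrarily flat triangles. The angle hypothesis bounds the tilt of one
  short side against the edge by a multiple of the same sine that amplifies the jump. The area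
  hypotheses allow the area of the flat triangle to serve as weight for the gradients on both
  neighbours as well. The final splitting takes A1 as a multiple of the square root of the sum and
  A2 = 2 h sqrt |Omega|, the price of replacing 2x by 2 P_i.\<close>

section \<open>Orthonormal frames\<close>

text \<open>Gaussian elimination reduces the linear map to one-dimensional affine substitutions,
  with Tonelli between them; the scaling factors multiply to the absolute determinant. For
  \<open>a = 0\<close> there is no pivot, and the inner variable occurs in the second coordinate
  only.\<close>

lemma nn_integral_lborel_unimodular:
  fixes f :: "real \<times> real \<Rightarrow> ennreal"
  assumes f [measurable]: "f \<in> borel_measurable borel" and det: "\<bar>a * d - b * c\<bar> = 1"
  shows "(\<integral>\<^sup>+x. \<integral>\<^sup>+y. f (a * x + b * y, c * x + d * y) \<partial>lborel \<partial>lborel) = (\<integral>\<^sup>+z. f z \<partial>lborel)"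
proof -
  have f': "f \<in> borel_measurable (lborel \<Otimes>\<^sub>M lborel)"
    by (simp add: lborel_prod)
  have [measurable]: "f \<in> borel_measurable (borel \<Otimes>\<^sub>M borel)"
    by (simp add: borel_prod)
  have plain: "(\<integral>\<^sup>+z. f z \<partial>lborel) = (\<integral>\<^sup>+x. \<integral>\<^sup>+y. f (x, y) \<partial>lborel \<partial>lborel)"
    using lborel.nn_integral_fst[OF f', symmetric] by (simp add: lborel_prod)
  have swapped: "(\<integral>\<^sup>+z. f z \<partial>lborel) = (\<integral>\<^sup>+y. \<integral>\<^sup>+x. f (x, y) \<partial>lborel \<partial>lborel)"
    unfolding plain by (rule lborel_pair.Fubini'[symmetric]) (simp add: lborel_prod)
  have "(\<integral>\<^sup>+x. \<integral>\<^sup>+y. f (a * x + b * y, c * x + d * y) \<partial>lborel \<partial>lborel) =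
      (\<integral>\<^sup>+y. \<integral>\<^sup>+x. f (a * x + b * y, c * x + d * y) \<partial>lborel \<partial>lborel)"
    by (rule lborel_pair.Fubini') (simp add: case_prod_unfold)
  also have "\<dots> = (\<integral>\<^sup>+z. f z \<partial>lborel)"
  proof (cases "a = 0")
    case True
    then have nz: "b \<noteq> 0" "c \<noteq> 0" and bc: "\<bar>b\<bar> * \<bar>c\<bar> = 1"
      using det by (auto simp: abs_mult)
    have inv: "1 / \<bar>c\<bar> = \<bar>b\<bar>"
      using bc nz by (simp add: field_simps)
    have "(\<integral>\<^sup>+y. \<integral>\<^sup>+x. f (b * y, c * x + d * y) \<partial>lborel \<partial>lborel) =
        (\<integral>\<^sup>+y. ennreal (1 / \<bar>c\<bar>) * (\<integral>\<^sup>+x. f (b * y, x) \<partial>lborel) \<partial>lborel)"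
    proof (rule nn_integral_cong)
      fix y
      have "(\<integral>\<^sup>+x. f (b * y, x) \<partial>lborel) = \<bar>c\<bar> * (\<integral>\<^sup>+x. f (b * y, d * y + c * x) \<partial>lborel)"
        by (rule nn_integral_real_affine[OF _ nz(2)]) measurable
      then show "(\<integral>\<^sup>+x. f (b * y, c * x + d * y) \<partial>lborel) =
          ennreal (1 / \<bar>c\<bar>) * (\<integral>\<^sup>+x. f (b * y, x) \<partial>lborel)"
        using nz(2) by (simp add: mult.assoc[symmetric] ennreal_mult[symmetric] add.commute)
    qed
    also have "\<dots> = ennreal (1 / \<bar>c\<bar>) * (\<integral>\<^sup>+y. (\<integral>\<^sup>+x. f (b * y, x) \<partial>lborel) \<partial>lborel)"
      by (rule nn_integral_cmult) measurable
    also have "(\<integral>\<^sup>+y. (\<integral>\<^sup>+x. f (y, x) \<partial>lborel) \<partial>lborel) =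
        \<bar>b\<bar> * (\<integral>\<^sup>+y. (\<integral>\<^sup>+x. f (0 + b * y, x) \<partial>lborel) \<partial>lborel)"
      by (rule nn_integral_real_affine[OF _ nz(1)]) measurable
    then have "ennreal (1 / \<bar>c\<bar>) * (\<integral>\<^sup>+y. (\<integral>\<^sup>+x. f (b * y, x) \<partial>lborel) \<partial>lborel) =
        (\<integral>\<^sup>+y. (\<integral>\<^sup>+x. f (y, x) \<partial>lborel) \<partial>lborel)"
      using inv by simp
    finally show ?thesis using True by (simp add: plain)
  next
    case False
    \<comment> \<open>The second pivot: once a x + b y is the new first variable, the second
      coordinate is c / a times it plus k y.\<close>
    define k where "k = (a * d - b * c) / a"
    have k: "k \<noteq> 0" "\<bar>a\<bar> * \<bar>k\<bar> = 1"
      using det False by (auto simp: k_def)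
    have "(\<integral>\<^sup>+y. \<integral>\<^sup>+x. f (a * x + b * y, c * x + d * y) \<partial>lborel \<partial>lborel) =
        (\<integral>\<^sup>+y. ennreal (1 / \<bar>a\<bar>) * (\<integral>\<^sup>+x. f (x, c / a * x + k * y) \<partial>lborel) \<partial>lborel)"
    proof (rule nn_integral_cong)
      fix y
      have "(\<integral>\<^sup>+x. f (x, c / a * x + k * y) \<partial>lborel) =
          \<bar>a\<bar> * (\<integral>\<^sup>+x. f (b * y + a * x, c / a * (b * y + a * x) + k * y) \<partial>lborel)"
        by (rule nn_integral_real_affine[OF _ False]) measurable
      moreover have "c / a * (b * y + a * x) + k * y = c * x + d * y" for x
        using False by (simp add: k_def field_simps)
      ultimately show "(\<integral>\<^sup>+x. f (a * x + b * y, c * x + d * y) \<partial>lborel) =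
          ennreal (1 / \<bar>a\<bar>) * (\<integral>\<^sup>+x. f (x, c / a * x + k * y) \<partial>lborel)"
        using False by (simp add: mult.assoc[symmetric] ennreal_mult[symmetric] add.commute)
    qed
    also have "\<dots> = ennreal (1 / \<bar>a\<bar>) * (\<integral>\<^sup>+y. (\<integral>\<^sup>+x. f (x, c / a * x + k * y) \<partial>lborel) \<partial>lborel)"
      by (rule nn_integral_cmult) measurable
    also have "(\<integral>\<^sup>+y. (\<integral>\<^sup>+x. f (x, c / a * x + k * y) \<partial>lborel) \<partial>lborel) =
        (\<integral>\<^sup>+x. (\<integral>\<^sup>+y. f (x, c / a * x + k * y) \<partial>lborel) \<partial>lborel)"
      by (rule lborel_pair.Fubini'[symmetric]) (simp add: case_prod_unfold)
    also have "\<dots> = (\<integral>\<^sup>+x. ennreal (1 / \<bar>k\<bar>) * (\<integral>\<^sup>+y. f (x, y) \<partial>lborel) \<partial>lborel)"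
    proof (rule nn_integral_cong)
      fix x
      have "(\<integral>\<^sup>+y. f (x, y) \<partial>lborel) = \<bar>k\<bar> * (\<integral>\<^sup>+y. f (x, c / a * x + k * y) \<partial>lborel)"
        by (rule nn_integral_real_affine[OF _ k(1)]) measurable
      then show "(\<integral>\<^sup>+y. f (x, c / a * x + k * y) \<partial>lborel) =
          ennreal (1 / \<bar>k\<bar>) * (\<integral>\<^sup>+y. f (x, y) \<partial>lborel)"
        using k(1) by (simp add: mult.assoc[symmetric] ennreal_mult[symmetric])
    qed
    also have "\<dots> = ennreal (1 / \<bar>k\<bar>) * (\<integral>\<^sup>+x. (\<integral>\<^sup>+y. f (x, y) \<partial>lborel) \<partial>lborel)"
      by (rule nn_integral_cmult) measurable
    also have "ennreal (1 / \<bar>a\<bar>) * \<dots> = (\<integral>\<^sup>+z. f z \<partial>lborel)"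
      using k(2) False k(1) by (simp add: plain mult.assoc[symmetric] ennreal_mult[symmetric])
    finally show ?thesis .
  qed
  finally show ?thesis .
qed

definition orthonormal_frame :: "point \<Rightarrow> point \<Rightarrow> bool" where
  "orthonormal_frame e \<nu> \<longleftrightarrow> norm e = 1 \<and> norm \<nu> = 1 \<and> e \<bullet> \<nu> = 0"

lemma orthonormal_frame_components:
  assumes "orthonormal_frame e \<nu>"
  shows "fst e ^ 2 + snd e ^ 2 = 1" "fst \<nu> ^ 2 + snd \<nu> ^ 2 = 1" "fst e * fst \<nu> + snd e * snd \<nu> = 0"
  using assms by (auto simp: orthonormal_frame_def norm_prod_def inner_prod_def)

text \<open>Lagrange's identity. The sign stays open because the points \<open>Q\<close> of a band
  may lie on either side of its line, so frames of both orientations occur.\<close>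

lemma orthonormal_frame_det:
  assumes "orthonormal_frame e \<nu>"
  shows "\<bar>fst e * snd \<nu> - fst \<nu> * snd e\<bar> = 1"
proof -
  note c = orthonormal_frame_components[OF assms]
  have "(fst e * snd \<nu> - fst \<nu> * snd e)^2 =
      (fst e ^ 2 + snd e ^ 2) * (fst \<nu> ^ 2 + snd \<nu> ^ 2) - (fst e * fst \<nu> + snd e * snd \<nu>)^2"
    by (simp add: power2_eq_square algebra_simps)
  then have "(fst e * snd \<nu> - fst \<nu> * snd e)^2 = 1" by (simp only: c) simp
  then show ?thesis by (simp add: power2_eq_1_iff abs_eq_iff')
qed

lemma orthonormal_frame_inner:
  assumes "orthonormal_frame e \<nu>"
  shows "x \<bullet> y = (x \<bullet> e) * (y \<bullet> e) + (x \<bullet> \<nu>) * (y \<bullet> \<nu>)"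
proof -
  obtain e1 e2 n1 n2 x1 x2 y1 y2 where [simp]: "e = (e1, e2)" "\<nu> = (n1, n2)" "x = (x1, x2)" "y = (y1, y2)"
    by (cases e, cases \<nu>, cases x, cases y)
  have c: "e1^2 + e2^2 = 1" "n1^2 + n2^2 = 1" "e1 * n1 + e2 * n2 = 0"
    using orthonormal_frame_components[OF assms] by auto
  \<comment> \<open>The orientation sign of the frame: \<nu> is \<open>e\<close> turned by a right
    angle, times \<open>k\<close>. Since \<open>k * k = 1\<close>, the claim becomes a polynomial
    identity in the coordinates of \<open>e\<close>.\<close>
  define k where "k = e1 * n2 - n1 * e2"
  have k: "k * k = 1"
    using orthonormal_frame_det[OF assms] abs_mult_self_eq[of k] by (simp add: k_def)
  have "n1 = n1 * (e1^2 + e2^2) - e1 * (e1 * n1 + e2 * n2)"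
    using c by simp
  then have n1: "n1 = - k * e2"
    by (simp add: k_def algebra_simps power2_eq_square)
  have "n2 = n2 * (e1^2 + e2^2) - e2 * (e1 * n1 + e2 * n2)"
    using c by simp
  then have n2: "n2 = k * e1"
    by (simp add: k_def algebra_simps power2_eq_square)
  have "(x1 * e1 + x2 * e2) * (y1 * e1 + y2 * e2) + (x1 * n1 + x2 * n2) * (y1 * n1 + y2 * n2) =
      (x1 * e1 + x2 * e2) * (y1 * e1 + y2 * e2) + (k * k) * ((x2 * e1 - x1 * e2) * (y2 * e1 - y1 * e2))"
    unfolding n1 n2 by (simp add: algebra_simps)
  also have "\<dots> = (e1^2 + e2^2) * (x1 * y1 + x2 * y2)"
    unfolding k by (simp add: algebra_simps power2_eq_square)
  finally have "x1 * y1 + x2 * y2 = (x1 * e1 + x2 * e2) * (y1 * e1 + y2 * e2) + (x1 * n1 + x2 * n2) * (y1 * n1 + y2 * n2)"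
    using c by simp
  then show ?thesis by simp
qed

lemma orthonormal_frame_expand:
  assumes "orthonormal_frame e \<nu>"
  shows "x = (x \<bullet> e) *\<^sub>R e + (x \<bullet> \<nu>) *\<^sub>R \<nu>"
proof (rule vector_eq_rdot[THEN iffD1], rule allI)
  fix z
  show "x \<bullet> z = ((x \<bullet> e) *\<^sub>R e + (x \<bullet> \<nu>) *\<^sub>R \<nu>) \<bullet> z"
    using orthonormal_frame_inner[OF assms, of x z] by (simp add: inner_add_left inner_commute[of z])
qed

lemma orthonormal_frame_simps:
  assumes "orthonormal_frame e \<nu>"
  shows "e \<bullet> e = 1" "\<nu> \<bullet> \<nu> = 1" "e \<bullet> \<nu> = 0" "\<nu> \<bullet> e = 0"
  using assms by (auto simp: orthonormal_frame_def norm_eq_sqrt_inner inner_commute)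

lemma nn_integral_orthonormal_frame:
  fixes f :: "point \<Rightarrow> ennreal"
  assumes "f \<in> borel_measurable borel" "orthonormal_frame e \<nu>"
  shows "(\<integral>\<^sup>+s. \<integral>\<^sup>+t. f (s *\<^sub>R e + t *\<^sub>R \<nu>) \<partial>lborel \<partial>lborel) = (\<integral>\<^sup>+z. f z \<partial>lborel)"
proof -
  have "s *\<^sub>R e + t *\<^sub>R \<nu> = (fst e * s + fst \<nu> * t, snd e * s + snd \<nu> * t)" for s t
    by (simp add: prod_eq_iff algebra_simps)
  then show ?thesis
    using nn_integral_lborel_unimodular[OF assms(1), of "fst e" "snd \<nu>" "fst \<nu>" "snd e"]
      orthonormal_frame_det[OF assms(2)] by (simp add: algebra_simps)
qed

text \<open>The change of variables as an equality of measures, which makes it applicable to signed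
  Bochner integrals.\<close>

lemma distr_lborel_orthonormal_frame:
  assumes "orthonormal_frame e \<nu>"
  shows "distr (lborel \<Otimes>\<^sub>M lborel) borel (\<lambda>(s, t). s *\<^sub>R e + t *\<^sub>R \<nu>) = lborel"
proof (rule measure_eqI)
  fix A assume "A \<in> sets (distr (lborel \<Otimes>\<^sub>M lborel) borel (\<lambda>(s, t). s *\<^sub>R e + t *\<^sub>R \<nu>))"
  then have A [measurable]: "A \<in> sets borel" by simp
  have "emeasure (distr (lborel \<Otimes>\<^sub>M lborel) borel (\<lambda>(s, t). s *\<^sub>R e + t *\<^sub>R \<nu>)) A =
      (\<integral>\<^sup>+z. indicator A z \<partial>distr (lborel \<Otimes>\<^sub>M lborel) borel (\<lambda>(s, t). s *\<^sub>R e + t *\<^sub>R \<nu>))"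
    by simp
  also have "\<dots> = (\<integral>\<^sup>+p. indicator A (case p of (s, t) \<Rightarrow> s *\<^sub>R e + t *\<^sub>R \<nu>) \<partial>(lborel \<Otimes>\<^sub>M lborel))"
    by (subst nn_integral_distr) (auto simp: case_prod_unfold)
  also have "\<dots> = (\<integral>\<^sup>+s. \<integral>\<^sup>+t. indicator A (s *\<^sub>R e + t *\<^sub>R \<nu>) \<partial>lborel \<partial>lborel)"
    using lborel.nn_integral_fst[of "\<lambda>p::real \<times> real. indicator A (case p of (s, t) \<Rightarrow> s *\<^sub>R e + t *\<^sub>R \<nu>)" lborel]
    by (simp add: case_prod_unfold)
  also have "\<dots> = emeasure lborel A"
    by (subst nn_integral_orthonormal_frame[OF _ assms]) auto
  finally show "emeasure (distr (lborel \<Otimes>\<^sub>M lborel) borel (\<lambda>(s, t). s *\<^sub>R e + t *\<^sub>R \<nu>)) A = emeasure lborel A" .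
qed simp

text \<open>Reduces integration by parts in the plane to the fundamental theorem of calculus on
  almost every line in direction \<nu>.\<close>

lemma integral_zero_of_lines:
  fixes f :: "point \<Rightarrow> real"
  assumes "integrable lborel f" "orthonormal_frame e \<nu>"
    and "AE s in lborel. (LINT t|lborel. f (s *\<^sub>R e + t *\<^sub>R \<nu>)) = 0"
  shows "(LINT x|lborel. f x) = 0"
proof -
  let ?T = "\<lambda>(s, t). s *\<^sub>R e + t *\<^sub>R \<nu>"
  have T: "?T \<in> lborel \<Otimes>\<^sub>M lborel \<rightarrow>\<^sub>M borel"
    by (simp add: case_prod_unfold)
  have f: "integrable (lborel \<Otimes>\<^sub>M lborel) (\<lambda>p. f (?T p))"
    using integrable_distr_eq[OF T, of f] borel_measurable_integrable[OF assms(1)] assms(1)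
    by (simp add: distr_lborel_orthonormal_frame[OF assms(2)])
  have "(LINT x|lborel. f x) = (LINT p|(lborel \<Otimes>\<^sub>M lborel). f (?T p))"
    using integral_distr[OF T, of f] borel_measurable_integrable[OF assms(1)]
    by (simp add: distr_lborel_orthonormal_frame[OF assms(2)])
  also have "\<dots> = (LINT s|lborel. LINT t|lborel. f (s *\<^sub>R e + t *\<^sub>R \<nu>))"
    using lborel_pair.integral_fst'[OF f] by simp
  also have "\<dots> = 0"
    using assms(3) by (simp add: integral_eq_zero_AE)
  finally show ?thesis .
qed

section \<open>Triangles and lines\<close>

lemma triangleE:
  fixes K :: "point set"
  assumes "2 simplex K"
  obtains a b c where "K = convex hull {a, b, c}" "\<not> collinear {a, b, c}"
proof -
  obtain C where C: "finite C" "\<not> affine_dependent C" "int (card C) = 2 + 1" "K = convex hull C"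
    using assms by (auto simp: simplex)
  then have "card C = 3" by simp
  then obtain a b c where "C = {a, b, c}" "a \<noteq> b" "a \<noteq> c" "b \<noteq> c"
    by (auto simp: card_3_iff)
  with C that show ?thesis by (auto simp: collinear_3_eq_affine_dependent)
qed

lemma DIM_point: "DIM(point) = 2"
  by simp

lemma triangle_compact:
  fixes K :: "point set"
  assumes "2 simplex K"
  shows "compact K" "convex K"
  using assms by (auto elim!: triangleE intro!: finite_imp_compact_convex_hull)

lemma triangle_diff_interior_subset_segments:
  fixes K :: "point set"
  assumes "2 simplex K"
  obtains E where "finite E" "K - interior K \<subseteq> (\<Union>(a, b)\<in>E. closed_segment a b)"
proof -
  obtain a b c where K: "K = convex hull {a, b, c}" and nc: "\<not> collinear {a, b, c}"
    using assms by (rule triangleE)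
  have "K - interior K \<subseteq> (\<Union>(a, b)\<in>{(a, b), (b, c), (a, c)}. closed_segment a b)"
  proof
    fix x assume x: "x \<in> K - interior K"
    then obtain u v w where uvw: "0 \<le> u" "0 \<le> v" "0 \<le> w" "u + v + w = 1" "x = u *\<^sub>R a + v *\<^sub>R b + w *\<^sub>R c"
      unfolding K convex_hull_3 by auto
    have "\<not> (0 < u \<and> 0 < v \<and> 0 < w)"
      using x uvw unfolding K interior_convex_hull_3_minimal[OF nc DIM_point] by blast
    then consider "u = 0" | "v = 0" | "w = 0" using uvw by linarith
    then show "x \<in> (\<Union>(a, b)\<in>{(a, b), (b, c), (a, c)}. closed_segment a b)"
    proof cases
      case 1
      then have "v = 1 - w" "x = v *\<^sub>R b + w *\<^sub>R c" using uvw by auto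
      then show ?thesis using uvw by (auto simp: closed_segment_def)
    next
      case 2
      then have "u = 1 - w" "x = u *\<^sub>R a + w *\<^sub>R c" using uvw by auto
      then show ?thesis using uvw by (auto simp: closed_segment_def)
    next
      case 3
      then have "u = 1 - v" "x = u *\<^sub>R a + v *\<^sub>R b" using uvw by auto
      then show ?thesis using uvw by (auto simp: closed_segment_def)
    qed
  qed
  then show ?thesis by (intro that[of "{(a, b), (b, c), (a, c)}"]) auto
qed

text \<open>A line in direction \<nu> meets a segment in infinitely many points only if the segment
  itself has that direction, and then \<open>s\<close> must equal \<open>a \<bullet> e\<close>. So
  there is at most one bad line per segment.\<close>

lemma finite_lines_overlapping_segment:
  assumes fr: "orthonormal_frame e \<nu>"
  shows "finite {s. infinite {t. s *\<^sub>R e + t *\<^sub>R \<nu> \<in> closed_segment a b}}"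
proof -
  note o = orthonormal_frame_simps[OF fr]
  have *: "s = a \<bullet> e" if inf: "infinite {t. s *\<^sub>R e + t *\<^sub>R \<nu> \<in> closed_segment a b}" for s
  proof -
    obtain t where "s *\<^sub>R e + t *\<^sub>R \<nu> \<in> closed_segment a b"
      using not_finite_existsD[OF inf] by blast
    then obtain u where u: "s *\<^sub>R e + t *\<^sub>R \<nu> = (1 - u) *\<^sub>R a + u *\<^sub>R b"
      by (auto simp: closed_segment_def)
    have se: "s = (1 - u) * (a \<bullet> e) + u * (b \<bullet> e)"
      using arg_cong[OF u, of "\<lambda>x. x \<bullet> e"] o by (simp add: inner_simps)
    show ?thesis
    proof (cases "a \<bullet> e = b \<bullet> e")
      case True
      then show ?thesis using se by (simp add: algebra_simps)
    next
      case False
      have "{t. s *\<^sub>R e + t *\<^sub>R \<nu> \<in> closed_segment a b} \<subseteq>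
          {(1 - (s - a \<bullet> e) / (b \<bullet> e - a \<bullet> e)) * (a \<bullet> \<nu>) + (s - a \<bullet> e) / (b \<bullet> e - a \<bullet> e) * (b \<bullet> \<nu>)}"
      proof
        fix t assume "t \<in> {t. s *\<^sub>R e + t *\<^sub>R \<nu> \<in> closed_segment a b}"
        then obtain u where u: "s *\<^sub>R e + t *\<^sub>R \<nu> = (1 - u) *\<^sub>R a + u *\<^sub>R b"
          by (auto simp: closed_segment_def)
        have "s = (1 - u) * (a \<bullet> e) + u * (b \<bullet> e)"
          using arg_cong[OF u, of "\<lambda>x. x \<bullet> e"] o by (simp add: inner_simps)
        then have "s - a \<bullet> e = u * (b \<bullet> e - a \<bullet> e)" by (simp add: algebra_simps)
        then have "u = (s - a \<bullet> e) / (b \<bullet> e - a \<bullet> e)" using False by simp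
        moreover have "t = (1 - u) * (a \<bullet> \<nu>) + u * (b \<bullet> \<nu>)"
          using arg_cong[OF u, of "\<lambda>x. x \<bullet> \<nu>"] o by (simp add: inner_simps)
        ultimately show "t \<in> {(1 - (s - a \<bullet> e) / (b \<bullet> e - a \<bullet> e)) * (a \<bullet> \<nu>) + (s - a \<bullet> e) / (b \<bullet> e - a \<bullet> e) * (b \<bullet> \<nu>)}"
          by simp
      qed
      then have "finite {t. s *\<^sub>R e + t *\<^sub>R \<nu> \<in> closed_segment a b}"
        by (rule finite_subset) simp
      with inf show ?thesis by simp
    qed
  qed
  show ?thesis by (rule finite_subset[of _ "{a \<bullet> e}"]) (use * in auto)
qed

lemma finite_lines_overlapping_skeleton:
  assumes fr: "orthonormal_frame e \<nu>" and "finite \<T>" and "\<And>K. K \<in> \<T> \<Longrightarrow> 2 simplex K"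
  shows "finite {s. infinite {t. s *\<^sub>R e + t *\<^sub>R \<nu> \<in> (\<Union>K\<in>\<T>. K - interior K)}}"
proof -
  have "\<forall>K\<in>\<T>. \<exists>E. finite E \<and> K - interior K \<subseteq> (\<Union>(a, b)\<in>E. closed_segment a b)"
    using assms(3) triangle_diff_interior_subset_segments by metis
  then obtain E where E: "\<And>K. K \<in> \<T> \<Longrightarrow> finite (E K)"
      "\<And>K. K \<in> \<T> \<Longrightarrow> K - interior K \<subseteq> (\<Union>(a, b)\<in>E K. closed_segment a b)"
    by metis
  let ?F = "\<Union>K\<in>\<T>. E K"
  have F: "finite ?F" using assms(2) E(1) by blast
  have "{s. infinite {t. s *\<^sub>R e + t *\<^sub>R \<nu> \<in> (\<Union>K\<in>\<T>. K - interior K)}} \<subseteq>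
      (\<Union>(a, b)\<in>?F. {s. infinite {t. s *\<^sub>R e + t *\<^sub>R \<nu> \<in> closed_segment a b}})"
  proof (rule subsetI, rule ccontr)
    fix s assume s: "s \<in> {s. infinite {t. s *\<^sub>R e + t *\<^sub>R \<nu> \<in> (\<Union>K\<in>\<T>. K - interior K)}}"
      and "s \<notin> (\<Union>(a, b)\<in>?F. {s. infinite {t. s *\<^sub>R e + t *\<^sub>R \<nu> \<in> closed_segment a b}})"
    then have "finite (\<Union>(a, b)\<in>?F. {t. s *\<^sub>R e + t *\<^sub>R \<nu> \<in> closed_segment a b})"
      by (intro finite_UN_I[OF F]) auto
    moreover have "{t. s *\<^sub>R e + t *\<^sub>R \<nu> \<in> (\<Union>K\<in>\<T>. K - interior K)} \<subseteq>
        (\<Union>(a, b)\<in>?F. {t. s *\<^sub>R e + t *\<^sub>R \<nu> \<in> closed_segment a b})"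
      using E(2) by fastforce
    ultimately show False using s finite_subset by blast
  qed
  moreover have "finite (\<Union>(a, b)\<in>?F. {s. infinite {t. s *\<^sub>R e + t *\<^sub>R \<nu> \<in> closed_segment a b}})"
    using finite_lines_overlapping_segment[OF fr] by (intro finite_UN_I[OF F]) auto
  ultimately show ?thesis by (rule finite_subset)
qed

section \<open>Piecewise affine functions on a mesh, the error and its elementwise gradient\<close>

lemma quad_fun_eq: "quad_fun x = x \<bullet> x"
  by (cases x) (simp add: quad_fun_def power2_eq_square)

text \<open>No domain is mentioned, so that the whole mesh and the subset formed by the band
  elements can both be instances, with the same \<open>U\<close>, \<open>A\<close> and
  \<open>c\<close>. \<open>A K\<close> is the constant gradient of \<open>U\<close> on
  \<open>K\<close>.\<close>

locale piecewise_affine =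
  fixes \<T> :: "point set set" and U :: "point \<Rightarrow> real" and A :: "point set \<Rightarrow> point" and c :: "point set \<Rightarrow> real"
  assumes finite: "finite \<T>"
    and simplex: "K \<in> \<T> \<Longrightarrow> 2 simplex K"
    and interiors_disjoint: "K \<in> \<T> \<Longrightarrow> L \<in> \<T> \<Longrightarrow> K \<noteq> L \<Longrightarrow> interior K \<inter> interior L = {}"
    and affine: "K \<in> \<T> \<Longrightarrow> x \<in> K \<Longrightarrow> U x = A K \<bullet> x + c K"
begin

definition err :: "point \<Rightarrow> real" where
  "err x = quad_fun x - U x"

text \<open>The elementwise gradient of the error. As a finite sum of indicators it is globally
  defined, Borel and bounded; on the edges of the elements its values are arbitrary as far as
  integrals are concerned.\<close>

definition G :: "point \<Rightarrow> point" where
  "G x = (\<Sum>K\<in>\<T>. indicator (interior K) x *\<^sub>R (2 *\<^sub>R x - A K))"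

definition skeleton :: "point set" where
  "skeleton = (\<Union>K\<in>\<T>. K - interior K)"

lemma G_eq:
  assumes "K \<in> \<T>" "x \<in> interior K"
  shows "G x = 2 *\<^sub>R x - A K"
proof -
  have "G x = (\<Sum>L\<in>{K}. indicator (interior L) x *\<^sub>R (2 *\<^sub>R x - A L))"
    unfolding G_def using finite assms interiors_disjoint[of K]
    by (intro sum.mono_neutral_right) (auto simp: indicator_def)
  then show ?thesis using assms by simp
qed

lemma G_measurable [measurable]: "G \<in> borel_measurable borel"
  unfolding G_def by (intro borel_measurable_sum borel_measurable_scaleR) auto

lemma compact_Union: "compact (\<Union>\<T>)"
  using finite simplex triangle_compact by (intro compact_Union) auto

lemma G_bounded: "\<exists>B\<ge>0. \<forall>x. norm (G x) \<le> B"
proof -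
  obtain R where R: "\<And>x. x \<in> \<Union>\<T> \<Longrightarrow> norm x \<le> R"
    using compact_imp_bounded[OF compact_Union] by (auto simp: bounded_iff)
  define B where "B = (\<Sum>K\<in>\<T>. 2 * \<bar>R\<bar> + norm (A K))"
  have "norm (G x) \<le> B" for x
    unfolding G_def B_def
  proof (rule order_trans[OF norm_sum], rule sum_mono)
    fix K assume K: "K \<in> \<T>"
    show "norm (indicator (interior K) x *\<^sub>R (2 *\<^sub>R x - A K)) \<le> 2 * \<bar>R\<bar> + norm (A K)"
    proof (cases "x \<in> interior K")
      case True
      then have "norm x \<le> R" using R K interior_subset by blast
      then show ?thesis using True norm_triangle_ineq4[of "2 *\<^sub>R x" "A K"] by simp
    qed simp
  qed
  moreover have "B \<ge> 0" unfolding B_def by (intro sum_nonneg) auto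
  ultimately show ?thesis by blast
qed

text \<open>Pasting over finitely many closed sets: \<open>U\<close> is a single function, so the
  affine formulas of neighbouring elements agree where the elements meet.\<close>

lemma continuous_on_U: "continuous_on (\<Union>\<T>) U"
proof (rule continuous_on_closed_Union[of \<T> "\<lambda>K. K", simplified])
  fix K assume K: "K \<in> \<T>"
  then show "closed K" using simplex triangle_compact compact_imp_closed by blast
  have "continuous_on K (\<lambda>x. A K \<bullet> x + c K)" by (intro continuous_intros)
  then show "continuous_on K U"
    using affine[OF K] by (subst continuous_on_cong[OF refl]) auto
qed (rule finite)

lemma continuous_on_err: "continuous_on (\<Union>\<T>) err"
  unfolding err_def quad_fun_eq by (intro continuous_intros continuous_on_U)

lemma err_has_derivative:
  assumes K: "K \<in> \<T>" "x \<in> interior K"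
  shows "(err has_derivative (\<lambda>y. G x \<bullet> y)) (at x)"
proof (rule has_derivative_transform_within_open[where s = "interior K"])
  show "((\<lambda>x. x \<bullet> x - (A K \<bullet> x + c K)) has_derivative (\<lambda>y. G x \<bullet> y)) (at x)"
    by (auto intro!: derivative_eq_intros simp: G_eq[OF K] inner_simps inner_commute)
  show "y \<bullet> y - (A K \<bullet> y + c K) = err y" if "y \<in> interior K" for y
    using affine[OF K(1), of y] that interior_subset[of K] by (auto simp: err_def quad_fun_eq)
qed (use K in auto)

lemma interior_cases:
  assumes "x \<in> \<Union>\<T>" "x \<notin> skeleton"
  obtains K where "K \<in> \<T>" "x \<in> interior K"
  using assms by (auto simp: skeleton_def)

lemma finite_lines_overlapping:
  assumes "orthonormal_frame e \<nu>"
  shows "finite {s. infinite {t. s *\<^sub>R e + t *\<^sub>R \<nu> \<in> skeleton}}"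
  unfolding skeleton_def using finite_lines_overlapping_skeleton[OF assms finite simplex] .

lemma AE_finite_line:
  assumes "orthonormal_frame e \<nu>"
  shows "AE s in lborel. finite {t. s *\<^sub>R e + t *\<^sub>R \<nu> \<in> skeleton}"
proof -
  let ?N = "{s. infinite {t. s *\<^sub>R e + t *\<^sub>R \<nu> \<in> skeleton}}"
  have "?N \<in> null_sets lborel"
    using finite_lines_overlapping[OF assms] by (rule finite_imp_null_set_lborel)
  then have "AE s in lborel. s \<notin> ?N" by (rule AE_not_in)
  then show ?thesis by simp
qed

end

section \<open>Weak gradients\<close>

lemma test_function_support:
  assumes "test_function S \<phi> \<psi>"
  defines "C \<equiv> closure {x. \<phi> x \<noteq> 0}"
  shows "compact C" "C \<subseteq> S" "\<And>x. x \<notin> C \<Longrightarrow> \<phi> x = 0" "\<And>x. x \<notin> C \<Longrightarrow> \<psi> x = 0"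
    "continuous_on UNIV \<phi>" "continuous_on UNIV \<psi>"
    "\<And>x. (\<phi> has_derivative (\<lambda>y. \<psi> x \<bullet> y)) (at x)"
proof -
  show "compact C" "C \<subseteq> S" and d: "\<And>x. (\<phi> has_derivative (\<lambda>y. \<psi> x \<bullet> y)) (at x)"
    and "continuous_on UNIV \<psi>"
    using assms by (auto simp: test_function_def)
  show "continuous_on UNIV \<phi>"
    using d by (meson continuous_at_imp_continuous_on has_derivative_continuous)
  show 0: "\<phi> x = 0" if "x \<notin> C" for x
    using that closure_subset[of "{x. \<phi> x \<noteq> 0}"] unfolding C_def by blast
  show "\<psi> x = 0" if x: "x \<notin> C" for x
  proof -
    have "((\<lambda>_. 0) has_derivative (\<lambda>y. \<psi> x \<bullet> y)) (at x)"
    proof (rule has_derivative_transform_within_open[OF d])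
      show "open (- C)" unfolding C_def by (intro open_Compl closed_closure)
      show "x \<in> - C" using x by simp
      show "\<phi> y = 0" if "y \<in> - C" for y using 0[of y] that by blast
    qed
    then have "(\<lambda>y. \<psi> x \<bullet> y) = (\<lambda>_. 0)"
      by (rule has_derivative_unique) simp
    then have "\<psi> x \<bullet> \<psi> x = 0" by (rule fun_cong)
    then show ?thesis by simp
  qed
qed

section \<open>Continuously differentiable cut-off functions for boxes\<close>

definition bump1 :: "real \<Rightarrow> real \<Rightarrow> real \<Rightarrow> real" where
  "bump1 l u x = (max 0 (x - l))\<^sup>2 * (max 0 (u - x))\<^sup>2"

definition bump1' :: "real \<Rightarrow> real \<Rightarrow> real \<Rightarrow> real" where
  "bump1' l u x = 2 * max 0 (x - l) * (max 0 (u - x))\<^sup>2 - (max 0 (x - l))\<^sup>2 * (2 * max 0 (u - x))"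

text \<open>Squaring removes the kink of the positive part at 0. The result is once continuously
  differentiable, which is the regularity that \<open>test_function\<close> asks for.\<close>

lemma has_real_derivative_pos_part_square:
  "((\<lambda>x::real. (max 0 x)\<^sup>2) has_real_derivative 2 * max 0 x) (at x)"
proof -
  consider "x > 0" | "x < 0" | "x = 0" by linarith
  then show ?thesis
  proof cases
    case 1
    have "((\<lambda>x::real. x\<^sup>2) has_real_derivative 2 * max 0 x) (at x)"
      using 1 by (auto intro!: derivative_eq_intros)
    then show ?thesis
      by (rule has_field_derivative_transform_within_open[of _ _ _ "{0<..}"]) (use 1 in auto)
  next
    case 2
    have "((\<lambda>x::real. 0) has_real_derivative 2 * max 0 x) (at x)"
      using 2 by (auto intro!: derivative_eq_intros)
    then show ?thesis
      by (rule has_field_derivative_transform_within_open[of _ _ _ "{..<0}"]) (use 2 in auto)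
  next
    case 3
    have "((\<lambda>y::real. (max 0 y)\<^sup>2 / y) \<longlongrightarrow> 0) (at 0)"
    proof (rule Lim_null_comparison[of _ "\<lambda>y. \<bar>y\<bar>"])
      show "\<forall>\<^sub>F y::real in at 0. norm ((max 0 y)\<^sup>2 / y) \<le> \<bar>y\<bar>"
        by (auto simp: max_def power2_eq_square intro!: always_eventually)
      show "((\<lambda>y::real. \<bar>y\<bar>) \<longlongrightarrow> 0) (at 0)" by (auto intro!: tendsto_eq_intros)
    qed
    then show ?thesis using 3 by (simp add: has_field_derivative_iff)
  qed
qed

lemma bump1_derivative: "(bump1 l u has_real_derivative bump1' l u x) (at x)"
proof -
  note D = has_real_derivative_pos_part_square
  have 1: "((\<lambda>x. (max 0 (x - l))\<^sup>2) has_real_derivative 2 * max 0 (x - l) * 1) (at x)"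
    by (rule DERIV_chain'[OF _ D]) (auto intro!: derivative_eq_intros)
  have 2: "((\<lambda>x. (max 0 (u - x))\<^sup>2) has_real_derivative 2 * max 0 (u - x) * (-1)) (at x)"
    by (rule DERIV_chain'[OF _ D]) (auto intro!: derivative_eq_intros)
  show ?thesis
    unfolding bump1_def[abs_def] bump1'_def
    by (rule DERIV_cong[OF DERIV_mult[OF 1 2]]) (simp add: algebra_simps)
qed

lemma bump1_nonneg: "bump1 l u x \<ge> 0"
  by (simp add: bump1_def)

lemma bump1_pos_iff: "bump1 l u x > 0 \<longleftrightarrow> l < x \<and> x < u"
proof (cases "l < x \<and> x < u")
  case True
  then have "max 0 (x - l) = x - l" "max 0 (u - x) = u - x" by auto
  then show ?thesis using True by (simp add: bump1_def)
next
  case False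
  then have "max 0 (x - l) = 0 \<or> max 0 (u - x) = 0" by auto
  then show ?thesis using False by (auto simp: bump1_def)
qed

lemma mem_box_point: "x \<in> box l u \<longleftrightarrow> fst l < fst x \<and> fst x < fst u \<and> snd l < snd x \<and> snd x < snd u"
  for x :: point
proof -
  have b: "(Basis :: point set) = {(1, 0), (0, 1)}"
    by (auto simp: Basis_prod_def)
  have "x \<in> box l u \<longleftrightarrow> (\<forall>i\<in>{(1, 0), (0, 1)}. l \<bullet> i < x \<bullet> i \<and> x \<bullet> i < u \<bullet> i)"
    by (simp only: mem_box b)
  also have "\<dots> \<longleftrightarrow> fst l < fst x \<and> fst x < fst u \<and> snd l < snd x \<and> snd x < snd u"
    by (simp add: inner_prod_def)
  finally show ?thesis .
qed

text \<open>The product of the \<open>bump1\<close> factors is positive exactly on the open box. The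
  map w / (1 + w) squeezes its multiples into [0, 1], and as \<open>n\<close> grows they tend
  pointwise to the indicator of the open box.\<close>

definition bump :: "point \<Rightarrow> point \<Rightarrow> nat \<Rightarrow> point \<Rightarrow> real" where
  "bump l u n x = (let w = real n * (bump1 (fst l) (fst u) (fst x) * bump1 (snd l) (snd u) (snd x)) in w / (1 + w))"

definition bump_grad :: "point \<Rightarrow> point \<Rightarrow> nat \<Rightarrow> point \<Rightarrow> point" where
  "bump_grad l u n x =
    (real n / (1 + real n * (bump1 (fst l) (fst u) (fst x) * bump1 (snd l) (snd u) (snd x)))\<^sup>2) *\<^sub>R
      (bump1' (fst l) (fst u) (fst x) * bump1 (snd l) (snd u) (snd x),
       bump1 (fst l) (fst u) (fst x) * bump1' (snd l) (snd u) (snd x))"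

lemma continuous_bump1 [continuous_intros]: "continuous_on X f \<Longrightarrow> continuous_on X (\<lambda>x. bump1 l u (f x))"
  unfolding bump1_def by (intro continuous_intros)

lemma continuous_bump1' [continuous_intros]: "continuous_on X f \<Longrightarrow> continuous_on X (\<lambda>x. bump1' l u (f x))"
  unfolding bump1'_def by (intro continuous_intros)

lemma bump_range: "0 \<le> bump l u n x" "bump l u n x \<le> 1"
proof -
  have "0 \<le> real n * (bump1 (fst l) (fst u) (fst x) * bump1 (snd l) (snd u) (snd x))"
    using bump1_nonneg by (intro mult_nonneg_nonneg) auto
  then show "0 \<le> bump l u n x" "bump l u n x \<le> 1" by (auto simp: bump_def Let_def)
qed

lemma bump_eq_0: "x \<notin> box l u \<Longrightarrow> bump l u n x = 0"
proof -
  assume "x \<notin> box l u"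
  then have "\<not> bump1 (fst l) (fst u) (fst x) > 0 \<or> \<not> bump1 (snd l) (snd u) (snd x) > 0"
    unfolding mem_box_point bump1_pos_iff by blast
  then have "bump1 (fst l) (fst u) (fst x) = 0 \<or> bump1 (snd l) (snd u) (snd x) = 0"
    using bump1_nonneg by (metis less_eq_real_def)
  then show ?thesis by (auto simp: bump_def)
qed

lemma bump_tendsto: "(\<lambda>n. bump l u n x) \<longlonglongrightarrow> indicator (box l u) x"
proof (cases "x \<in> box l u")
  case True
  define w where "w = bump1 (fst l) (fst u) (fst x) * bump1 (snd l) (snd u) (snd x)"
  have w: "w > 0"
    using True unfolding w_def mem_box_point by (intro mult_pos_pos) (auto simp: bump1_pos_iff)
  have "(\<lambda>n. 1 - 1 / (1 + real n * w)) \<longlonglongrightarrow> 1 - 0"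
  proof (intro tendsto_intros)
    have "filterlim (\<lambda>n. w * real n) at_top sequentially"
      by (rule filterlim_tendsto_pos_mult_at_top[OF tendsto_const w filterlim_real_sequentially])
    then have "filterlim (\<lambda>n. real n * w) at_top sequentially"
      by (simp add: mult.commute)
    then have "filterlim (\<lambda>n. 1 + real n * w) at_top sequentially"
      by (rule filterlim_tendsto_add_at_top[OF tendsto_const])
    then show "(\<lambda>n. 1 / (1 + real n * w)) \<longlonglongrightarrow> 0"
      using tendsto_divide_0[OF tendsto_const] filterlim_at_top_imp_at_infinity by blast
  qed
  moreover have "bump l u n x = 1 - 1 / (1 + real n * w)" for n
  proof -
    have "1 + real n * w > 0" using w by (simp add: add_pos_nonneg)
    then show ?thesis by (simp add: bump_def w_def Let_def field_simps)
  qed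
  ultimately show ?thesis using True by simp
qed (simp add: bump_eq_0)

lemma bump_has_derivative: "(bump l u n has_derivative (\<lambda>y. bump_grad l u n x \<bullet> y)) (at x)"
proof -
  define w where "w x = real n * (bump1 (fst l) (fst u) (fst x) * bump1 (snd l) (snd u) (snd x))" for x :: point
  have f: "((\<lambda>x. bump1 (fst l) (fst u) (fst x)) has_derivative (\<lambda>y. bump1' (fst l) (fst u) (fst x) * fst y)) (at x)"
    by (rule has_derivative_compose[OF _ bump1_derivative[unfolded has_field_derivative_def], where f = fst])
      (auto intro!: derivative_eq_intros)
  have s: "((\<lambda>x. bump1 (snd l) (snd u) (snd x)) has_derivative (\<lambda>y. bump1' (snd l) (snd u) (snd x) * snd y)) (at x)"
    by (rule has_derivative_compose[OF _ bump1_derivative[unfolded has_field_derivative_def], where f = snd])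
      (auto intro!: derivative_eq_intros)
  have w: "(w has_derivative (\<lambda>y. real n * (bump1 (fst l) (fst u) (fst x) * (bump1' (snd l) (snd u) (snd x) * snd y) +
      bump1' (fst l) (fst u) (fst x) * fst y * bump1 (snd l) (snd u) (snd x)))) (at x)"
    unfolding w_def by (intro has_derivative_mult_right has_derivative_mult f s)
  have pos: "1 + w x > 0"
    unfolding w_def using bump1_nonneg by (intro add_pos_nonneg mult_nonneg_nonneg) auto
  have "((\<lambda>z. z / (1 + z)) has_real_derivative 1 / (1 + w x)\<^sup>2) (at (w x))"
    using pos by (auto intro!: derivative_eq_intros simp: field_simps power2_eq_square)
  from has_derivative_compose[OF w this[unfolded has_field_derivative_def]]
  have "((\<lambda>x. w x / (1 + w x)) has_derivative (\<lambda>y. bump_grad l u n x \<bullet> y)) (at x)"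
    by (rule has_derivative_eq_rhs) (simp add: fun_eq_iff bump_grad_def w_def[symmetric] inner_prod_def algebra_simps add_divide_distrib)
  then show ?thesis
    by (simp add: bump_def[abs_def] w_def Let_def)
qed

lemma test_function_bump:
  assumes "cbox l u \<subseteq> S"
  shows "test_function S (bump l u n) (bump_grad l u n)"
proof -
  have nz: "1 + real n * (bump1 (fst l) (fst u) (fst x) * bump1 (snd l) (snd u) (snd x)) \<noteq> 0" for x
  proof -
    have "0 \<le> real n * (bump1 (fst l) (fst u) (fst x) * bump1 (snd l) (snd u) (snd x))"
      using bump1_nonneg by (intro mult_nonneg_nonneg) auto
    then show ?thesis by linarith
  qed
  have "closure {x. bump l u n x \<noteq> 0} \<subseteq> cbox l u"
    using bump_eq_0[of _ l u n] box_subset_cbox[of l u] by (intro closure_minimal closed_cbox) blast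
  moreover have "continuous_on UNIV (bump_grad l u n)"
    unfolding bump_grad_def using nz by (intro continuous_intros) auto
  ultimately show ?thesis
    using assms bump_has_derivative
      compact_Int_closed[OF compact_cbox[of l u] closed_closure[of "{x. bump l u n x \<noteq> 0}"]]
    unfolding test_function_def by (simp only: inf_absorb2) blast
qed

section \<open>Uniqueness and measurability of weak gradients\<close>

lemma AE_not_in_cbox_diff_box: "AE x in lborel. x \<notin> cbox l u - box l (u::'a::euclidean_space)"
proof -
  have "cbox l u - box l u \<in> null_sets lborel"
    using negligible_frontier_interval[of l u] by (simp add: negligible_iff_null_sets null_sets_completion_iff)
  then show ?thesis by (rule AE_not_in)
qed

text \<open>Open boxes form an intersection-stable generator of the Borel sets, so vanishing
  integrals spread to all Borel sets by Dynkin's argument. Complements need the integral over the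
  whole space; it vanishes because the space is an increasing union of boxes.\<close>

lemma AE_zero_of_box_integrals:
  fixes k :: "'a::euclidean_space \<Rightarrow> 'b::{second_countable_topology, banach}"
  assumes int: "integrable lborel k"
    and box: "\<And>a b. (LINT x:box a b|lborel. k x) = 0"
  shows "AE x in lborel. k x = 0"
proof (rule sigma_finite_measure.density_zero[OF lborel.sigma_finite_measure_axioms int])
  let ?E = "range (\<lambda>(a, b). box a b :: 'a set)"
  have si: "set_integrable lborel A k" if "A \<in> sets borel" for A
    using int that by (simp add: set_integrable_def integrable_mult_indicator)
  have total: "(LINT x|lborel. k x) = 0"
  proof -
    have "(\<lambda>i. LINT x:box (- (real i *\<^sub>R One)) (real i *\<^sub>R One :: 'a)|lborel. k x) \<longlonglongrightarrow>
        (LINT x:(\<Union>i. box (- (real i *\<^sub>R One)) (real i *\<^sub>R One :: 'a))|lborel. k x)"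
    proof (rule set_integral_cont_up)
      show "incseq (\<lambda>i. box (- (real i *\<^sub>R One)) (real i *\<^sub>R One :: 'a))"
        unfolding incseq_def by (intro allI impI subset_box_imp(4)) simp
    qed (auto intro!: si)
    then have "(LINT x:(\<Union>i. box (- (real i *\<^sub>R One)) (real i *\<^sub>R One :: 'a))|lborel. k x) = 0"
      by (simp add: box LIMSEQ_const_iff)
    then show ?thesis
      unfolding UN_box_eq_UNIV by (simp add: set_lebesgue_integral_def)
  qed
  fix A :: "'a set" assume "A \<in> sets lborel"
  then have A: "A \<in> sigma_sets UNIV ?E"
    by (simp add: borel_eq_box)
  have "Int_stable ?E" "?E \<subseteq> Pow UNIV"
    by (auto simp: Int_stable_def box_Int_box)
  from this A show "(LINT x:A|lborel. k x) = 0"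
  proof (induct rule: sigma_sets_induct_disjoint)
    case (basic A)
    then show ?case using box by auto
  next
    case empty
    show ?case by (simp add: set_lebesgue_integral_def)
  next
    case (compl A)
    then have "A \<in> sets borel" by (simp add: borel_eq_box)
    then have "(LINT x|lborel. k x) = (LINT x:A|lborel. k x) + (LINT x:UNIV - A|lborel. k x)"
      using set_integral_Un[of A "UNIV - A" lborel k] si by (auto simp: set_lebesgue_integral_def)
    then show ?case using compl total by simp
  next
    case (union A)
    have "A i \<in> sets borel" for i using union by (auto simp: borel_eq_box)
    then have "(LINT x:(\<Union>i. A i)|lborel. k x) = (\<Sum>i. LINT x:A i|lborel. k x)"
      using union si by (intro lebesgue_integral_countable_add) (auto simp: disjoint_family_on_def)
    then show ?case using union by simp
  qed
qed

text \<open>A weak gradient is only locally integrable. A continuous factor supported in a compact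
  part of \<open>S\<close> makes the product globally integrable, so that integrals against test
  functions may be subtracted.\<close>

lemma weak_gradient_scaled_integrable:
  assumes g: "\<And>C. compact C \<Longrightarrow> C \<subseteq> S \<Longrightarrow> set_integrable lborel C g"
    and C: "compact C" "C \<subseteq> S" and f: "continuous_on UNIV f" and z: "\<And>x. x \<notin> C \<Longrightarrow> f x = 0"
  shows "integrable lborel (\<lambda>x. indicator S x *\<^sub>R (f x *\<^sub>R (g x :: point)))"
proof -
  have "compact (f ` C)"
    using compact_continuous_image[OF continuous_on_subset[OF f] C(1)] by simp
  then obtain B where B: "\<And>x. x \<in> C \<Longrightarrow> norm (f x) \<le> B"
    using compact_imp_bounded bounded_iff by (metis imageI)
  have gC: "integrable lborel (\<lambda>x. indicator C x *\<^sub>R g x)"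
    using g[OF C] by (simp add: set_integrable_def)
  have fm [measurable]: "f \<in> borel_measurable borel"
    using f by (rule borel_measurable_continuous_onI)
  have "integrable lborel (\<lambda>x. f x *\<^sub>R (indicator C x *\<^sub>R g x))"
  proof (rule Bochner_Integration.integrable_bound)
    show "integrable lborel (\<lambda>x. B *\<^sub>R (indicator C x *\<^sub>R g x))"
      using gC by (rule integrable_scaleR_right)
    show "(\<lambda>x. f x *\<^sub>R (indicator C x *\<^sub>R g x)) \<in> borel_measurable lborel"
      using borel_measurable_integrable[OF gC] by measurable
    show "AE x in lborel. norm (f x *\<^sub>R (indicator C x *\<^sub>R g x)) \<le> norm (B *\<^sub>R (indicator C x *\<^sub>R g x))"
      using B by (intro always_eventually allI)
        (auto simp: indicator_def intro!: mult_right_mono intro: order_trans[OF _ abs_ge_self])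
  qed
  moreover have "indicator S x *\<^sub>R (f x *\<^sub>R g x) = f x *\<^sub>R (indicator C x *\<^sub>R g x)" for x
    using z[of x] C(2) by (auto simp: indicator_def)
  ultimately show ?thesis by (simp only:)
qed

text \<open>The fundamental lemma of the calculus of variations. The difference \<open>k\<close>
  integrates to zero against the bumps, hence by dominated convergence over every box whose closed
  box lies in \<open>S\<close>; this is localised to closed boxes, where \<open>k\<close> is
  integrable.\<close>

lemma weak_gradient_unique:
  assumes S: "open S" and g: "weak_gradient S v g" and g': "weak_gradient S v g'"
  shows "AE x in lborel. x \<in> S \<longrightarrow> g x = g' x"
proof -
  define k where "k x = g x - g' x" for x
  have lg: "\<And>C. compact C \<Longrightarrow> C \<subseteq> S \<Longrightarrow> set_integrable lborel C g"
    and lg': "\<And>C. compact C \<Longrightarrow> C \<subseteq> S \<Longrightarrow> set_integrable lborel C g'"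
    using g g' by (auto simp: weak_gradient_def)
  then have lk: "set_integrable lborel C k" if "compact C" "C \<subseteq> S" for C
    unfolding k_def using that by (intro set_integral_diff) auto
  have test: "(LINT x|lborel. indicator S x *\<^sub>R (\<phi> x *\<^sub>R k x)) = 0" if t: "test_function S \<phi> \<psi>" for \<phi> \<psi>
  proof -
    note s = test_function_support[OF t]
    have "(LINT x:S|lborel. v x *\<^sub>R \<psi> x) = - (LINT x:S|lborel. \<phi> x *\<^sub>R g x)"
      "(LINT x:S|lborel. v x *\<^sub>R \<psi> x) = - (LINT x:S|lborel. \<phi> x *\<^sub>R g' x)"
      using g g' t unfolding weak_gradient_def by blast+
    then have "(LINT x:S|lborel. \<phi> x *\<^sub>R g x) = (LINT x:S|lborel. \<phi> x *\<^sub>R g' x)"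
      by simp
    then show ?thesis
      using weak_gradient_scaled_integrable[OF lg s(1,2,5,3)] weak_gradient_scaled_integrable[OF lg' s(1,2,5,3)]
      by (simp add: k_def set_lebesgue_integral_def scaleR_diff_right)
  qed
  have box0: "(LINT x:box l u|lborel. k x) = 0" if lu: "cbox l u \<subseteq> S" for l u
  proof -
    have kC: "integrable lborel (\<lambda>x. indicator (cbox l u) x *\<^sub>R k x)"
      using lk[OF compact_cbox lu] by (simp add: set_integrable_def)
    have kB: "integrable lborel (\<lambda>x. indicator (box l u) x *\<^sub>R k x)"
      using set_integrable_subset[OF lk[OF compact_cbox lu], of "box l u"] box_subset_cbox[of l u]
      by (simp add: set_integrable_def)
    have eq: "indicator S x *\<^sub>R (bump l u n x *\<^sub>R k x) = bump l u n x *\<^sub>R (indicator (cbox l u) x *\<^sub>R k x)" for n x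
      using bump_eq_0[of x l u n] lu box_subset_cbox[of l u] by (auto simp: indicator_def)
    have bm: "bump l u n \<in> borel_measurable borel" for n
      using test_function_support(5)[OF test_function_bump[OF lu]] by (rule borel_measurable_continuous_onI)
    have "(\<lambda>n. LINT x|lborel. bump l u n x *\<^sub>R (indicator (cbox l u) x *\<^sub>R k x)) \<longlonglongrightarrow>
        (LINT x|lborel. indicator (box l u) x *\<^sub>R k x)"
    proof (rule integral_dominated_convergence)
      show "integrable lborel (\<lambda>x. norm (indicator (cbox l u) x *\<^sub>R k x))"
        using kC by (rule integrable_norm)
      show "(\<lambda>x. indicator (box l u) x *\<^sub>R k x) \<in> borel_measurable lborel"
        using kB by (rule borel_measurable_integrable)
      show "(\<lambda>x. bump l u n x *\<^sub>R (indicator (cbox l u) x *\<^sub>R k x)) \<in> borel_measurable lborel" for n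
        using borel_measurable_integrable[OF kC] bm[of n] by measurable
      show "AE x in lborel. (\<lambda>n. bump l u n x *\<^sub>R (indicator (cbox l u) x *\<^sub>R k x)) \<longlonglongrightarrow> indicator (box l u) x *\<^sub>R k x"
      proof (intro always_eventually allI)
        fix x
        have "(\<lambda>n. bump l u n x *\<^sub>R (indicator (cbox l u) x *\<^sub>R k x)) \<longlonglongrightarrow>
            indicator (box l u) x *\<^sub>R (indicator (cbox l u) x *\<^sub>R k x)"
          by (intro tendsto_intros bump_tendsto)
        moreover have "indicator (box l u) x *\<^sub>R (indicator (cbox l u) x *\<^sub>R k x) = indicator (box l u) x *\<^sub>R k x"
          using box_subset_cbox[of l u] by (auto simp: indicator_def)
        ultimately show "(\<lambda>n. bump l u n x *\<^sub>R (indicator (cbox l u) x *\<^sub>R k x)) \<longlonglongrightarrow> indicator (box l u) x *\<^sub>R k x"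
          by (simp only:)
      qed
      show "AE x in lborel. norm (bump l u n x *\<^sub>R (indicator (cbox l u) x *\<^sub>R k x))
          \<le> norm (indicator (cbox l u) x *\<^sub>R k x)" for n
      proof (intro always_eventually allI)
        fix x
        have "norm (bump l u n x *\<^sub>R (indicator (cbox l u) x *\<^sub>R k x)) =
            bump l u n x * norm (indicator (cbox l u) x *\<^sub>R k x)"
          using bump_range(1)[of l u n x] by (subst norm_scaleR) (simp only: abs_of_nonneg)
        then show "norm (bump l u n x *\<^sub>R (indicator (cbox l u) x *\<^sub>R k x)) \<le> norm (indicator (cbox l u) x *\<^sub>R k x)"
          using mult_right_mono[OF bump_range(2)[of l u n x] norm_ge_zero[of "indicator (cbox l u) x *\<^sub>R k x"]]
          by (simp only: mult_1_left)
      qed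
    qed
    moreover have "(LINT x|lborel. bump l u n x *\<^sub>R (indicator (cbox l u) x *\<^sub>R k x)) = 0" for n
      using test[OF test_function_bump[OF lu], of n] unfolding eq .
    ultimately show ?thesis
      by (simp add: LIMSEQ_const_iff set_lebesgue_integral_def)
  qed
  have cbox0: "AE x in lborel. x \<in> cbox l u \<longrightarrow> k x = 0" if lu: "cbox l u \<subseteq> S" for l u
  proof -
    have "AE x in lborel. indicator (cbox l u) x *\<^sub>R k x = 0"
    proof (rule AE_zero_of_box_integrals)
      show int: "integrable lborel (\<lambda>x. indicator (cbox l u) x *\<^sub>R k x)"
        using lk[OF compact_cbox lu] by (simp add: set_integrable_def)
      fix a b
      obtain l' u' where lu': "box a b \<inter> box l u = box l' u'"
        unfolding box_Int_box by blast
      \<comment> \<open>A closed box and its open box differ by a null set, so the intersection may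
        be treated as an open box again.\<close>
      have ae: "AE x in lborel. indicator (box a b) x *\<^sub>R (indicator (cbox l u) x *\<^sub>R k x) =
          indicator (box l' u') x *\<^sub>R k x"
        using AE_not_in_cbox_diff_box[of l u]
        by eventually_elim (use box_subset_cbox[of l u] in \<open>auto simp: indicator_def lu'[symmetric]\<close>)
      have ib: "integrable lborel (\<lambda>x. indicator (box a b) x *\<^sub>R (indicator (cbox l u) x *\<^sub>R k x))"
        by (rule integrable_mult_indicator[OF _ int]) simp
      have meas: "(\<lambda>x. indicator (box l' u') x *\<^sub>R k x) \<in> borel_measurable lborel"
      proof -
        have "indicator (box l' u') x *\<^sub>R k x = indicator (box l' u') x *\<^sub>R (indicator (cbox l u) x *\<^sub>R k x)" for x
          using lu' box_subset_cbox[of l u] by (auto simp: indicator_def)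
        moreover have "(\<lambda>x. indicator (box l' u') x *\<^sub>R (indicator (cbox l u) x *\<^sub>R k x)) \<in> borel_measurable lborel"
          by (intro borel_measurable_scaleR borel_measurable_indicator borel_measurable_integrable[OF int]) simp
        ultimately show ?thesis by (simp only:)
      qed
      have eq: "(LINT x:box a b|lborel. indicator (cbox l u) x *\<^sub>R k x) = (LINT x:box l' u'|lborel. k x)"
        unfolding set_lebesgue_integral_def
        by (rule integral_cong_AE[OF borel_measurable_integrable[OF ib] meas ae])
      show "(LINT x:box a b|lborel. indicator (cbox l u) x *\<^sub>R k x) = 0"
      \<comment> \<open>For a nonempty open box the closed box is its closure and therefore stays
        inside \<open>S\<close>, as \<open>box0\<close> requires; for an empty one nothing is known
        about \<open>cbox l' u'\<close>.\<close>
      proof (cases "box l' u' = {}")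
        case True
        then show ?thesis unfolding eq by (simp add: set_lebesgue_integral_def)
      next
        case False
        have "cbox l' u' = closure (box l' u')" using closure_box[OF False] by simp
        also have "\<dots> \<subseteq> cbox l u"
          using lu' box_subset_cbox[of l u] by (intro closure_minimal closed_cbox) blast
        finally have "cbox l' u' \<subseteq> S" using lu by (rule order_trans)
        then show ?thesis unfolding eq by (rule box0)
      qed
    qed
    then show ?thesis by eventually_elim (auto simp: indicator_def)
  qed
  \<comment> \<open>A countable cover by closed boxes turns equality almost everywhere on each box
    into equality almost everywhere on \<open>S\<close>.\<close>
  obtain D where D: "countable D" "D \<subseteq> Pow S" "\<forall>X\<in>D. \<exists>a b. X = cbox a b" "\<Union>D = S"
  proof (rule open_countable_Union_open_cbox[OF S])
    fix E assume E: "countable E" "E \<subseteq> Pow S" "\<And>X. X \<in> E \<Longrightarrow> \<exists>a b. X = cbox a b" "\<Union>E = S"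
    show thesis by (rule that[OF E(1,2) ballI[OF E(3)] E(4)])
  qed
  have "\<forall>X\<in>D. AE x in lborel. x \<in> X \<longrightarrow> k x = 0"
  proof (rule ballI)
    fix X assume "X \<in> D"
    obtain a b where X: "X = cbox a b" using bspec[OF D(3) \<open>X \<in> D\<close>] by (elim exE)
    have "cbox a b \<subseteq> S" using subsetD[OF D(2) \<open>X \<in> D\<close>] unfolding X by (rule PowD)
    then show "AE x in lborel. x \<in> X \<longrightarrow> k x = 0" unfolding X by (rule cbox0)
  qed
  then have "AE x in lborel. \<forall>X\<in>D. x \<in> X \<longrightarrow> k x = 0"
    by (rule iffD2[OF AE_ball_countable[OF D(1), where M = lborel and P = "\<lambda>x X. x \<in> X \<longrightarrow> k x = 0"]])
  then show ?thesis
  proof eventually_elim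
    fix x assume x: "\<forall>X\<in>D. x \<in> X \<longrightarrow> k x = 0"
    show "x \<in> S \<longrightarrow> g x = g' x"
    proof
      assume "x \<in> S"
      then have "k x = 0" using x D(4) by blast
      then show "g x = g' x" by (simp add: k_def)
    qed
  qed
qed

text \<open>The definition gives measurability on compact subsets only. An increasing exhaustion by
  compact sets carries it over to \<open>S\<close> as a pointwise limit.\<close>

lemma weak_gradient_measurable:
  assumes "open S" "weak_gradient S v g"
  shows "(\<lambda>x. indicator S x *\<^sub>R g x) \<in> borel_measurable lborel"
proof -
  obtain C :: "nat \<Rightarrow> point set" where C: "\<And>n. compact (C n)" "\<And>n. C n \<subseteq> S" "\<And>n. C n \<subseteq> interior (C (Suc n))"
      "\<Union>(range C) = S"
    using open_Union_compact_subsets[OF assms(1)] by metis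
  have inc: "incseq C"
    using C(3) interior_subset by (intro incseq_SucI) blast
  show ?thesis
  proof (rule borel_measurable_LIMSEQ_metric)
    fix n
    have "set_integrable lborel (C n) g"
      using assms(2) C(1)[of n] C(2)[of n] unfolding weak_gradient_def by blast
    then show "(\<lambda>x. indicator (C n) x *\<^sub>R g x) \<in> borel_measurable lborel"
      unfolding set_integrable_def by (rule borel_measurable_integrable)
  next
    fix x
    show "(\<lambda>n. indicator (C n) x *\<^sub>R g x) \<longlonglongrightarrow> indicator S x *\<^sub>R g x"
      by (rule tendsto_scaleR[OF LIMSEQ_indicator_incseq[OF inc, unfolded C(4)] tendsto_const])
  qed
qed

lemma frame_line_notin_ball:
  assumes "orthonormal_frame e \<nu>" "\<bar>t\<bar> > R"
  shows "norm (s *\<^sub>R e + t *\<^sub>R \<nu>) > R"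
proof -
  have "\<bar>t\<bar> = \<bar>(s *\<^sub>R e + t *\<^sub>R \<nu>) \<bullet> \<nu>\<bar>"
    using orthonormal_frame_simps[OF assms(1)] by (simp add: inner_simps)
  also have "\<dots> \<le> norm (s *\<^sub>R e + t *\<^sub>R \<nu>) * norm \<nu>" by (rule Cauchy_Schwarz_ineq2)
  finally show ?thesis using assms by (simp add: orthonormal_frame_def)
qed

section \<open>The elementwise gradient is the weak gradient of the error\<close>

context piecewise_affine
begin

lemma set_integrable_G:
  assumes C: "compact C"
  shows "set_integrable lborel C G"
proof -
  obtain B where B: "\<And>x. norm (G x) \<le> B" using G_bounded by blast
  have "integrable lborel (\<lambda>x. indicator C x *\<^sub>R B)"
    using borel_integrable_compact[OF C, of "\<lambda>_. B"] by simp
  then show ?thesis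
    unfolding set_integrable_def
  proof (rule Bochner_Integration.integrable_bound)
    show "(\<lambda>x. indicat_real C x *\<^sub>R G x) \<in> borel_measurable lborel"
      using C by (intro borel_measurable_scaleR borel_measurable_indicator) (auto intro: borel_compact)
    show "AE x in lborel. norm (indicat_real C x *\<^sub>R G x) \<le> norm (indicat_real C x *\<^sub>R B)"
      using B by (intro always_eventually allI) (auto simp: indicator_def intro: order_trans[OF _ abs_ge_self])
  qed
qed

text \<open>The integrand is the derivative in direction \<nu> of the product of the error and the
  test function. On almost every line this product is continuous, differentiable off finitely many
  points and zero far out, so the integral along the line vanishes. Continuity across edges is what
  rules out jump terms.\<close>

lemma weak_gradient_component:
  assumes S: "open S" "S \<subseteq> \<Union>\<T>" and t: "test_function S \<phi> \<psi>" and fr: "orthonormal_frame e \<nu>"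
  defines "C \<equiv> closure {x. \<phi> x \<noteq> 0}"
  shows "(LINT x|lborel. indicator C x *\<^sub>R (err x * (\<psi> x \<bullet> \<nu>) + \<phi> x * (G x \<bullet> \<nu>))) = 0"
proof (rule integral_zero_of_lines[OF _ fr])
  note s = test_function_support[OF t, folded C_def]
  define Z where "Z x = indicator C x *\<^sub>R (err x * (\<psi> x \<bullet> \<nu>) + \<phi> x * (G x \<bullet> \<nu>))" for x
  have errC: "continuous_on C err"
    using continuous_on_err s(2) S(2) by (rule continuous_on_subset[OF _ order_trans])
  have cont: "continuous_on C (\<lambda>x. err x * (\<psi> x \<bullet> \<nu>))"
    using errC s(6) by (intro continuous_intros) (auto intro: continuous_on_subset)
  have int1: "integrable lborel (\<lambda>x. indicator C x *\<^sub>R (err x * (\<psi> x \<bullet> \<nu>)))"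
    using s(1) cont by (rule borel_integrable_compact)
  obtain B1 where B1: "\<And>x. x \<in> C \<Longrightarrow> norm (err x * (\<psi> x \<bullet> \<nu>)) \<le> B1"
    using compact_imp_bounded[OF compact_continuous_image[OF cont s(1)]] by (auto simp: bounded_iff)
  obtain B2 where B2: "\<And>x. x \<in> C \<Longrightarrow> norm (\<phi> x) \<le> B2"
    using compact_imp_bounded[OF compact_continuous_image[OF continuous_on_subset[OF s(5)] s(1)]]
    by (auto simp: bounded_iff)
  obtain B3 where B3: "\<And>x. norm (G x) \<le> B3" "B3 \<ge> 0" using G_bounded by blast
  define B where "B = \<bar>B1\<bar> + \<bar>B2\<bar> * B3"
  have B: "norm (Z x) \<le> B" for x
  proof (cases "x \<in> C")
    case True
    have "\<bar>G x \<bullet> \<nu>\<bar> \<le> norm (G x) * norm \<nu>" by (rule Cauchy_Schwarz_ineq2)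
    then have "\<bar>G x \<bullet> \<nu>\<bar> \<le> B3" using B3(1)[of x] fr by (simp add: orthonormal_frame_def)
    then have "\<bar>\<phi> x\<bar> * \<bar>G x \<bullet> \<nu>\<bar> \<le> \<bar>B2\<bar> * B3"
      using B2[OF True] B3(2) by (intro mult_mono) auto
    moreover have "\<bar>err x * (\<psi> x \<bullet> \<nu>)\<bar> \<le> \<bar>B1\<bar>" using B1[OF True] by simp
    moreover have "\<bar>Z x\<bar> \<le> \<bar>err x * (\<psi> x \<bullet> \<nu>)\<bar> + \<bar>\<phi> x\<bar> * \<bar>G x \<bullet> \<nu>\<bar>"
      using True abs_triangle_ineq[of "err x * (\<psi> x \<bullet> \<nu>)" "\<phi> x * (G x \<bullet> \<nu>)"] by (simp add: Z_def abs_mult)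
    ultimately show ?thesis unfolding B_def real_norm_def by linarith
  next
    case False
    then show ?thesis using B3(2) by (simp add: Z_def B_def)
  qed
  have "Z x = indicator C x *\<^sub>R (err x * (\<psi> x \<bullet> \<nu>)) + \<phi> x * (G x \<bullet> \<nu>)" for x
    using s(3)[of x] by (cases "x \<in> C") (simp_all add: Z_def)
  moreover have "(\<lambda>x. \<phi> x * (G x \<bullet> \<nu>)) \<in> borel_measurable borel"
    using borel_measurable_continuous_onI[OF s(5)] by measurable
  ultimately have Zm: "Z \<in> borel_measurable borel"
    using borel_measurable_integrable[OF int1] by (simp add: borel_measurable_add cong: measurable_cong)
  show "integrable lborel (\<lambda>x. indicator C x *\<^sub>R (err x * (\<psi> x \<bullet> \<nu>) + \<phi> x * (G x \<bullet> \<nu>)))"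
    unfolding Z_def[symmetric]
  proof (rule Bochner_Integration.integrable_bound[where f = "\<lambda>x. indicator C x *\<^sub>R B"])
    show "integrable lborel (\<lambda>x. indicator C x *\<^sub>R B)"
      using s(1) by (rule borel_integrable_compact) auto
    show "AE x in lborel. norm (Z x) \<le> norm (indicator C x *\<^sub>R B)"
    proof (intro always_eventually allI)
      fix x show "norm (Z x) \<le> norm (indicator C x *\<^sub>R B)"
        using B[of x] by (cases "x \<in> C") (auto simp: Z_def intro: order_trans[OF _ abs_ge_self])
    qed
  qed (use Zm in simp)
  obtain R where R: "R > 0" "\<And>x. x \<in> C \<Longrightarrow> norm x \<le> R"
    using compact_imp_bounded[OF s(1)] by (auto simp: bounded_pos)
  show "AE s in lborel. (LINT t|lborel. indicator C (s *\<^sub>R e + t *\<^sub>R \<nu>) *\<^sub>R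
      (err (s *\<^sub>R e + t *\<^sub>R \<nu>) * (\<psi> (s *\<^sub>R e + t *\<^sub>R \<nu>) \<bullet> \<nu>) + \<phi> (s *\<^sub>R e + t *\<^sub>R \<nu>) * (G (s *\<^sub>R e + t *\<^sub>R \<nu>) \<bullet> \<nu>))) = 0"
    using AE_finite_line[OF fr] unfolding Z_def[symmetric]
  proof eventually_elim
    fix s assume fin: "finite {t. s *\<^sub>R e + t *\<^sub>R \<nu> \<in> skeleton}"
    define l where "l t = s *\<^sub>R e + t *\<^sub>R \<nu>" for t
    \<comment> \<open>Off \<Union>\<T> nothing is known about \<open>err\<close>, hence the
      extension by zero. Continuity holds on the two open sets \<open>S\<close> and
      \<open>- C\<close>, which together cover the plane.\<close>
    define w where "w x = (if x \<in> S then err x * \<phi> x else 0)" for x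
    have wC: "w x = 0" if "x \<notin> C" for x using s(3) that by (simp add: w_def)
    have l: "(l has_derivative (\<lambda>h. h *\<^sub>R \<nu>)) (at t)" for t
      unfolding l_def by (auto intro!: derivative_eq_intros)
    have "continuous_on (S \<union> - C) w"
    proof (rule continuous_on_open_Un)
      have "continuous_on S (\<lambda>x. err x * \<phi> x)"
        by (intro continuous_intros continuous_on_subset[OF continuous_on_err S(2)] continuous_on_subset[OF s(5)]) auto
      then show "continuous_on S w" by (subst continuous_on_cong[OF refl]) (auto simp: w_def)
      show "continuous_on (- C) w"
        using wC by (subst continuous_on_cong[OF refl, of _ _ "\<lambda>_. 0"]) auto
      show "open (- C)" unfolding C_def by (intro open_Compl closed_closure)
    qed (rule S)
    moreover have "S \<union> - C = UNIV" using s(2) by blast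
    ultimately have "continuous_on UNIV w" by simp
    then have wl: "continuous_on {a..b} (\<lambda>t. w (l t))" for a b
      by (rule continuous_on_compose2) (auto simp: l_def intro!: continuous_intros)
    have der: "((\<lambda>t. w (l t)) has_vector_derivative Z (l t)) (at t)" if nsk: "l t \<notin> skeleton" for t
    proof (cases "l t \<in> S")
      case True
      obtain K where K: "K \<in> \<T>" "l t \<in> interior K"
        using interior_cases[OF subsetD[OF S(2) True] nsk] .
      have "((\<lambda>x. err x * \<phi> x) has_derivative (\<lambda>y. err (l t) * (\<psi> (l t) \<bullet> y) + (G (l t) \<bullet> y) * \<phi> (l t))) (at (l t))"
        by (intro has_derivative_mult err_has_derivative[OF K] s(7))
      then have "(w has_derivative (\<lambda>y. err (l t) * (\<psi> (l t) \<bullet> y) + (G (l t) \<bullet> y) * \<phi> (l t))) (at (l t))"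
        by (rule has_derivative_transform_within_open[OF _ S(1) True]) (simp add: w_def)
      from has_derivative_compose[OF l this]
      have "((\<lambda>t. w (l t)) has_derivative (\<lambda>h. h *\<^sub>R (err (l t) * (\<psi> (l t) \<bullet> \<nu>) + \<phi> (l t) * (G (l t) \<bullet> \<nu>)))) (at t)"
        by (rule has_derivative_eq_rhs) (simp add: fun_eq_iff algebra_simps)
      moreover have "err (l t) * (\<psi> (l t) \<bullet> \<nu>) + \<phi> (l t) * (G (l t) \<bullet> \<nu>) = Z (l t)"
        using s(3,4)[of "l t"] by (cases "l t \<in> C") (simp_all add: Z_def)
      ultimately show ?thesis by (simp add: has_vector_derivative_def)
    next
      case False
      then have nC: "l t \<in> - C" using s(2) by blast
      have "((\<lambda>_. 0) has_vector_derivative Z (l t)) (at t)"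
        using nC by (simp add: Z_def)
      moreover have "open (l -` (- C))"
        using s(1) by (intro open_vimage open_Compl compact_imp_closed) (auto simp: l_def[abs_def] intro!: continuous_intros)
      ultimately show ?thesis
        using nC wC by (rule_tac has_vector_derivative_transform_within_open[of "\<lambda>_. 0" _ _ "l -` (- C)"]) auto
    qed
    \<comment> \<open>\<open>R\<close> bounds the support of the test function, so \<open>w\<close>
      is zero at both endpoints.\<close>
    have hi: "((\<lambda>t. Z (l t)) has_integral (w (l (R + 1)) - w (l (- R - 1)))) {- R - 1..R + 1}"
      using R(1) der wl by (intro fundamental_theorem_of_calculus_interior_strong[OF fin[folded l_def]]) auto
    have out: "l t \<notin> C" if "\<bar>t\<bar> > R" for t
      using R(2)[of "l t"] frame_line_notin_ball[OF fr that, of s] by (auto simp: l_def)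
    have lm: "(\<lambda>t. Z (l t)) \<in> borel_measurable borel"
      unfolding l_def by (rule measurable_compose[OF _ Zm]) measurable
    have si: "set_integrable lborel {- R - 1..R + 1} (\<lambda>t. Z (l t))"
      unfolding set_integrable_def
    proof (rule Bochner_Integration.integrable_bound[where f = "\<lambda>t. indicator {- R - 1..R + 1} t *\<^sub>R B"])
      show "integrable lborel (\<lambda>t. indicator {- R - 1..R + 1} t *\<^sub>R B)"
        by (rule borel_integrable_compact) auto
      show "(\<lambda>t. indicator {- R - 1..R + 1} t *\<^sub>R Z (l t)) \<in> borel_measurable lborel"
        using lm by simp
      show "AE t in lborel. norm (indicator {- R - 1..R + 1} t *\<^sub>R Z (l t)) \<le> norm (indicator {- R - 1..R + 1} t *\<^sub>R B)"
      proof (intro always_eventually allI)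
        fix t show "norm (indicator {- R - 1..R + 1} t *\<^sub>R Z (l t)) \<le> norm (indicator {- R - 1..R + 1} t *\<^sub>R B)"
          using B[of "l t"] by (auto simp: indicator_def)
      qed
    qed
    have Z0: "Z (l t) = 0" if "t \<notin> {- R - 1..R + 1}" for t
      using out[of t] that by (auto simp: Z_def)
    have "(LINT t|lborel. Z (l t)) = (LINT t:{- R - 1..R + 1}|lborel. Z (l t))"
      unfolding set_lebesgue_integral_def
    proof (rule Bochner_Integration.integral_cong[OF refl])
      fix t show "Z (l t) = indicator {- R - 1..R + 1} t *\<^sub>R Z (l t)"
        using Z0[of t] by (cases "t \<in> {- R - 1..R + 1}") auto
    qed
    also have "\<dots> = integral {- R - 1..R + 1} (\<lambda>t. Z (l t))"
      by (rule set_borel_integral_eq_integral(2)[OF si])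
    also have "\<dots> = w (l (R + 1)) - w (l (- R - 1))"
      by (rule integral_unique[OF hi])
    also have "\<dots> = 0"
      using wC[OF out[of "R + 1"]] wC[OF out[of "- R - 1"]] R(1) by simp
    finally show "(LINT t|lborel. Z (s *\<^sub>R e + t *\<^sub>R \<nu>)) = 0" by (simp add: l_def)
  qed
qed

lemma weak_gradient_G:
  assumes S: "open S" "S \<subseteq> \<Union>\<T>"
  shows "weak_gradient S err G"
  unfolding weak_gradient_def
proof (intro conjI allI impI)
  fix C assume C: "compact C \<and> C \<subseteq> S"
  then show "set_integrable lborel C err"
    unfolding set_integrable_def
    using continuous_on_subset[OF continuous_on_err] S(2) by (intro borel_integrable_compact) auto
  show "set_integrable lborel C G" using C set_integrable_G by blast
next
  fix \<phi> \<psi> assume t: "test_function S \<phi> \<psi>"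
  define C where "C = closure {x. \<phi> x \<noteq> 0}"
  note s = test_function_support[OF t, folded C_def]
  have errC: "continuous_on C err"
    using continuous_on_err s(2) S(2) by (rule continuous_on_subset[OF _ order_trans])
  have i1: "integrable lborel (\<lambda>x. indicator C x *\<^sub>R (err x *\<^sub>R \<psi> x))"
    using s(1) errC s(6) by (intro borel_integrable_compact continuous_intros) (auto intro: continuous_on_subset)
  have i2: "integrable lborel (\<lambda>x. indicator S x *\<^sub>R (\<phi> x *\<^sub>R G x))"
    by (rule weak_gradient_scaled_integrable[OF set_integrable_G s(1,2,5,3)])
  have e1: "indicator S x *\<^sub>R (err x *\<^sub>R \<psi> x) = indicator C x *\<^sub>R (err x *\<^sub>R \<psi> x)" for x
    using s(4)[of x] s(2) by (cases "x \<in> C") auto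
  have e2: "indicator S x *\<^sub>R (\<phi> x *\<^sub>R G x) = indicator C x *\<^sub>R (\<phi> x *\<^sub>R G x)" for x
    using s(3)[of x] s(2) by (cases "x \<in> C") auto
  define X where "X = (LINT x|lborel. indicator C x *\<^sub>R (err x *\<^sub>R \<psi> x)) + (LINT x|lborel. indicator C x *\<^sub>R (\<phi> x *\<^sub>R G x))"
  have comp: "X \<bullet> \<nu> = 0" if fr: "orthonormal_frame e \<nu>" for e \<nu>
  proof -
    have "X \<bullet> \<nu> = (LINT x|lborel. (indicator C x *\<^sub>R (err x *\<^sub>R \<psi> x)) \<bullet> \<nu>) + (LINT x|lborel. (indicator C x *\<^sub>R (\<phi> x *\<^sub>R G x)) \<bullet> \<nu>)"
      using i1 i2 unfolding e2 X_def by (subst (1 2) integral_inner_left) (auto simp: inner_add_left)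
    also have "\<dots> = (LINT x|lborel. (indicator C x *\<^sub>R (err x *\<^sub>R \<psi> x)) \<bullet> \<nu> + (indicator C x *\<^sub>R (\<phi> x *\<^sub>R G x)) \<bullet> \<nu>)"
      using i1 i2 unfolding e2 by (intro Bochner_Integration.integral_add[symmetric] integrable_inner_left) auto
    also have "\<dots> = (LINT x|lborel. indicator C x *\<^sub>R (err x * (\<psi> x \<bullet> \<nu>) + \<phi> x * (G x \<bullet> \<nu>)))"
      by (simp add: algebra_simps)
    also have "\<dots> = 0"
      unfolding C_def by (rule weak_gradient_component[OF S t fr])
    finally show ?thesis .
  qed
  \<comment> \<open>Two frames suffice: their second vectors are the two coordinate
    directions.\<close>
  have "X = 0"
    using comp[of "(1, 0)" "(0, 1)"] comp[of "(0, 1)" "(1, 0)"]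
    by (simp add: orthonormal_frame_def norm_prod_def inner_prod_def prod_eq_iff)
  then show "(LINT x:S|lborel. err x *\<^sub>R \<psi> x) = - (LINT x:S|lborel. \<phi> x *\<^sub>R G x)"
    unfolding set_lebesgue_integral_def e1 e2 X_def by (rule eq_neg_iff_add_eq_0[THEN iffD2])
qed

lemma set_integrable_norm_G_square:
  assumes S: "S \<in> sets borel" "S \<subseteq> \<Union>\<T>"
  shows "set_integrable lborel S (\<lambda>x. (norm (G x))\<^sup>2)"
proof -
  obtain B where B: "\<And>x. norm (G x) \<le> B" using G_bounded by blast
  have "integrable lborel (\<lambda>x. indicator (\<Union>\<T>) x *\<^sub>R B\<^sup>2)"
    by (rule borel_integrable_compact[OF compact_Union]) auto
  then show ?thesis
    unfolding set_integrable_def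
  proof (rule Bochner_Integration.integrable_bound)
    show "(\<lambda>x. indicator S x *\<^sub>R (norm (G x))\<^sup>2) \<in> borel_measurable lborel"
      using S(1) by simp
    show "AE x in lborel. norm (indicator S x *\<^sub>R (norm (G x))\<^sup>2) \<le> norm (indicator (\<Union>\<T>) x *\<^sub>R B\<^sup>2)"
      using B S(2) by (intro always_eventually allI) (auto simp: indicator_def intro: power_mono)
  qed
qed

text \<open>\<open>G\<close> witnesses that the choice in \<open>weak_grad\<close> is made from a
  nonempty set, and uniqueness identifies the chosen representative with \<open>G\<close> almost
  everywhere.\<close>

lemma h1_seminorm_square:
  assumes "interior M \<subseteq> \<Union>\<T>"
  shows "(h1_seminorm M err)\<^sup>2 = (LINT x:interior M|lborel. (norm (G x))\<^sup>2)"
proof -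
  let ?S = "interior M"
  let ?g = "weak_grad ?S err"
  have G: "weak_gradient ?S err G" using weak_gradient_G assms by simp
  then have g: "weak_gradient ?S err ?g"
    unfolding weak_grad_def by (rule someI[of "weak_gradient ?S err"])
  have m: "(\<lambda>x. indicator ?S x *\<^sub>R ?g x) \<in> borel_measurable lborel"
    using g by (intro weak_gradient_measurable) auto
  have eq: "indicator ?S x *\<^sub>R (norm (h x))\<^sup>2 = (norm (indicator ?S x *\<^sub>R h x))\<^sup>2" for h :: "point \<Rightarrow> point" and x
    by (simp add: indicator_def)
  have "(LINT x:?S|lborel. (norm (?g x))\<^sup>2) = (LINT x:?S|lborel. (norm (G x))\<^sup>2)"
    unfolding set_lebesgue_integral_def
  proof (rule integral_cong_AE)
    show "(\<lambda>x. indicator ?S x *\<^sub>R (norm (?g x))\<^sup>2) \<in> borel_measurable lborel"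
      unfolding eq using m by measurable
    show "(\<lambda>x. indicator ?S x *\<^sub>R (norm (G x))\<^sup>2) \<in> borel_measurable lborel"
      by simp
    show "AE x in lborel. indicator ?S x *\<^sub>R (norm (?g x))\<^sup>2 = indicator ?S x *\<^sub>R (norm (G x))\<^sup>2"
      using weak_gradient_unique[OF open_interior g G] by eventually_elim (auto simp: indicator_def)
  qed
  moreover have "0 \<le> (LINT x:?S|lborel. (norm (G x))\<^sup>2)"
    unfolding set_lebesgue_integral_def by (intro Bochner_Integration.integral_nonneg) auto
  ultimately show ?thesis by (simp add: h1_seminorm_def)
qed

end

section \<open>Traces on segments\<close>

text \<open>Cauchy-Schwarz against the constant 1, obtained from the nonnegativity of the variance:
  \<open>m\<close> is the mean of \<open>g\<close>.\<close>

lemma square_set_integral_le: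
  fixes g :: "real \<Rightarrow> real"
  assumes ab: "a < b" and g: "set_integrable lborel {a..b} g" and g2: "set_integrable lborel {a..b} (\<lambda>t. (g t)\<^sup>2)"
  shows "(LINT t:{a..b}|lborel. g t)\<^sup>2 \<le> (b - a) * (LINT t:{a..b}|lborel. (g t)\<^sup>2)"
proof -
  define m where "m = (LINT t:{a..b}|lborel. g t) / (b - a)"
  have c: "set_integrable lborel {a..b} (\<lambda>t. m\<^sup>2)"
    unfolding set_integrable_def by (rule borel_integrable_compact) auto
  have mg: "set_integrable lborel {a..b} (\<lambda>t. 2 * m * g t)"
    using g by (rule set_integrable_mult_right)
  have "0 \<le> (LINT t:{a..b}|lborel. (g t - m)\<^sup>2)"
    unfolding set_lebesgue_integral_def by (intro Bochner_Integration.integral_nonneg) auto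
  also have "(\<lambda>t. (g t - m)\<^sup>2) = (\<lambda>t. (g t)\<^sup>2 - 2 * m * g t + m\<^sup>2)"
    by (simp add: fun_eq_iff power2_eq_square algebra_simps)
  also have "(LINT t:{a..b}|lborel. (g t)\<^sup>2 - 2 * m * g t + m\<^sup>2) =
      (LINT t:{a..b}|lborel. (g t)\<^sup>2) - (LINT t:{a..b}|lborel. 2 * m * g t) + (LINT t:{a..b}|lborel. m\<^sup>2)"
    using set_integral_add(2)[OF set_integral_diff(1)[OF g2 mg] c] set_integral_diff(2)[OF g2 mg] by simp
  also have "(LINT t:{a..b}|lborel. 2 * m * g t) = 2 * m * (LINT t:{a..b}|lborel. g t)"
    by (rule set_integral_mult_right)
  also have "(LINT t:{a..b}|lborel. m\<^sup>2) = (b - a) * m\<^sup>2"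
    using ab by (simp add: set_lebesgue_integral_def)
  also have "(LINT t:{a..b}|lborel. g t) = m * (b - a)"
    using ab by (simp add: m_def)
  finally have "(b - a) * m\<^sup>2 \<le> (LINT t:{a..b}|lborel. (g t)\<^sup>2)"
    by (simp add: power2_eq_square algebra_simps)
  then have "(b - a) * ((b - a) * m\<^sup>2) \<le> (b - a) * (LINT t:{a..b}|lborel. (g t)\<^sup>2)"
    using ab by (intro mult_left_mono) auto
  moreover have "(b - a) * ((b - a) * m\<^sup>2) = (LINT t:{a..b}|lborel. g t)\<^sup>2"
    using ab by (simp add: m_def power2_eq_square)
  ultimately show ?thesis by simp
qed

lemma set_integrable_bounded:
  fixes g :: "real \<Rightarrow> real"
  assumes "g \<in> borel_measurable borel" "\<And>t. \<bar>g t\<bar> \<le> B"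
  shows "set_integrable lborel {a..b} g"
  unfolding set_integrable_def
proof (rule Bochner_Integration.integrable_bound[where f = "\<lambda>t. indicator {a..b} t *\<^sub>R B"])
  show "integrable lborel (\<lambda>t. indicator {a..b} t *\<^sub>R B)"
    by (rule borel_integrable_compact) auto
  show "(\<lambda>t. indicator {a..b} t *\<^sub>R g t) \<in> borel_measurable lborel"
    using assms(1) by simp
  show "AE t in lborel. norm (indicator {a..b} t *\<^sub>R g t) \<le> norm (indicator {a..b} t *\<^sub>R B)"
  proof (intro always_eventually allI)
    fix t show "norm (indicator {a..b} t *\<^sub>R g t) \<le> norm (indicator {a..b} t *\<^sub>R B)"
      using assms(2)[of t] by (auto simp: indicator_def)
  qed
qed

context piecewise_affine
begin

lemma err_difference_on_line:
  assumes fr: "orthonormal_frame e \<nu>" and fin: "finite {t. s *\<^sub>R e + t *\<^sub>R \<nu> \<in> skeleton}"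
    and ab: "a < b" and line: "\<And>t. t \<in> {a..b} \<Longrightarrow> s *\<^sub>R e + t *\<^sub>R \<nu> \<in> \<Union>\<T>"
  shows "(err (s *\<^sub>R e + b *\<^sub>R \<nu>) - err (s *\<^sub>R e + a *\<^sub>R \<nu>))\<^sup>2 \<le>
    (b - a) * (LINT t:{a..b}|lborel. (norm (G (s *\<^sub>R e + t *\<^sub>R \<nu>)))\<^sup>2)"
proof -
  define l where "l t = s *\<^sub>R e + t *\<^sub>R \<nu>" for t
  have l: "(l has_derivative (\<lambda>h. h *\<^sub>R \<nu>)) (at t)" for t
    unfolding l_def by (auto intro!: derivative_eq_intros)
  have lm [measurable]: "l \<in> borel_measurable borel"
    unfolding l_def by measurable
  obtain B where B: "\<And>x. norm (G x) \<le> B" "B \<ge> 0" using G_bounded by blast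
  have cs: "\<bar>G x \<bullet> \<nu>\<bar> \<le> norm (G x)" for x
    using Cauchy_Schwarz_ineq2[of "G x" \<nu>] fr by (simp add: orthonormal_frame_def)
  have g: "set_integrable lborel {a..b} (\<lambda>t. G (l t) \<bullet> \<nu>)"
    by (rule set_integrable_bounded[of _ B]) (measurable, rule order_trans[OF cs B(1)])
  have g2: "set_integrable lborel {a..b} (\<lambda>t. (G (l t) \<bullet> \<nu>)\<^sup>2)"
  proof (rule set_integrable_bounded[of _ "B\<^sup>2"])
    fix t show "\<bar>(G (l t) \<bullet> \<nu>)\<^sup>2\<bar> \<le> B\<^sup>2"
      using power_mono[OF order_trans[OF cs B(1)] abs_ge_zero, of "l t" 2] by simp
  qed measurable
  have G2: "set_integrable lborel {a..b} (\<lambda>t. (norm (G (l t)))\<^sup>2)"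
  proof (rule set_integrable_bounded[of _ "B\<^sup>2"])
    fix t show "\<bar>(norm (G (l t)))\<^sup>2\<bar> \<le> B\<^sup>2"
      using power_mono[OF B(1) norm_ge_zero, of "l t" 2] by simp
  qed measurable
  have "((\<lambda>t. G (l t) \<bullet> \<nu>) has_integral (err (l b) - err (l a))) {a..b}"
  proof (rule fundamental_theorem_of_calculus_interior_strong[OF fin[folded l_def]])
    show "a \<le> b" using ab by simp
    have "continuous_on {a..b} l" unfolding l_def by (intro continuous_intros)
    moreover have "l ` {a..b} \<subseteq> \<Union>\<T>" unfolding l_def using line by blast
    ultimately show "continuous_on {a..b} (\<lambda>t. err (l t))"
      by (rule continuous_on_compose2[OF continuous_on_err])
    fix t assume t: "t \<in> {a<..<b} - {t. l t \<in> skeleton}"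
    have "l t \<in> \<Union>\<T>" using line[of t] t unfolding l_def by (simp add: less_imp_le)
    moreover have "l t \<notin> skeleton" using t by blast
    ultimately obtain K where K: "K \<in> \<T>" "l t \<in> interior K"
      by (rule interior_cases)
    have "((\<lambda>t. err (l t)) has_derivative (\<lambda>h. G (l t) \<bullet> (h *\<^sub>R \<nu>))) (at t)"
      by (rule has_derivative_compose[OF l err_has_derivative[OF K]])
    then show "((\<lambda>t. err (l t)) has_vector_derivative G (l t) \<bullet> \<nu>) (at t)"
      by (simp add: has_vector_derivative_def)
  qed
  then have "(LINT t:{a..b}|lborel. G (l t) \<bullet> \<nu>) = err (l b) - err (l a)"
    using set_borel_integral_eq_integral(2)[OF g] by (simp add: integral_unique)
  then have "(err (l b) - err (l a))\<^sup>2 \<le> (b - a) * (LINT t:{a..b}|lborel. (G (l t) \<bullet> \<nu>)\<^sup>2)"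
    using square_set_integral_le[OF ab g g2] by simp
  also have "\<dots> \<le> (b - a) * (LINT t:{a..b}|lborel. (norm (G (l t)))\<^sup>2)"
  proof (intro mult_left_mono set_integral_mono[OF g2 G2])
    fix t show "(G (l t) \<bullet> \<nu>)\<^sup>2 \<le> (norm (G (l t)))\<^sup>2"
      using cs[of "l t"] by (metis abs_le_square_iff abs_norm_cancel)
  qed (use ab in simp)
  finally show ?thesis by (simp add: l_def)
qed

text \<open>The energy on one slice of the domain. Extended nonnegative values allow Tonelli's
  theorem to be applied without discussing the integrability of single slices.\<close>

definition line_energy :: "point set \<Rightarrow> point \<Rightarrow> point \<Rightarrow> real \<Rightarrow> ennreal" where
  "line_energy \<Omega> e \<nu> s = (\<integral>\<^sup>+t. indicator \<Omega> (s *\<^sub>R e + t *\<^sub>R \<nu>) * ennreal ((norm (G (s *\<^sub>R e + t *\<^sub>R \<nu>)))\<^sup>2) \<partial>lborel)"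

lemma line_energy_measurable:
  assumes [measurable]: "\<Omega> \<in> sets borel"
  shows "line_energy \<Omega> e \<nu> \<in> borel_measurable borel"
proof -
  have [measurable]: "(\<lambda>x. indicator \<Omega> x * ennreal ((norm (G x))\<^sup>2)) \<in> borel_measurable borel"
    by measurable
  have "(\<lambda>(s, t). s *\<^sub>R e + t *\<^sub>R \<nu>) \<in> borel \<Otimes>\<^sub>M borel \<rightarrow>\<^sub>M borel"
    by (simp add: case_prod_unfold)
  then show ?thesis
    unfolding line_energy_def by measurable
qed

lemma nn_integral_line_energy:
  assumes \<Omega>: "open \<Omega>" "\<Omega> \<subseteq> \<Union>\<T>" and fr: "orthonormal_frame e \<nu>"
  shows "(\<integral>\<^sup>+s. line_energy \<Omega> e \<nu> s \<partial>lborel) = ennreal ((h1_seminorm \<Omega> err)\<^sup>2)"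
proof -
  have \<Omega>b [measurable]: "\<Omega> \<in> sets borel" using \<Omega>(1) by simp
  have "(\<integral>\<^sup>+s. line_energy \<Omega> e \<nu> s \<partial>lborel) = (\<integral>\<^sup>+x. indicator \<Omega> x * ennreal ((norm (G x))\<^sup>2) \<partial>lborel)"
    unfolding line_energy_def by (rule nn_integral_orthonormal_frame[OF _ fr]) measurable
  also have "\<dots> = (\<integral>\<^sup>+x. ennreal (indicator \<Omega> x *\<^sub>R (norm (G x))\<^sup>2) \<partial>lborel)"
    by (rule nn_integral_cong) (simp add: indicator_def)
  also have "\<dots> = ennreal (LINT x:\<Omega>|lborel. (norm (G x))\<^sup>2)"
    unfolding set_lebesgue_integral_def
    using set_integrable_norm_G_square[OF \<Omega>b \<Omega>(2)] by (intro nn_integral_eq_integral) (auto simp: set_integrable_def)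
  finally show ?thesis
    using h1_seminorm_square[of \<Omega>] \<Omega> by (simp add: interior_open)
qed

text \<open>The line through the point in direction \<open>\<nu>\<close> is followed up to its first exit from
  \<open>\<Omega>\<close>, where the error is controlled by the interpolation error.\<close>
lemma err_square_le_line_energy:
  assumes fr: "orthonormal_frame e \<nu>" and fin: "finite {t. s *\<^sub>R e + t *\<^sub>R \<nu> \<in> skeleton}"
    and \<Omega>: "open \<Omega>" "bounded \<Omega>" "closure \<Omega> = \<Union>\<T>"
    and D: "\<And>x y. x \<in> closure \<Omega> \<Longrightarrow> y \<in> closure \<Omega> \<Longrightarrow> dist x y \<le> D"
    and \<beta>: "\<And>x. x \<in> frontier \<Omega> \<Longrightarrow> \<bar>err x\<bar> \<le> \<beta>"
    and a: "s *\<^sub>R e + a *\<^sub>R \<nu> \<in> closure \<Omega>"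
  shows "ennreal ((err (s *\<^sub>R e + a *\<^sub>R \<nu>))\<^sup>2) \<le> ennreal (2 * \<beta>\<^sup>2) + ennreal (2 * D) * line_energy \<Omega> e \<nu> s"
proof -
  define l where "l t = s *\<^sub>R e + t *\<^sub>R \<nu>" for t
  show ?thesis
  proof (cases "l a \<in> frontier \<Omega>")
    case True
    then have "(err (l a))\<^sup>2 \<le> \<beta>\<^sup>2"
      using power_mono[OF \<beta>[OF True] abs_ge_zero, of 2] by simp
    then have "ennreal ((err (l a))\<^sup>2) \<le> ennreal (2 * \<beta>\<^sup>2)"
      by (intro ennreal_leI) (use zero_le_power2[of \<beta>] in linarith)
    also have "\<dots> \<le> ennreal (2 * \<beta>\<^sup>2) + ennreal (2 * D) * line_energy \<Omega> e \<nu> s"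
      by simp
    finally show ?thesis by (simp add: l_def)
  next
    case False
    then have int: "l a \<in> interior \<Omega>" using a by (simp add: frontier_def l_def)
    have "\<nu> \<noteq> 0" using fr by (auto simp: orthonormal_frame_def)
    then obtain d where d: "0 < d" "l a + d *\<^sub>R \<nu> \<in> frontier \<Omega>"
        "\<And>t. \<lbrakk>0 \<le> t; t < d\<rbrakk> \<Longrightarrow> l a + t *\<^sub>R \<nu> \<in> interior \<Omega>"
      using ray_to_frontier[OF \<Omega>(2) int] by metis
    have shift: "l a + t *\<^sub>R \<nu> = l (a + t)" for t
      by (simp add: l_def algebra_simps)
    have inside: "l t \<in> \<Omega>" if "a \<le> t" "t < a + d" for t
      using d(3)[of "t - a"] that interior_subset[of \<Omega>] by (auto simp: shift)
    have exit: "l (a + d) \<in> frontier \<Omega>" using d(2) by (simp add: shift)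
    have cl: "l t \<in> \<Union>\<T>" if "t \<in> {a..a + d}" for t
    proof (cases "t = a + d")
      case True
      then show ?thesis using exit \<Omega>(3) by (auto simp: frontier_def)
    next
      case False
      then have "l t \<in> \<Omega>" using that by (intro inside) auto
      then show ?thesis using closure_subset \<Omega>(3) by blast
    qed
    define J where "J = (LINT t:{a..a + d}|lborel. (norm (G (l t)))\<^sup>2)"
    have lm [measurable]: "l \<in> borel_measurable borel"
      unfolding l_def by measurable
    obtain B where B: "\<And>x. norm (G x) \<le> B" "B \<ge> 0" using G_bounded by blast
    have G2: "set_integrable lborel {a..a + d} (\<lambda>t. (norm (G (l t)))\<^sup>2)"
    proof (rule set_integrable_bounded[of _ "B\<^sup>2"])
      fix t show "\<bar>(norm (G (l t)))\<^sup>2\<bar> \<le> B\<^sup>2"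
        using power_mono[OF B(1) norm_ge_zero, of "l t" 2] by simp
    qed measurable
    have J: "J \<ge> 0"
      unfolding J_def set_lebesgue_integral_def by (intro Bochner_Integration.integral_nonneg) auto
    have diff: "(err (l (a + d)) - err (l a))\<^sup>2 \<le> d * J"
      using err_difference_on_line[OF fr fin, of a "a + d"] d(1) cl unfolding J_def l_def by simp
    have "dist (l a) (l (a + d)) = d"
      using d(1) fr by (simp add: shift[symmetric] dist_norm orthonormal_frame_def)
    moreover have "dist (l a) (l (a + d)) \<le> D"
      using cl[of a] cl[of "a + d"] d(1) \<Omega>(3) by (intro D) auto
    ultimately have dD: "d \<le> D" by simp
    \<comment> \<open>The difference of the two sides is the square of 2 y - x, where x and y are
      the errors at the starting point and at the exit point.\<close>
    have "(err (l a))\<^sup>2 \<le> 2 * (err (l (a + d)))\<^sup>2 + 2 * (err (l (a + d)) - err (l a))\<^sup>2"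
      using zero_le_power2[of "2 * err (l (a + d)) - err (l a)"] by (simp add: power2_eq_square algebra_simps)
    also have "\<dots> \<le> 2 * \<beta>\<^sup>2 + 2 * (D * J)"
    proof -
      have "(err (l (a + d)))\<^sup>2 \<le> \<beta>\<^sup>2"
        using power_mono[OF \<beta>[OF exit] abs_ge_zero, of 2] by simp
      moreover have "d * J \<le> D * J" using dD J by (rule mult_right_mono)
      ultimately show ?thesis using diff by linarith
    qed
    finally have "ennreal ((err (l a))\<^sup>2) \<le> ennreal (2 * \<beta>\<^sup>2) + ennreal (2 * D) * ennreal J"
      using J d(1) dD by (simp add: ennreal_leI ennreal_plus[symmetric] ennreal_mult[symmetric] mult.assoc del: ennreal_plus)
    also have "\<dots> \<le> ennreal (2 * \<beta>\<^sup>2) + ennreal (2 * D) * line_energy \<Omega> e \<nu> s"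
    proof (intro add_left_mono mult_left_mono)
      have "ennreal J = (\<integral>\<^sup>+t. ennreal (indicator {a..a + d} t *\<^sub>R (norm (G (l t)))\<^sup>2) \<partial>lborel)"
        unfolding J_def set_lebesgue_integral_def
        using G2 by (intro nn_integral_eq_integral[symmetric]) (auto simp: set_integrable_def)
      also have "\<dots> \<le> (\<integral>\<^sup>+t. indicator \<Omega> (l t) * ennreal ((norm (G (l t)))\<^sup>2) \<partial>lborel)"
      proof (rule nn_integral_mono_AE)
        \<comment> \<open>The exit point lies on the frontier, outside the open set, so the
          parameter \<open>a + d\<close> is removed as a null set.\<close>
        show "AE t in lborel. ennreal (indicator {a..a + d} t *\<^sub>R (norm (G (l t)))\<^sup>2) \<le>
            indicator \<Omega> (l t) * ennreal ((norm (G (l t)))\<^sup>2)"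
          using AE_lborel_singleton[of "a + d"]
        proof eventually_elim
          fix t assume "t \<noteq> a + d"
          then show "ennreal (indicator {a..a + d} t *\<^sub>R (norm (G (l t)))\<^sup>2) \<le>
              indicator \<Omega> (l t) * ennreal ((norm (G (l t)))\<^sup>2)"
            using inside[of t] by (cases "t \<in> {a..a + d}") auto
        qed
      qed
      finally show "ennreal J \<le> line_energy \<Omega> e \<nu> s"
        by (simp add: line_energy_def l_def)
    qed auto
    finally show ?thesis by (simp add: l_def)
  qed
qed

text \<open>A second difference evaluates the error on three parallel lines at once, and all three
  have to be good lines.\<close>

lemma AE_finite_line_shift:
  assumes fr: "orthonormal_frame e \<nu>"
  shows "AE s in lborel. finite {t. (s + \<delta>) *\<^sub>R e + t *\<^sub>R \<nu> \<in> skeleton}"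
proof -
  let ?N = "{s. infinite {t. s *\<^sub>R e + t *\<^sub>R \<nu> \<in> skeleton}}"
  have "finite ((\<lambda>s. s + \<delta>) -` ?N)"
    by (rule finite_vimageI[OF finite_lines_overlapping[OF fr]]) (simp add: inj_def)
  then have "(\<lambda>s. s + \<delta>) -` ?N \<in> null_sets lborel"
    by (rule finite_imp_null_set_lborel)
  then have "AE s in lborel. s \<notin> (\<lambda>s. s + \<delta>) -` ?N" by (rule AE_not_in)
  then show ?thesis by simp
qed

text \<open>A second difference annihilates affine functions, so along a segment on which \<open>U\<close> is almost
  affine the quadratic part of \<open>u\<close> survives in the error.\<close>
lemma second_difference_energy:
  assumes fr: "orthonormal_frame e \<nu>"
    and \<Omega>: "open \<Omega>" "bounded \<Omega>" "closure \<Omega> = \<Union>\<T>"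
    and D: "\<And>x y. x \<in> closure \<Omega> \<Longrightarrow> y \<in> closure \<Omega> \<Longrightarrow> dist x y \<le> D"
    and \<beta>: "\<And>x. x \<in> frontier \<Omega> \<Longrightarrow> \<bar>err x\<bar> \<le> \<beta>"
    and L: "L > 0" and seg: "\<And>\<tau>. \<tau> \<in> {0..L} \<Longrightarrow> p + \<tau> *\<^sub>R e \<in> closure \<Omega>"
    and sd: "\<And>\<tau>. \<tau> \<in> {0..L / 3} \<Longrightarrow>
      L\<^sup>2 / 9 \<le> \<bar>err (p + \<tau> *\<^sub>R e) - 2 * err (p + (\<tau> + L / 3) *\<^sub>R e) + err (p + (\<tau> + 2 * L / 3) *\<^sub>R e)\<bar>"
  shows "L ^ 5 / 243 \<le> 12 * \<beta>\<^sup>2 * L + 36 * D * (h1_seminorm \<Omega> err)\<^sup>2"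
proof -
  define c where "c = p \<bullet> e"
  define a where "a = p \<bullet> \<nu>"
  define F where "F = line_energy \<Omega> e \<nu>"
  define I where "I = {c..c + L / 3}"
  have Fm [measurable]: "F \<in> borel_measurable borel"
    unfolding F_def using \<Omega>(1) by (intro line_energy_measurable) simp
  have D0: "D \<ge> 0"
    using D[OF seg seg, of 0 0] L by simp
  have pt: "p + \<tau> *\<^sub>R e = (c + \<tau>) *\<^sub>R e + a *\<^sub>R \<nu>" for \<tau>
    using orthonormal_frame_expand[OF fr, of p] by (simp add: c_def a_def algebra_simps)
  have trace: "ennreal ((err (p + \<tau> *\<^sub>R e))\<^sup>2) \<le> ennreal (2 * \<beta>\<^sup>2) + ennreal (2 * D) * F (c + \<tau>)"
    if "\<tau> \<in> {0..L}" "finite {t. (c + \<tau>) *\<^sub>R e + t *\<^sub>R \<nu> \<in> skeleton}" for \<tau>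
    unfolding F_def pt
  proof (rule err_square_le_line_energy[OF fr that(2) \<Omega>])
    show "(c + \<tau>) *\<^sub>R e + a *\<^sub>R \<nu> \<in> closure \<Omega>" using seg[OF that(1)] unfolding pt .
  qed (fact D, fact \<beta>)
  have alg: "k * ((a + b * x) + (a + b * y) + (a + b * z)) = k * (a + a + a) + (k * b) * (x + y + z)"
    for a b k x y z :: ennreal
    by (simp add: algebra_simps)
  have six: "6 * (ennreal x + ennreal x + ennreal x) = ennreal (18 * x)" if "x \<ge> 0" for x
  proof -
    have "ennreal x + ennreal x + ennreal x = ennreal (3 * x)"
      using that by (simp add: ennreal_plus[symmetric] del: ennreal_plus)
    moreover have "ennreal (6 * (3 * x)) = ennreal 6 * ennreal (3 * x)"
      using that by (intro ennreal_mult) auto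
    ultimately show ?thesis by simp
  qed
  have twelve: "6 * ennreal (2 * D) = ennreal (12 * D)"
  proof -
    have "ennreal (6 * (2 * D)) = ennreal 6 * ennreal (2 * D)"
      using D0 by (intro ennreal_mult) auto
    then show ?thesis by simp
  qed
  have pointwise: "ennreal (L ^ 4 / 81) * indicator I s \<le>
      ennreal (36 * \<beta>\<^sup>2) * indicator I s + ennreal (12 * D) * (F s + F (s + L / 3) + F (s + 2 * L / 3))"
    if fin: "finite {t. s *\<^sub>R e + t *\<^sub>R \<nu> \<in> skeleton}"
      "finite {t. (s + L / 3) *\<^sub>R e + t *\<^sub>R \<nu> \<in> skeleton}"
      "finite {t. (s + 2 * L / 3) *\<^sub>R e + t *\<^sub>R \<nu> \<in> skeleton}" for s
  proof (cases "s \<in> I")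
    case True
    define \<tau> where "\<tau> = s - c"
    have \<tau>: "\<tau> \<in> {0..L / 3}" using True by (auto simp: I_def \<tau>_def)
    have mem: "\<tau> \<in> {0..L}" "\<tau> + L / 3 \<in> {0..L}" "\<tau> + 2 * L / 3 \<in> {0..L}"
      using \<tau> L by auto
    have s: "c + \<tau> = s" "c + (\<tau> + L / 3) = s + L / 3" "c + (\<tau> + 2 * L / 3) = s + 2 * L / 3"
      by (simp_all add: \<tau>_def)
    define v1 where "v1 = err (p + \<tau> *\<^sub>R e)"
    define v2 where "v2 = err (p + (\<tau> + L / 3) *\<^sub>R e)"
    define v3 where "v3 = err (p + (\<tau> + 2 * L / 3) *\<^sub>R e)"
    have v: "ennreal (v1\<^sup>2) \<le> ennreal (2 * \<beta>\<^sup>2) + ennreal (2 * D) * F s"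
        "ennreal (v2\<^sup>2) \<le> ennreal (2 * \<beta>\<^sup>2) + ennreal (2 * D) * F (s + L / 3)"
        "ennreal (v3\<^sup>2) \<le> ennreal (2 * \<beta>\<^sup>2) + ennreal (2 * D) * F (s + 2 * L / 3)"
      unfolding v1_def v2_def v3_def
      using trace[OF mem(1), unfolded s, OF fin(1)] trace[OF mem(2), unfolded s, OF fin(2)]
        trace[OF mem(3), unfolded s, OF fin(3)] .
    have "(L\<^sup>2 / 9)\<^sup>2 \<le> \<bar>v1 - 2 * v2 + v3\<bar>\<^sup>2"
      unfolding v1_def v2_def v3_def using sd[OF \<tau>] by (intro power_mono) auto
    also have "\<dots> \<le> 6 * (v1\<^sup>2 + v2\<^sup>2 + v3\<^sup>2)"
    proof -
      \<comment> \<open>Cauchy-Schwarz for the coefficients 1, -2, 1, whose squares add up to 6; the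
        defect is written out as a sum of three squares.\<close>
      have "6 * (v1\<^sup>2 + v2\<^sup>2 + v3\<^sup>2) - (v1 - 2 * v2 + v3)\<^sup>2 = (2 * v1 + v2)\<^sup>2 + (v1 - v3)\<^sup>2 + (v2 + 2 * v3)\<^sup>2"
        by (simp add: power2_eq_square algebra_simps)
      then show ?thesis
        using zero_le_power2[of "2 * v1 + v2"] zero_le_power2[of "v1 - v3"] zero_le_power2[of "v2 + 2 * v3"]
        by (simp only: power2_abs)
    qed
    also have "(L\<^sup>2 / 9)\<^sup>2 = L ^ 4 / 81" by (simp add: power_divide)
    finally have "ennreal (L ^ 4 / 81) \<le> ennreal (6 * (v1\<^sup>2 + v2\<^sup>2 + v3\<^sup>2))"
      by (rule ennreal_leI)
    also have "\<dots> = 6 * (ennreal (v1\<^sup>2) + ennreal (v2\<^sup>2) + ennreal (v3\<^sup>2))"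
    proof -
      have "ennreal (6 * (v1\<^sup>2 + v2\<^sup>2 + v3\<^sup>2)) = ennreal 6 * ennreal (v1\<^sup>2 + v2\<^sup>2 + v3\<^sup>2)"
        by (rule ennreal_mult) auto
      then show ?thesis by simp
    qed
    also have "\<dots> \<le> 6 * ((ennreal (2 * \<beta>\<^sup>2) + ennreal (2 * D) * F s) +
        (ennreal (2 * \<beta>\<^sup>2) + ennreal (2 * D) * F (s + L / 3)) +
        (ennreal (2 * \<beta>\<^sup>2) + ennreal (2 * D) * F (s + 2 * L / 3)))"
      by (intro mult_left_mono add_mono v) auto
    also have "\<dots> = 6 * (ennreal (2 * \<beta>\<^sup>2) + ennreal (2 * \<beta>\<^sup>2) + ennreal (2 * \<beta>\<^sup>2)) +
        (6 * ennreal (2 * D)) * (F s + F (s + L / 3) + F (s + 2 * L / 3))"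
      by (rule alg)
    also have "6 * (ennreal (2 * \<beta>\<^sup>2) + ennreal (2 * \<beta>\<^sup>2) + ennreal (2 * \<beta>\<^sup>2)) = ennreal (18 * (2 * \<beta>\<^sup>2))"
      by (rule six) simp
    also have "6 * ennreal (2 * D) = ennreal (12 * D)"
      by (rule twelve)
    finally have "ennreal (L ^ 4 / 81) \<le> ennreal (18 * (2 * \<beta>\<^sup>2)) + ennreal (12 * D) * (F s + F (s + L / 3) + F (s + 2 * L / 3))" .
    moreover have "18 * (2 * \<beta>\<^sup>2) = 36 * \<beta>\<^sup>2" by simp
    ultimately have "ennreal (L ^ 4 / 81) \<le> ennreal (36 * \<beta>\<^sup>2) + ennreal (12 * D) * (F s + F (s + L / 3) + F (s + 2 * L / 3))"
      by (simp only:)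
    then show ?thesis by (simp only: indicator_simps(1)[OF True] mult_1_right)
  next
    case False
    show ?thesis by (simp only: indicator_simps(2)[OF False] mult_zero_right zero_le)
  qed
  have Fint: "(\<integral>\<^sup>+s. F s \<partial>lborel) = ennreal ((h1_seminorm \<Omega> err)\<^sup>2)"
    unfolding F_def using \<Omega>(3) closure_subset[of \<Omega>] by (intro nn_integral_line_energy[OF \<Omega>(1) _ fr]) auto
  \<comment> \<open>By translation invariance each shifted slice energy again integrates to the full
    energy. The three shifts turn 6 * 2 D into 36 D, and the three boundary terms over a length L /
    3 give 12 \<beta>^2 L.\<close>
  have Fshift: "(\<integral>\<^sup>+s. F (s + \<delta>) \<partial>lborel) = ennreal ((h1_seminorm \<Omega> err)\<^sup>2)" for \<delta>
    using nn_integral_real_affine[OF Fm, of 1 \<delta>] by (simp add: add.commute Fint)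
  have "ennreal (L ^ 5 / 243) = (\<integral>\<^sup>+s. ennreal (L ^ 4 / 81) * indicator I s \<partial>lborel)"
  proof -
    have "(\<integral>\<^sup>+s. ennreal (L ^ 4 / 81) * indicator I s \<partial>lborel) = ennreal (L ^ 4 / 81) * ennreal (L / 3)"
      using L by (subst nn_integral_cmult_indicator) (auto simp: I_def)
    also have "\<dots> = ennreal (L ^ 4 / 81 * (L / 3))"
      using L by (intro ennreal_mult[symmetric]) auto
    also have "L ^ 4 / 81 * (L / 3) = L ^ 5 / 243" by (simp add: eval_nat_numeral)
    finally show ?thesis by simp
  qed
  also have "\<dots> \<le> (\<integral>\<^sup>+s. ennreal (36 * \<beta>\<^sup>2) * indicator I s +
      ennreal (12 * D) * (F s + F (s + L / 3) + F (s + 2 * L / 3)) \<partial>lborel)"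
  proof (rule nn_integral_mono_AE)
    show "AE s in lborel. ennreal (L ^ 4 / 81) * indicator I s \<le> ennreal (36 * \<beta>\<^sup>2) * indicator I s +
        ennreal (12 * D) * (F s + F (s + L / 3) + F (s + 2 * L / 3))"
      using AE_finite_line[OF fr] AE_finite_line_shift[OF fr, of "L / 3"] AE_finite_line_shift[OF fr, of "2 * L / 3"]
      by eventually_elim (rule pointwise)
  qed
  also have "\<dots> = ennreal (36 * \<beta>\<^sup>2) * ennreal (L / 3) + ennreal (12 * D) *
      ((\<integral>\<^sup>+s. F s \<partial>lborel) + (\<integral>\<^sup>+s. F (s + L / 3) \<partial>lborel) + (\<integral>\<^sup>+s. F (s + 2 * L / 3) \<partial>lborel))"
    using L by (simp add: nn_integral_add nn_integral_cmult nn_integral_cmult_indicator I_def)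
  also have "\<dots> = ennreal (36 * \<beta>\<^sup>2) * ennreal (L / 3) + ennreal (12 * D) *
      (ennreal ((h1_seminorm \<Omega> err)\<^sup>2) + ennreal ((h1_seminorm \<Omega> err)\<^sup>2) + ennreal ((h1_seminorm \<Omega> err)\<^sup>2))"
    by (simp only: Fint Fshift)
  also have "\<dots> =
      ennreal (36 * \<beta>\<^sup>2 * (L / 3) + 12 * D * ((h1_seminorm \<Omega> err)\<^sup>2 + (h1_seminorm \<Omega> err)\<^sup>2 + (h1_seminorm \<Omega> err)\<^sup>2))"
  proof -
    have "ennreal (36 * \<beta>\<^sup>2) * ennreal (L / 3) = ennreal (36 * \<beta>\<^sup>2 * (L / 3))"
      using L by (intro ennreal_mult[symmetric]) auto
    moreover have "ennreal (12 * D) * ennreal (H + H + H) = ennreal (12 * D * (H + H + H))" if "H \<ge> 0" for H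
      using D0 that by (intro ennreal_mult[symmetric]) auto
    moreover have "ennreal H + ennreal H + ennreal H = ennreal (H + H + H)" if "H \<ge> 0" for H
      using that by (simp add: ennreal_plus[symmetric] del: ennreal_plus)
    moreover have "ennreal (36 * \<beta>\<^sup>2 * (L / 3)) + ennreal (12 * D * (H + H + H)) =
        ennreal (36 * \<beta>\<^sup>2 * (L / 3) + 12 * D * (H + H + H))" if "H \<ge> 0" for H
      using that L D0 by (intro ennreal_plus[symmetric] mult_nonneg_nonneg add_nonneg_nonneg) auto
    ultimately show ?thesis by (metis zero_le_power2)
  qed
  finally have "L ^ 5 / 243 \<le> 36 * \<beta>\<^sup>2 * (L / 3) + 12 * D * ((h1_seminorm \<Omega> err)\<^sup>2 + (h1_seminorm \<Omega> err)\<^sup>2 + (h1_seminorm \<Omega> err)\<^sup>2)"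
    using L D0 by (subst (asm) ennreal_le_iff) auto
  then show ?thesis by (simp add: algebra_simps)
qed

end

section \<open>Piecewise affine functions of one variable\<close>

lemma ex_consecutive_interval:
  fixes t :: "'a::linorder"
  assumes "t \<in> {\<tau> 0..\<tau> (Suc n)}"
  shows "\<exists>i\<le>n. t \<in> {\<tau> i..\<tau> (Suc i)}"
  using assms
proof (induction n)
  case (Suc n)
  show ?case
  proof (cases "t \<le> \<tau> (Suc n)")
    case True
    then have "\<exists>i\<le>n. t \<in> {\<tau> i..\<tau> (Suc i)}" using Suc.prems by (intro Suc.IH) auto
    then show ?thesis using le_SucI by blast
  next
    case False
    then have "t \<in> {\<tau> (Suc n)..\<tau> (Suc (Suc n))}" using Suc.prems by simp
    then show ?thesis by blast
  qed
qed auto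

text \<open>Every slope differs from the first one by at most the total variation of the slopes.
  Integrating this from the left endpoint bounds the distance between \<open>f\<close> and the
  continuation of its first affine piece.\<close>

lemma piecewise_affine_slopes_bound:
  fixes \<tau> s :: "nat \<Rightarrow> real" and f :: "real \<Rightarrow> real"
  assumes mono: "\<And>i. i \<le> N \<Longrightarrow> \<tau> i \<le> \<tau> (Suc i)"
    and aff: "\<And>i t. i \<le> N \<Longrightarrow> t \<in> {\<tau> i..\<tau> (Suc i)} \<Longrightarrow> f t = f (\<tau> i) + s i * (t - \<tau> i)"
    and t: "t \<in> {\<tau> 0..\<tau> (Suc N)}"
  shows "\<bar>f t - f (\<tau> 0) - s 0 * (t - \<tau> 0)\<bar> \<le> (\<Sum>i=1..N. \<bar>s i - s (i - 1)\<bar>) * (t - \<tau> 0)"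
proof -
  define V where "V = (\<Sum>i=1..N. \<bar>s i - s (i - 1)\<bar>)"
  have slope: "\<bar>s i - s 0\<bar> \<le> (\<Sum>j=1..i. \<bar>s j - s (j - 1)\<bar>)" for i
  proof (induction i)
    case (Suc i)
    have "\<bar>s (Suc i) - s 0\<bar> \<le> \<bar>s i - s 0\<bar> + \<bar>s (Suc i) - s i\<bar>" by linarith
    with Suc show ?case by simp
  qed simp
  have slopeV: "\<bar>s i - s 0\<bar> \<le> V" if "i \<le> N" for i
  proof -
    have "(\<Sum>j=1..i. \<bar>s j - s (j - 1)\<bar>) \<le> V"
      unfolding V_def using that by (intro sum_mono2) auto
    then show ?thesis using slope[of i] by linarith
  qed
  have step: "\<bar>f t - f (\<tau> 0) - s 0 * (t - \<tau> 0)\<bar> \<le> V * (t - \<tau> 0)"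
    if "i \<le> N" "t \<in> {\<tau> i..\<tau> (Suc i)}" "\<bar>f (\<tau> i) - f (\<tau> 0) - s 0 * (\<tau> i - \<tau> 0)\<bar> \<le> V * (\<tau> i - \<tau> 0)" for i t
  proof -
    have "f t - f (\<tau> 0) - s 0 * (t - \<tau> 0) = (f (\<tau> i) - f (\<tau> 0) - s 0 * (\<tau> i - \<tau> 0)) + (s i - s 0) * (t - \<tau> i)"
      using aff[OF that(1,2)] by (simp add: algebra_simps)
    moreover have "\<bar>(s i - s 0) * (t - \<tau> i)\<bar> \<le> V * (t - \<tau> i)"
      using slopeV[OF that(1)] that(2) by (simp add: abs_mult mult_right_mono)
    ultimately have "\<bar>f t - f (\<tau> 0) - s 0 * (t - \<tau> 0)\<bar> \<le> V * (\<tau> i - \<tau> 0) + V * (t - \<tau> i)"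
      using that(3) by linarith
    then show ?thesis by (simp add: algebra_simps)
  qed
  have node: "\<bar>f (\<tau> i) - f (\<tau> 0) - s 0 * (\<tau> i - \<tau> 0)\<bar> \<le> V * (\<tau> i - \<tau> 0)" if "i \<le> Suc N" for i
    using that
  proof (induction i)
    case (Suc i)
    then have i: "i \<le> N" by simp
    show ?case
    proof (rule step[OF i])
      show "\<tau> (Suc i) \<in> {\<tau> i..\<tau> (Suc i)}" using mono[OF i] by simp
      show "\<bar>f (\<tau> i) - f (\<tau> 0) - s 0 * (\<tau> i - \<tau> 0)\<bar> \<le> V * (\<tau> i - \<tau> 0)"
        using Suc i by simp
    qed
  qed simp
  obtain i where "i \<le> N" "t \<in> {\<tau> i..\<tau> (Suc i)}"
    using ex_consecutive_interval[of t \<tau>, OF t] by blast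
  then show ?thesis using step[of i t] node[of i] unfolding V_def by simp
qed

section \<open>Flat triangles\<close>

lemma vertex_angle_cos_range:
  "\<bar>((a - v) \<bullet> (b - v)) / (norm (a - v) * norm (b - v))\<bar> \<le> 1"
  for a b v :: point
proof (cases "norm (a - v) * norm (b - v) = 0")
  case False
  then have "norm (a - v) * norm (b - v) > 0" by simp
  then show ?thesis
    using Cauchy_Schwarz_ineq2[of "a - v" "b - v"] by (simp only: abs_divide abs_of_pos pos_divide_le_eq)
qed auto

lemma sin_vertex_angle_nonneg: "0 \<le> sin (vertex_angle a v b)"
proof -
  have "0 \<le> vertex_angle a v b" "vertex_angle a v b \<le> pi"
    using vertex_angle_cos_range[of a v b] unfolding vertex_angle_def
    by (auto intro!: arccos_lbound arccos_ubound simp only: abs_le_iff)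
  then show ?thesis by (rule sin_ge_zero)
qed

text \<open>Lagrange's identity in terms of the angle. If a side is degenerate, the angle is a
  default value, but then both sides vanish.\<close>

lemma sin_vertex_angle_square:
  "(norm (a - v) * norm (b - v) * sin (vertex_angle a v b))\<^sup>2 = (norm (a - v))\<^sup>2 * (norm (b - v))\<^sup>2 - ((a - v) \<bullet> (b - v))\<^sup>2"
proof (cases "a = v \<or> b = v")
  case True
  then show ?thesis by auto
next
  case False
  define c where "c = ((a - v) \<bullet> (b - v)) / (norm (a - v) * norm (b - v))"
  have "(sin (arccos c))\<^sup>2 = 1 - c\<^sup>2"
    using vertex_angle_cos_range[of a v b] unfolding c_def[symmetric]
    by (simp add: sin_arccos abs_le_iff abs_square_le_1)
  moreover have "(a - v) \<bullet> (b - v) = c * (norm (a - v) * norm (b - v))"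
    using False by (simp add: c_def)
  moreover have "(X * Y * s)\<^sup>2 = X\<^sup>2 * Y\<^sup>2 - (c * (X * Y))\<^sup>2" if "s\<^sup>2 = 1 - c\<^sup>2" for X Y s :: real
    unfolding power_mult_distrib that by (simp add: algebra_simps)
  ultimately show ?thesis
    unfolding vertex_angle_def c_def[symmetric] by presburger
qed

text \<open>A vector orthogonal to one side sees only the component \<open>z\<close> of the other
  side that is orthogonal to the first, and \<open>z\<close> has length \<open>norm (b - v)\<close>
  times the sine.\<close>

lemma inner_le_sin_vertex_angle:
  assumes "w \<bullet> (a - v) = 0" "a \<noteq> v"
  shows "\<bar>w \<bullet> (b - v)\<bar> \<le> norm w * (norm (b - v) * sin (vertex_angle a v b))"
proof -
  define x where "x = a - v"
  define y where "y = b - v"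
  have x: "x \<bullet> x > 0" using assms(2) by (simp add: x_def)
  define z where "z = y - ((x \<bullet> y) / (x \<bullet> x)) *\<^sub>R x"
  have "w \<bullet> y = w \<bullet> z"
    using assms(1) by (simp add: z_def x_def inner_diff_right)
  then have "\<bar>w \<bullet> y\<bar> \<le> norm w * norm z"
    using Cauchy_Schwarz_ineq2[of w z] by simp
  moreover have "norm z = norm y * sin (vertex_angle a v b)"
  proof (rule power2_eq_imp_eq)
    have "(norm x)\<^sup>2 * (norm z)\<^sup>2 = (norm x)\<^sup>2 * (norm y)\<^sup>2 - (x \<bullet> y)\<^sup>2"
      using x unfolding power2_norm_eq_inner z_def
      by (simp add: inner_diff_left inner_diff_right inner_commute field_simps power2_eq_square)
    also have "\<dots> = (norm x)\<^sup>2 * (norm y * sin (vertex_angle a v b))\<^sup>2"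
      using sin_vertex_angle_square[of a v b] unfolding x_def y_def by (simp add: power_mult_distrib mult.assoc)
    finally show "(norm z)\<^sup>2 = (norm y * sin (vertex_angle a v b))\<^sup>2"
      using x by (simp add: power2_norm_eq_inner)
  qed (auto intro: mult_nonneg_nonneg sin_vertex_angle_nonneg)
  ultimately show ?thesis by (simp add: y_def)
qed

text \<open>The law of sines: the sine of the base angle at \<open>r\<close> is that of the apex
  angle times \<open>norm (p - q) / l\<close>, a factor of at most 1 when the base is a longest
  edge. The proof computes twice the area in two ways.\<close>

lemma base_angle_le_sin_apex:
  assumes fr: "orthonormal_frame e \<nu>" and base: "r - p = l *\<^sub>R e" and l: "norm (p - q) \<le> l"
    and pos: "(q - r) \<bullet> \<nu> > 0"
  shows "(q - r) \<bullet> \<nu> \<le> norm (q - r) * sin (vertex_angle p q r)"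
proof -
  note o = orthonormal_frame_simps[OF fr]
  define x where "x = p - q"
  define y where "y = r - q"
  have y: "y = x + l *\<^sub>R e" using base by (simp add: x_def y_def algebra_simps)
  have ye: "y \<bullet> e = x \<bullet> e + l" and yn: "y \<bullet> \<nu> = x \<bullet> \<nu>"
    unfolding y using o by (simp_all add: inner_add_left)
  have yn': "y \<bullet> \<nu> = - ((q - r) \<bullet> \<nu>)" by (simp add: y_def inner_diff_left)
  have xpos: "norm x > 0" using yn yn' pos by auto
  have "(norm x * norm y * sin (vertex_angle p q r))\<^sup>2 = (x \<bullet> x) * (y \<bullet> y) - (x \<bullet> y)\<^sup>2"
    using sin_vertex_angle_square[of p q r] unfolding x_def y_def by (simp add: power2_norm_eq_inner)
  also have "\<dots> = (l * (x \<bullet> \<nu>))\<^sup>2"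
    unfolding orthonormal_frame_inner[OF fr, of x x] orthonormal_frame_inner[OF fr, of y y]
      orthonormal_frame_inner[OF fr, of x y] ye yn
    by (simp add: power2_eq_square algebra_simps)
  finally have "\<bar>norm x * norm y * sin (vertex_angle p q r)\<bar> = \<bar>l * (x \<bullet> \<nu>)\<bar>"
    unfolding power2_eq_iff by (elim disjE) (simp_all only: abs_minus_cancel)
  moreover have "\<bar>norm x * norm y * sin (vertex_angle p q r)\<bar> = norm x * (norm y * sin (vertex_angle p q r))"
    using sin_vertex_angle_nonneg[of p q r] by (simp add: abs_mult)
  moreover have "\<bar>l * (x \<bullet> \<nu>)\<bar> = l * ((q - r) \<bullet> \<nu>)"
  proof -
    have "x \<bullet> \<nu> = - ((q - r) \<bullet> \<nu>)" using yn yn' by simp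
    moreover have "l \<ge> 0" using l norm_ge_zero[of "p - q"] by linarith
    ultimately show ?thesis using pos by (simp add: abs_mult)
  qed
  ultimately have "norm x * (norm y * sin (vertex_angle p q r)) = l * ((q - r) \<bullet> \<nu>)"
    by (simp only:)
  moreover have "norm x * ((q - r) \<bullet> \<nu>) \<le> l * ((q - r) \<bullet> \<nu>)"
    using l pos unfolding x_def by (intro mult_right_mono) auto
  ultimately have "norm x * ((q - r) \<bullet> \<nu>) \<le> norm x * (norm y * sin (vertex_angle p q r))" by simp
  then have "(q - r) \<bullet> \<nu> \<le> norm y * sin (vertex_angle p q r)"
    using xpos by (rule mult_left_le_imp_le)
  then show ?thesis by (simp add: y_def norm_minus_commute)
qed

text \<open>The tangential jump of the gradient between \<open>g0\<close> and \<open>g1\<close> is transported through the flat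
  triangle, whose gradient \<open>gt\<close> agrees with each of them only along one of its two short sides.\<close>
lemma gradient_jump_bound:
  assumes fr: "orthonormal_frame e \<nu>"
    and o1: "(gt - g1) \<bullet> (q1 - p) = 0" and o0: "(gt - g0) \<bullet> (q0 - p) = 0"
    and q1: "q1 \<noteq> p" and pos: "(q0 - p) \<bullet> \<nu> > 0"
    and Ca: "Ca \<ge> 0" and base: "(q0 - p) \<bullet> \<nu> \<le> norm (q0 - p) * (Ca * sn)"
    and sn: "sn = sin (vertex_angle q0 p q1)"
  shows "\<bar>(g1 - g0) \<bullet> e\<bar> \<le> 2 * (1 + Ca) * (norm (gt - g1) + norm (gt - g0)) * sn"
proof -
  define b where "b = q0 - p"
  define T where "T = norm (gt - g1) + norm (gt - g0)"
  define \<delta> where "\<delta> = g1 - g0"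
  have nb: "norm b > 0" using pos by (auto simp: b_def)
  have sn0: "sn \<ge> 0" unfolding sn by (rule sin_vertex_angle_nonneg)
  have T0: "T \<ge> 0" by (simp add: T_def)
  have "norm \<delta> \<le> T"
    using norm_triangle_ineq4[of "gt - g0" "gt - g1"] by (simp add: \<delta>_def T_def)
  have sn': "sn = sin (vertex_angle q1 p q0)"
    unfolding sn vertex_angle_def by (simp add: inner_commute mult.commute)
  \<comment> \<open>Along \<open>b\<close> the part gt - g0 drops out. What is left is orthogonal to
    the other short side, which encloses the flat angle with \<open>b\<close>; this yields the
    factor \<open>sn\<close>.\<close>
  have "\<delta> \<bullet> b = - ((gt - g1) \<bullet> b)"
    using o0 unfolding b_def \<delta>_def by (simp add: inner_diff_left)
  then have "\<bar>\<delta> \<bullet> b\<bar> \<le> norm (gt - g1) * (norm b * sn)"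
    using inner_le_sin_vertex_angle[OF o1 q1, of q0] unfolding sn' b_def by simp
  also have "\<dots> \<le> T * (norm b * sn)"
    unfolding T_def using nb sn0 by (intro mult_right_mono) auto
  finally have db: "\<bar>\<delta> \<bullet> b\<bar> \<le> norm b * (T * sn)" by (simp add: mult_ac)
  have de: "\<bar>\<delta> \<bullet> e\<bar> \<le> T" "\<bar>\<delta> \<bullet> \<nu>\<bar> \<le> T"
    using Cauchy_Schwarz_ineq2[of \<delta> e] Cauchy_Schwarz_ineq2[of \<delta> \<nu>] fr \<open>norm \<delta> \<le> T\<close>
    by (auto simp: orthonormal_frame_def)
  have bsq: "(norm b)\<^sup>2 = (b \<bullet> e)\<^sup>2 + (b \<bullet> \<nu>)\<^sup>2"
    using orthonormal_frame_inner[OF fr, of b b] unfolding power2_norm_eq_inner by (simp add: power2_eq_square)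
  \<comment> \<open>One component of \<open>b\<close> has at least half its length. If it is the
    tangential one, the jump in direction \<open>e\<close> is solved for from \<delta> \<bullet> b,
    the normal part being small by \<open>base\<close>. If \<open>b\<close> is steep,
    \<open>base\<close> forces 1 \<le> 2 Ca sn, so nothing has to be gained over the trivial bound
    \<open>T\<close>.\<close>
  have "\<bar>\<delta> \<bullet> e\<bar> \<le> 2 * (1 + Ca) * T * sn"
  proof (cases "norm b \<le> 2 * \<bar>b \<bullet> e\<bar>")
    case True
    have "(\<delta> \<bullet> e) * (b \<bullet> e) = \<delta> \<bullet> b - (\<delta> \<bullet> \<nu>) * (b \<bullet> \<nu>)"
      using orthonormal_frame_inner[OF fr, of \<delta> b] by simp
    then have "\<bar>\<delta> \<bullet> e\<bar> * \<bar>b \<bullet> e\<bar> \<le> \<bar>\<delta> \<bullet> b\<bar> + \<bar>\<delta> \<bullet> \<nu>\<bar> * \<bar>b \<bullet> \<nu>\<bar>"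
      by (metis abs_mult abs_triangle_ineq4)
    also have "\<dots> \<le> norm b * (T * sn) + T * (norm b * (Ca * sn))"
      using db de(2) base pos T0 unfolding b_def by (intro add_mono mult_mono) auto
    finally have "\<bar>\<delta> \<bullet> e\<bar> * \<bar>b \<bullet> e\<bar> \<le> norm b * ((1 + Ca) * T * sn)"
      by (simp add: algebra_simps)
    moreover have "\<bar>\<delta> \<bullet> e\<bar> * norm b \<le> \<bar>\<delta> \<bullet> e\<bar> * (2 * \<bar>b \<bullet> e\<bar>)"
      using True by (rule mult_left_mono) simp
    ultimately have "norm b * \<bar>\<delta> \<bullet> e\<bar> \<le> norm b * (2 * (1 + Ca) * T * sn)"
      by (simp add: algebra_simps)
    then show ?thesis using nb by (rule mult_left_le_imp_le)
  next
    case False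
    have "norm b \<le> 2 * (b \<bullet> \<nu>)"
    proof (rule ccontr)
      assume "\<not> norm b \<le> 2 * (b \<bullet> \<nu>)"
      then have small: "2 * (b \<bullet> \<nu>) \<le> norm b" "2 * \<bar>b \<bullet> e\<bar> \<le> norm b" using False by auto
      have "(2 * (b \<bullet> \<nu>))\<^sup>2 \<le> (norm b)\<^sup>2"
        by (rule power_mono[OF small(1)]) (use pos in \<open>simp add: b_def\<close>)
      moreover have "(2 * \<bar>b \<bullet> e\<bar>)\<^sup>2 \<le> (norm b)\<^sup>2"
        by (rule power_mono[OF small(2)]) simp
      ultimately have "4 * (b \<bullet> \<nu>)\<^sup>2 \<le> (norm b)\<^sup>2" "4 * (b \<bullet> e)\<^sup>2 \<le> (norm b)\<^sup>2"
        by (simp_all only: power_mult_distrib power2_abs) simp_all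
      then have "(norm b)\<^sup>2 \<le> 0" using bsq by linarith
      then show False using nb by simp
    qed
    then have "norm b * 1 \<le> norm b * (2 * (Ca * sn))"
      using base unfolding b_def by simp
    then have "1 \<le> 2 * (Ca * sn)" using nb by (rule mult_left_le_imp_le)
    then have "T * 1 \<le> T * (2 * (Ca * sn))" using T0 by (rule mult_left_mono)
    also have "\<dots> \<le> 2 * (1 + Ca) * T * sn" using T0 sn0 by (simp add: algebra_simps)
    finally show ?thesis using de(1) by simp
  qed
  then show ?thesis by (simp add: T_def \<delta>_def)
qed

text \<open>Normalising the direction turns the parameter into arc length: slopes in \<tau> are then
  tangential gradients, and the band length telescopes.\<close>

lemma is_band_frame:
  assumes "is_band \<T> N P Q"
  obtains p e \<nu> \<tau> where "orthonormal_frame e \<nu>" "strict_mono_on {0..N + 1} \<tau>"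
    "\<And>i. i \<le> N + 1 \<Longrightarrow> P i = p + \<tau> i *\<^sub>R e" "\<And>i. i \<le> N \<Longrightarrow> (Q i - p) \<bullet> \<nu> > 0"
    "band_length N P = \<tau> (N + 1) - \<tau> 0"
proof -
  obtain p d n t where *: "d \<noteq> 0" "n \<noteq> 0" "d \<bullet> n = 0" "strict_mono_on {0..N + 1} t"
      "\<forall>i\<in>{0..N + 1}. P i = p + t i *\<^sub>R d" "\<forall>i\<in>{0..N}. (Q i - p) \<bullet> n > 0"
  proof -
    have "\<exists>p d n t. d \<noteq> 0 \<and> n \<noteq> 0 \<and> d \<bullet> n = 0 \<and> strict_mono_on {0..N + 1} t \<and>
        (\<forall>i\<in>{0..N + 1}. P i = p + t i *\<^sub>R d) \<and> (\<forall>i\<in>{0..N}. (Q i - p) \<bullet> n > 0)"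
      using assms unfolding is_band_def by (elim conjE)
    then show thesis using that by blast
  qed
  define e where "e = (1 / norm d) *\<^sub>R d"
  define \<nu> where "\<nu> = (1 / norm n) *\<^sub>R n"
  define \<tau> where "\<tau> i = norm d * t i" for i
  have fr: "orthonormal_frame e \<nu>"
    using *(1-3) by (simp add: orthonormal_frame_def e_def \<nu>_def)
  have mono: "strict_mono_on {0..N + 1} \<tau>"
    using *(1,4) by (auto simp: strict_mono_on_def \<tau>_def)
  have P: "P i = p + \<tau> i *\<^sub>R e" if "i \<le> N + 1" for i
    using *(1,5) that by (simp add: \<tau>_def e_def)
  have Q: "(Q i - p) \<bullet> \<nu> > 0" if "i \<le> N" for i
    using *(2,6) that by (simp add: \<nu>_def)
  have "dist (P i) (P (i + 1)) = \<tau> (Suc i) - \<tau> i" if "i \<le> N" for i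
  proof -
    have "\<tau> i < \<tau> (Suc i)" using mono that by (auto simp: strict_mono_on_def)
    moreover have "P i - P (i + 1) = (\<tau> i - \<tau> (Suc i)) *\<^sub>R e"
      using P[of i] P[of "i + 1"] that by (simp add: scaleR_diff_left)
    ultimately show ?thesis using fr by (simp add: dist_norm orthonormal_frame_def)
  qed
  then have "band_length N P = (\<Sum>i=0..N. \<tau> (Suc i) - \<tau> i)"
    unfolding band_length_def by (intro sum.cong) auto
  also have "\<dots> = \<tau> (N + 1) - \<tau> 0"
    by (simp add: sum_Suc_diff)
  finally show ?thesis using that fr mono P Q by blast
qed

lemma band_points:
  "P i \<in> band_K P Q i" "P (Suc i) \<in> band_K P Q i" "Q i \<in> band_K P Q i"
  "Q (i - 1) \<in> band_Kt P Q i" "Q i \<in> band_Kt P Q i" "P i \<in> band_Kt P Q i"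
  by (auto simp: band_K_def band_Kt_def intro: hull_inc)

section \<open>Energies and areas of single triangles and of their unions\<close>

context piecewise_affine
begin

lemma measure_interior:
  assumes "K \<in> \<T>"
  shows "measure lborel (interior K) = area K"
proof -
  have K: "compact K" "convex K" using triangle_compact[OF simplex[OF assms]] by auto
  have kb: "K \<in> sets borel" using K(1) by (rule borel_compact)
  have "K - interior K = frontier K"
    using K(1) by (simp add: frontier_def closure_closed compact_imp_closed)
  then have "K - interior K \<in> null_sets lborel"
    using negligible_convex_frontier[OF K(2)] kb by (simp add: negligible_iff_null_sets null_sets_completion_iff)
  then have "measure lborel (K - (K - interior K)) = measure lborel K"
    using kb by (intro measure_Diff_null_set) auto
  moreover have "K - (K - interior K) = interior K" using interior_subset by blast
  ultimately show ?thesis by simp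
qed

lemma G_square_interior_integrable:
  assumes "K \<in> \<T>"
  shows "set_integrable lborel (interior K) (\<lambda>x. (norm (G x))\<^sup>2)"
  using assms interior_subset by (intro set_integrable_norm_G_square) auto

text \<open>Comparing at \<open>P\<close> instead of pointwise costs an error of order \<open>h\<^sup>2\<close> per unit area.\<close>
lemma triangle_gradient_error:
  assumes K: "K \<in> \<T>" and P: "P \<in> K" and h: "\<And>x y. x \<in> K \<Longrightarrow> y \<in> K \<Longrightarrow> dist x y \<le> h"
  shows "area K * (norm (A K - 2 *\<^sub>R P))\<^sup>2 \<le>
    2 * (LINT x:interior K|lborel. (norm (G x))\<^sup>2) + 8 * h\<^sup>2 * area K"
proof -
  have Kc: "compact K" using triangle_compact[OF simplex[OF K]] by auto
  have c: "set_integrable lborel (interior K) (\<lambda>x. c)" for c :: real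
  proof -
    have "set_integrable lborel K (\<lambda>x. c)"
      unfolding set_integrable_def by (rule borel_integrable_compact[OF Kc]) auto
    then show ?thesis by (rule set_integrable_subset) (use interior_subset[of K] in auto)
  qed
  have int: "(LINT x:interior K|lborel. c) = area K * c" for c :: real
    using measure_interior[OF K] by (simp add: set_lebesgue_integral_def)
  have g: "set_integrable lborel (interior K) (\<lambda>x. 2 * (norm (G x))\<^sup>2)"
    using G_square_interior_integrable[OF K] by (rule set_integrable_mult_right)
  have "(LINT x:interior K|lborel. (norm (A K - 2 *\<^sub>R P))\<^sup>2) \<le> (LINT x:interior K|lborel. 2 * (norm (G x))\<^sup>2 + 8 * h\<^sup>2)"
  proof (rule set_integral_mono[OF c set_integral_add(1)[OF g c]])
    fix x assume x: "x \<in> interior K"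
    have "norm (x - P) \<le> h"
      using h[of x P] x P interior_subset[of K] by (auto simp: dist_norm)
    moreover have "2 *\<^sub>R P - A K = G x - 2 *\<^sub>R (x - P)"
      by (simp add: G_eq[OF K x] scaleR_diff_right)
    then have "norm (A K - 2 *\<^sub>R P) = norm (G x - 2 *\<^sub>R (x - P))"
      by (metis norm_minus_commute)
    then have "norm (A K - 2 *\<^sub>R P) \<le> norm (G x) + 2 * norm (x - P)"
      using norm_triangle_ineq4[of "G x" "2 *\<^sub>R (x - P)"] by simp
    ultimately have "norm (A K - 2 *\<^sub>R P) \<le> norm (G x) + 2 * h" by simp
    then have "(norm (A K - 2 *\<^sub>R P))\<^sup>2 \<le> (norm (G x) + 2 * h)\<^sup>2"
      by (rule power_mono) simp
    also have "\<dots> \<le> 2 * (norm (G x))\<^sup>2 + 8 * h\<^sup>2"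
      using zero_le_power2[of "norm (G x) - 2 * h"] by (simp add: power2_eq_square algebra_simps)
    finally show "(norm (A K - 2 *\<^sub>R P))\<^sup>2 \<le> 2 * (norm (G x))\<^sup>2 + 8 * h\<^sup>2" .
  qed
  also have "\<dots> = (LINT x:interior K|lborel. 2 * (norm (G x))\<^sup>2) + (LINT x:interior K|lborel. 8 * h\<^sup>2)"
    by (rule set_integral_add(2)[OF g c])
  also have "(LINT x:interior K|lborel. 2 * (norm (G x))\<^sup>2) = 2 * (LINT x:interior K|lborel. (norm (G x))\<^sup>2)"
    by (rule set_integral_mult_right)
  finally show ?thesis unfolding int by (simp add: mult.commute)
qed

text \<open>The interiors are disjoint, so at most one term of the sum is nonzero. The estimate
  serves both for energies and for areas.\<close>

lemma sum_indicator_interior_le: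
  assumes "S \<in> sets borel" "\<And>K. K \<in> \<T> \<Longrightarrow> interior K \<subseteq> S"
  shows "(\<Sum>K\<in>\<T>. indicator (interior K) x :: real) \<le> indicator S x"
proof (cases "\<exists>K\<in>\<T>. x \<in> interior K")
  case True
  then obtain K where K: "K \<in> \<T>" "x \<in> interior K" by blast
  have "(\<Sum>L\<in>\<T>. indicator (interior L) x :: real) = (\<Sum>L\<in>{K}. indicator (interior L) x)"
    using finite K interiors_disjoint[of K]
    by (intro sum.mono_neutral_right) (auto simp: indicator_def)
  then show ?thesis using K assms(2)[OF K(1)] by auto
next
  case False
  then have "(\<Sum>K\<in>\<T>. indicator (interior K) x :: real) = 0" by (intro sum.neutral) auto
  then show ?thesis by simp
qed

lemma sum_interior_energy_le:
  "(\<Sum>K\<in>\<T>. LINT x:interior K|lborel. (norm (G x))\<^sup>2) \<le> (h1_seminorm (\<Union>\<T>) err)\<^sup>2"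
proof -
  let ?S = "interior (\<Union>\<T>)"
  have sub: "?S \<subseteq> \<Union>\<T>" by (rule interior_subset)
  have "(\<Sum>K\<in>\<T>. LINT x:interior K|lborel. (norm (G x))\<^sup>2) =
      (LINT x|lborel. (\<Sum>K\<in>\<T>. indicator (interior K) x *\<^sub>R (norm (G x))\<^sup>2))"
    unfolding set_lebesgue_integral_def
    using G_square_interior_integrable by (intro Bochner_Integration.integral_sum[symmetric]) (simp add: set_integrable_def)
  also have "\<dots> \<le> (LINT x|lborel. indicator ?S x *\<^sub>R (norm (G x))\<^sup>2)"
  proof (rule integral_mono)
    show "integrable lborel (\<lambda>x. \<Sum>K\<in>\<T>. indicator (interior K) x *\<^sub>R (norm (G x))\<^sup>2)"
      using G_square_interior_integrable by (intro Bochner_Integration.integrable_sum) (simp add: set_integrable_def)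
    show "integrable lborel (\<lambda>x. indicator ?S x *\<^sub>R (norm (G x))\<^sup>2)"
      using set_integrable_norm_G_square[of ?S] sub by (simp add: set_integrable_def)
    fix x
    have "(\<Sum>K\<in>\<T>. indicator (interior K) x :: real) \<le> indicator ?S x"
      by (rule sum_indicator_interior_le) (auto intro!: interior_mono)
    then have "(\<Sum>K\<in>\<T>. indicator (interior K) x :: real) * (norm (G x))\<^sup>2 \<le> indicator ?S x * (norm (G x))\<^sup>2"
      by (rule mult_right_mono) simp
    then show "(\<Sum>K\<in>\<T>. indicator (interior K) x *\<^sub>R (norm (G x))\<^sup>2) \<le> indicator ?S x *\<^sub>R (norm (G x))\<^sup>2"
      by (simp add: sum_distrib_right)
  qed
  finally show ?thesis
    using h1_seminorm_square[OF sub] by (simp add: set_lebesgue_integral_def)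
qed

text \<open>Makes the accumulated O(h) term depend on the area of the domain alone, not on the
  number of elements.\<close>

lemma sum_area_le:
  assumes "compact S" "\<Union>\<T> \<subseteq> S"
  shows "(\<Sum>K\<in>\<T>. area K) \<le> area S"
proof -
  have Sb: "S \<in> sets borel" using assms(1) by (rule borel_compact)
  have iS: "integrable lborel (indicator S :: point \<Rightarrow> real)"
    using borel_integrable_compact[OF assms(1), of "\<lambda>_. 1::real"] by simp
  have iK: "integrable lborel (indicator (interior K) :: point \<Rightarrow> real)" if "K \<in> \<T>" for K
  proof (rule Bochner_Integration.integrable_bound[OF iS])
    have "interior K \<subseteq> S" using that assms(2) interior_subset by blast
    then show "AE x in lborel. norm (indicat_real (interior K) x) \<le> norm (indicat_real S x)"
      by (intro always_eventually allI) (auto simp: indicator_def)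
  qed simp
  have "(\<Sum>K\<in>\<T>. area K) = (\<Sum>K\<in>\<T>. LINT x|lborel. indicator (interior K) x)"
    using measure_interior by (intro sum.cong) auto
  also have "\<dots> = (LINT x|lborel. (\<Sum>K\<in>\<T>. indicator (interior K) x))"
    using iK by (intro Bochner_Integration.integral_sum[symmetric]) auto
  also have "\<dots> \<le> (LINT x|lborel. indicator S x)"
  proof (rule integral_mono[OF _ iS])
    show "integrable lborel (\<lambda>x. \<Sum>K\<in>\<T>. indicat_real (interior K) x)"
      using iK by (intro Bochner_Integration.integrable_sum) auto
    show "(\<Sum>K\<in>\<T>. indicat_real (interior K) x) \<le> indicator S x" for x
      using assms(2) interior_subset by (intro sum_indicator_interior_le Sb) blast
  qed
  finally show ?thesis using Sb by simp
qed

end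

section \<open>Bands\<close>

context piecewise_affine
begin

text \<open>By contraposition: with a slope variation of at most L / 36 the edge would satisfy the
  hypotheses of \<open>second_difference_energy\<close>, whose conclusion is excluded by
  \<open>large\<close>.\<close>

lemma band_slope_variation:
  assumes band: "is_band \<T> N P Q" and fr: "orthonormal_frame e \<nu>"
    and mono: "strict_mono_on {0..N + 1} \<tau>" and P: "\<And>i. i \<le> N + 1 \<Longrightarrow> P i = p + \<tau> i *\<^sub>R e"
    and \<Omega>: "open \<Omega>" "bounded \<Omega>" "closure \<Omega> = \<Union>\<T>"
    and D: "\<And>x y. x \<in> closure \<Omega> \<Longrightarrow> y \<in> closure \<Omega> \<Longrightarrow> dist x y \<le> D"
    and \<beta>: "\<And>x. x \<in> frontier \<Omega> \<Longrightarrow> \<bar>err x\<bar> \<le> \<beta>"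
    and L: "L = \<tau> (N + 1) - \<tau> 0"
    and large: "12 * \<beta>\<^sup>2 * L + 36 * D * (h1_seminorm \<Omega> err)\<^sup>2 < L ^ 5 / 243"
  shows "L < 36 * (\<Sum>i=1..N. \<bar>(A (band_K P Q i) - A (band_K P Q (i - 1))) \<bullet> e\<bar>)"
proof (rule ccontr)
  define V where "V = (\<Sum>i=1..N. \<bar>(A (band_K P Q i) - A (band_K P Q (i - 1))) \<bullet> e\<bar>)"
  define s where "s i = A (band_K P Q i) \<bullet> e" for i
  define f where "f t = U (p + t *\<^sub>R e)" for t
  assume "\<not> L < 36 * (\<Sum>i=1..N. \<bar>(A (band_K P Q i) - A (band_K P Q (i - 1))) \<bullet> e\<bar>)"
  then have V: "36 * V \<le> L" by (simp add: V_def)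
  have V0: "V \<ge> 0" unfolding V_def by (intro sum_nonneg) auto
  have Lpos: "L > 0" unfolding L using mono by (auto simp: strict_mono_on_def)
  have \<tau>: "\<tau> i < \<tau> (Suc i)" if "i \<le> N" for i
    using mono that by (auto simp: strict_mono_on_def)
  have KT: "band_K P Q i \<in> \<T>" if "i \<le> N" for i
    using band that unfolding is_band_def band_elements_def by auto
  have edge: "p + t *\<^sub>R e \<in> band_K P Q i" if i: "i \<le> N" and t: "t \<in> {\<tau> i..\<tau> (Suc i)}" for i t
  proof -
    define u where "u = (t - \<tau> i) / (\<tau> (Suc i) - \<tau> i)"
    have u: "0 \<le> u" "u \<le> 1" using t \<tau>[OF i] by (auto simp: u_def field_simps)
    have tu: "t = (1 - u) * \<tau> i + u * \<tau> (Suc i)"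
    proof -
      have "u * (\<tau> (Suc i) - \<tau> i) = t - \<tau> i" using \<tau>[OF i] by (simp add: u_def)
      then show ?thesis by (simp add: algebra_simps)
    qed
    have "p + t *\<^sub>R e = (1 - u) *\<^sub>R P i + u *\<^sub>R P (Suc i)"
      using P[of i] P[of "Suc i"] i by (simp add: tu algebra_simps)
    also have "\<dots> \<in> band_K P Q i"
      using convexD[of "band_K P Q i" "P i" "P (Suc i)" "1 - u" u] band_points(1,2)[where i = i] u
      unfolding band_K_def by (simp add: convex_convex_hull)
    finally show ?thesis .
  qed
  have aff: "f t = f (\<tau> i) + s i * (t - \<tau> i)" if i: "i \<le> N" and t: "t \<in> {\<tau> i..\<tau> (Suc i)}" for i t
  proof -
    have "f r = A (band_K P Q i) \<bullet> (p + r *\<^sub>R e) + c (band_K P Q i)" if "r \<in> {\<tau> i..\<tau> (Suc i)}" for r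
      unfolding f_def by (rule affine[OF KT[OF i] edge[OF i that]])
    from this[OF t] this[of "\<tau> i"] \<tau>[OF i] show ?thesis
      by (simp add: s_def inner_add_right algebra_simps)
  qed
  have slopes: "\<bar>f t - f (\<tau> 0) - s 0 * (t - \<tau> 0)\<bar> \<le> V * (t - \<tau> 0)" if "t \<in> {\<tau> 0..\<tau> (Suc N)}" for t
  proof -
    have "V = (\<Sum>i=1..N. \<bar>s i - s (i - 1)\<bar>)"
      by (simp add: V_def s_def inner_diff_left)
    moreover have "\<bar>f t - f (\<tau> 0) - s 0 * (t - \<tau> 0)\<bar> \<le> (\<Sum>i=1..N. \<bar>s i - s (i - 1)\<bar>) * (t - \<tau> 0)"
    proof (rule piecewise_affine_slopes_bound)
      show "\<tau> i \<le> \<tau> (Suc i)" if "i \<le> N" for i using \<tau>[OF that] by simp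
    qed (rule aff, assumption+, rule that)
    ultimately show ?thesis by simp
  qed
  \<comment> \<open>The deviation of \<open>U\<close> on the edge from the continuation of its first
    affine piece.\<close>
  define R where "R x = f (\<tau> 0 + x) - f (\<tau> 0) - s 0 * x" for x
  have R: "\<bar>R x\<bar> \<le> V * L" if "x \<in> {0..L}" for x
  proof -
    have "\<bar>R x\<bar> \<le> V * x"
      using slopes[of "\<tau> 0 + x"] that by (simp add: R_def L)
    also have "\<dots> \<le> V * L" using V0 that by (intro mult_left_mono) auto
    finally show ?thesis .
  qed
  define q where "q = p + \<tau> 0 *\<^sub>R e"
  have err: "err (q + x *\<^sub>R e) = q \<bullet> q + 2 * x * (q \<bullet> e) + x\<^sup>2 - f (\<tau> 0) - s 0 * x - R x" for x
  proof -
    have "q + x *\<^sub>R e = p + (\<tau> 0 + x) *\<^sub>R e" by (simp add: q_def algebra_simps)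
    then have "U (q + x *\<^sub>R e) = f (\<tau> 0) + s 0 * x + R x" by (simp add: f_def R_def)
    moreover have "quad_fun (q + x *\<^sub>R e) = q \<bullet> q + 2 * x * (q \<bullet> e) + x\<^sup>2"
      using orthonormal_frame_simps(1)[OF fr]
      by (simp add: quad_fun_eq inner_add_left inner_add_right inner_commute power2_eq_square algebra_simps)
    ultimately show ?thesis by (simp add: err_def)
  qed
  have "L ^ 5 / 243 \<le> 12 * \<beta>\<^sup>2 * L + 36 * D * (h1_seminorm \<Omega> err)\<^sup>2"
  proof (rule second_difference_energy[OF fr \<Omega> D \<beta> Lpos])
    fix x assume x: "x \<in> {0..L}"
    have "\<exists>i\<le>N. \<tau> 0 + x \<in> {\<tau> i..\<tau> (Suc i)}"
      using x L by (intro ex_consecutive_interval) auto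
    then obtain i where "i \<le> N" "\<tau> 0 + x \<in> {\<tau> i..\<tau> (Suc i)}" by blast
    then have "p + (\<tau> 0 + x) *\<^sub>R e \<in> \<Union>\<T>" using edge KT by blast
    then show "q + x *\<^sub>R e \<in> closure \<Omega>" unfolding \<Omega>(3) by (simp add: q_def algebra_simps)
  next
    fix x assume x: "x \<in> {0..L / 3}"
    \<comment> \<open>Constants and linear terms cancel; x^2 contributes 2 (L / 3)^2.\<close>
    have "err (q + x *\<^sub>R e) - 2 * err (q + (x + L / 3) *\<^sub>R e) + err (q + (x + 2 * L / 3) *\<^sub>R e) =
        2 * L\<^sup>2 / 9 - (R x - 2 * R (x + L / 3) + R (x + 2 * L / 3))"
      unfolding err by (simp add: power2_eq_square algebra_simps)
    moreover have "\<bar>R x\<bar> \<le> V * L" "\<bar>R (x + L / 3)\<bar> \<le> V * L" "\<bar>R (x + 2 * L / 3)\<bar> \<le> V * L"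
      using x by (auto intro!: R)
    \<comment> \<open>The origin of 36 = 4 * 9: the remainders enter with total weight 4, and at
      most L^2 / 9 of the main term 2 L^2 / 9 may be lost.\<close>
    moreover have "36 * (V * L) \<le> L\<^sup>2"
      using mult_right_mono[OF V, of L] Lpos by (simp add: power2_eq_square mult.assoc)
    ultimately show "L\<^sup>2 / 9 \<le> \<bar>err (q + x *\<^sub>R e) - 2 * err (q + (x + L / 3) *\<^sub>R e) + err (q + (x + 2 * L / 3) *\<^sub>R e)\<bar>"
      by linarith
  qed
  then show False using large by linarith
qed

text \<open>The flat triangle shares the side P_i Q_i with its right neighbour and P_i Q_(i-1) with
  its left one, and \<open>U\<close> is affine on all three, which gives the two orthogonalities.
  The tilt of P_i Q_(i-1) against the edge is a base angle of the left neighbour; since the edge is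
  longest there, it is controlled by the apex angle and so by the angle hypothesis.\<close>

lemma band_jump:
  assumes band: "is_band \<T> N P Q" and fr: "orthonormal_frame e \<nu>"
    and mono: "strict_mono_on {0..N + 1} \<tau>" and P: "\<And>i. i \<le> N + 1 \<Longrightarrow> P i = p + \<tau> i *\<^sub>R e"
    and Q: "\<And>i. i \<le> N \<Longrightarrow> (Q i - p) \<bullet> \<nu> > 0"
    and i: "i \<in> {1..N}" and Ca: "Ca \<ge> 0"
    and angle: "sin (pi - band_alpha P Q (i - 1)) \<le> Ca * sin (pi - band_alphat P Q i)"
  defines "gt \<equiv> A (band_Kt P Q i)" and "g1 \<equiv> A (band_K P Q i)" and "g0 \<equiv> A (band_K P Q (i - 1))"
  shows "\<bar>(g1 - g0) \<bullet> e\<bar> \<le>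
    2 * (1 + Ca) * (norm (gt - g1) + norm (gt - g0)) * sin (band_alphat P Q i)"
proof -
  have KT: "band_K P Q i \<in> \<T>" "band_K P Q (i - 1) \<in> \<T>" "band_Kt P Q i \<in> \<T>"
    using band i unfolding is_band_def band_elements_def by auto
  have Si: "Suc (i - 1) = i" using i by simp
  have dp: "P i \<in> band_K P Q (i - 1)" using band_points(2)[of P "i - 1" Q] unfolding Si .
  have same: "A K \<bullet> (x - y) = U x - U y" if "K \<in> \<T>" "x \<in> K" "y \<in> K" for K x y
    using affine[OF that(1,2)] affine[OF that(1,3)] by (simp add: inner_diff_right)
  have o1: "(gt - g1) \<bullet> (Q i - P i) = 0"
    unfolding gt_def g1_def inner_diff_left
    using same[OF KT(3) band_points(5,6)] same[OF KT(1) band_points(3,1)] by simp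
  have o0: "(gt - g0) \<bullet> (Q (i - 1) - P i) = 0"
    unfolding gt_def g0_def inner_diff_left
    using same[OF KT(3) band_points(4,6)] same[OF KT(2) band_points(3) dp] by simp
  have n: "(Q j - P i) \<bullet> \<nu> > 0" if "j \<le> N" for j
    using Q[OF that] P[of i] i orthonormal_frame_simps(3)[OF fr]
    by (simp add: inner_diff_left inner_add_left)
  have q1: "Q i \<noteq> P i" using n[of i] i by auto
  have q0: "(Q (i - 1) - P i) \<bullet> \<nu> > 0" using i by (intro n) auto
  have \<tau>: "\<tau> (i - 1) < \<tau> i" using mono i by (auto simp: strict_mono_on_def)
  have ba: "P i - P (i - 1) = (\<tau> i - \<tau> (i - 1)) *\<^sub>R e"
  proof -
    have "P (i - 1) = p + \<tau> (i - 1) *\<^sub>R e" using i by (intro P) auto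
    then show ?thesis using P[of i] i by (simp add: scaleR_diff_left)
  qed
  have "dist (P (i - 1)) (P i) = norm (P i - P (i - 1))"
    by (metis dist_commute dist_norm)
  then have len: "dist (P (i - 1)) (P i) = \<tau> i - \<tau> (i - 1)"
    using \<tau> fr unfolding ba by (simp add: orthonormal_frame_def)
  have "dist (P (i - 1)) (Q (i - 1)) \<le> dist (P (i - 1)) (P (i - 1 + 1))"
  proof -
    have "i - 1 \<in> {0..N}" using i by (simp only: atLeastAtMost_iff) arith
    with band show ?thesis unfolding is_band_def by blast
  qed
  then have "norm (P (i - 1) - Q (i - 1)) \<le> \<tau> i - \<tau> (i - 1)"
    using len Si by (simp add: dist_norm)
  from base_angle_le_sin_apex[OF fr ba this q0]
  have "(Q (i - 1) - P i) \<bullet> \<nu> \<le> norm (Q (i - 1) - P i) * sin (vertex_angle (P (i - 1)) (Q (i - 1)) (P i))" .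
  also have "sin (vertex_angle (P (i - 1)) (Q (i - 1)) (P i)) \<le> Ca * sin (band_alphat P Q i)"
    using angle Si by (simp add: band_alpha_def)
  finally have base: "(Q (i - 1) - P i) \<bullet> \<nu> \<le> norm (Q (i - 1) - P i) * (Ca * sin (band_alphat P Q i))"
    by (simp add: mult_left_mono)
  show ?thesis
    by (rule gradient_jump_bound[OF fr o1 o0 q1 q0 Ca base]) (simp add: band_alphat_def)
qed

text \<open>\<open>P i\<close> is a common vertex of the three triangles involved in the \<open>i\<close>-th jump, so all three
  gradients are compared with \<open>\<nabla>u (P i) = 2 P i\<close>.\<close>
lemma band_energy:
  assumes band: "is_band \<T> N P Q" and fr: "orthonormal_frame e \<nu>"
    and mono: "strict_mono_on {0..N + 1} \<tau>" and P: "\<And>i. i \<le> N + 1 \<Longrightarrow> P i = p + \<tau> i *\<^sub>R e"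
    and Q: "\<And>i. i \<le> N \<Longrightarrow> (Q i - p) \<bullet> \<nu> > 0"
    and CK: "CK \<ge> 0" and Ca: "Ca \<ge> 0"
    and area: "\<And>i. i \<in> {1..N} \<Longrightarrow> area (band_Kt P Q i) \<le> CK * area (band_K P Q i)"
      "\<And>i. i \<in> {1..N} \<Longrightarrow> area (band_Kt P Q i) \<le> CK * area (band_K P Q (i - 1))"
    and angle: "\<And>i. i \<in> {1..N} \<Longrightarrow> sin (pi - band_alpha P Q (i - 1)) \<le> Ca * sin (pi - band_alphat P Q i)"
    and L: "0 \<le> L" "L \<le> 36 * (\<Sum>i=1..N. \<bar>(A (band_K P Q i) - A (band_K P Q (i - 1))) \<bullet> e\<bar>)"
    and E: "\<And>K x. K \<in> \<T> \<Longrightarrow> x \<in> K \<Longrightarrow> area K * (norm (A K - 2 *\<^sub>R x))\<^sup>2 \<le> E K"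
  shows "(MIN i\<in>{1..N}. 1 / (sin (pi - band_alphat P Q i))\<^sup>2) * (MIN i\<in>{1..N}. area (band_Kt P Q i)) * L\<^sup>2 / real N
    \<le> 36\<^sup>2 * (32 * (1 + Ca)\<^sup>2 * (1 + CK)) * (\<Sum>K\<in>band_elements N P Q. E K)"
proof -
  define m1 where "m1 = (MIN i\<in>{1..N}. 1 / (sin (pi - band_alphat P Q i))\<^sup>2)"
  define m2 where "m2 = (MIN i\<in>{1..N}. area (band_Kt P Q i))"
  define \<delta> where "\<delta> i = \<bar>(A (band_K P Q i) - A (band_K P Q (i - 1))) \<bullet> e\<bar>" for i
  let ?K = "band_K P Q" and ?Kt = "band_Kt P Q"
  have N: "1 \<le> N" using band by (simp add: is_band_def)
  have KT: "?K i \<in> \<T>" if "i \<le> N" for i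
    using band that unfolding is_band_def band_elements_def by auto
  have KtT: "?Kt i \<in> \<T>" if "i \<in> {1..N}" for i
    using band that unfolding is_band_def band_elements_def by auto
  have E0: "0 \<le> E K" if "K \<in> \<T>" "x \<in> K" for K x
    using E[OF that] by (rule order_trans[rotated]) simp
  have m: "0 \<le> m1" "0 \<le> m2"
    unfolding m1_def m2_def using N by (auto intro!: Min.boundedI)
  have m1: "m1 \<le> 1 / (sin (band_alphat P Q i))\<^sup>2" if "i \<in> {1..N}" for i
  proof -
    have "m1 \<le> 1 / (sin (pi - band_alphat P Q i))\<^sup>2"
      unfolding m1_def using that by (intro Min_le) auto
    then show ?thesis by simp
  qed
  have m2: "m2 \<le> area (?Kt i)" if "i \<in> {1..N}" for i
    unfolding m2_def using that by (intro Min_le) auto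
  have each: "m1 * m2 * (\<delta> i)\<^sup>2 \<le> 32 * (1 + Ca)\<^sup>2 * (E (?Kt i)) + 16 * (1 + Ca)\<^sup>2 * CK * (E (?K i) + E (?K (i - 1)))"
    if i: "i \<in> {1..N}" for i
  proof -
    define gt g1 g0 where g_defs: "gt = A (?Kt i)" "g1 = A (?K i)" "g0 = A (?K (i - 1))"
    define T where "T = norm (gt - g1) + norm (gt - g0)"
    define sn where "sn = sin (band_alphat P Q i)"
    have i': "i \<le> N" "i - 1 \<le> N" "Suc (i - 1) = i" using i by auto
    have j: "\<delta> i \<le> 2 * (1 + Ca) * T * sn"
      using band_jump[OF band fr mono P Q i Ca angle[OF i]] unfolding \<delta>_def T_def sn_def g_defs .
    have T0: "T \<ge> 0" by (simp add: T_def)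
    have \<delta>0: "\<delta> i \<ge> 0" by (simp add: \<delta>_def)
    have "m1 * (\<delta> i)\<^sup>2 \<le> (2 * (1 + Ca) * T)\<^sup>2"
    \<comment> \<open>If the sine vanishes, \<open>1 / 0 = 0\<close> makes the minimum
      \<open>m1\<close> nonpositive, and the bound is trivial.\<close>
    proof (cases "sn = 0")
      case True
      then have "m1 \<le> 0" using m1[OF i] by (simp add: sn_def)
      then have "m1 * (\<delta> i)\<^sup>2 \<le> 0" by (intro mult_nonpos_nonneg) auto
      then show ?thesis using zero_le_power2 order_trans by blast
    next
      case False
      have "(\<delta> i)\<^sup>2 \<le> (2 * (1 + Ca) * T)\<^sup>2 * sn\<^sup>2"
        using power_mono[OF j \<delta>0, of 2] by (simp only: power_mult_distrib)
      then have "m1 * (\<delta> i)\<^sup>2 \<le> 1 / sn\<^sup>2 * ((2 * (1 + Ca) * T)\<^sup>2 * sn\<^sup>2)"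
        using m1[OF i] m unfolding sn_def by (intro mult_mono) auto
      then show ?thesis using False by simp
    qed
    then have "m2 * (m1 * (\<delta> i)\<^sup>2) \<le> area (?Kt i) * (2 * (1 + Ca) * T)\<^sup>2"
      using m2[OF i] m by (intro mult_mono) auto
    moreover have "(2 * (1 + Ca) * T)\<^sup>2 = 4 * (1 + Ca)\<^sup>2 * T\<^sup>2"
      by (simp only: power_mult_distrib) simp
    ultimately have "m1 * m2 * (\<delta> i)\<^sup>2 \<le> 4 * (1 + Ca)\<^sup>2 * (area (?Kt i) * T\<^sup>2)"
      by (simp only: mult_ac)
    also have "area (?Kt i) * T\<^sup>2 \<le> 8 * E (?Kt i) + 4 * CK * (E (?K i) + E (?K (i - 1)))"
    proof -
      define a b1 b0 where ab: "a = norm (gt - 2 *\<^sub>R P i)" "b1 = norm (g1 - 2 *\<^sub>R P i)" "b0 = norm (g0 - 2 *\<^sub>R P i)"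
      have "norm (gt - g1) \<le> a + b1" "norm (gt - g0) \<le> a + b0"
        using norm_triangle_ineq4[of "gt - 2 *\<^sub>R P i" "g1 - 2 *\<^sub>R P i"]
          norm_triangle_ineq4[of "gt - 2 *\<^sub>R P i" "g0 - 2 *\<^sub>R P i"] by (auto simp: ab)
      then have "T \<le> 2 * a + b1 + b0" by (simp add: T_def)
      then have "T\<^sup>2 \<le> (2 * a + b1 + b0)\<^sup>2" using T0 by (rule power_mono)
      \<comment> \<open>Weighted Cauchy-Schwarz with weights 2, 1, 1 of sum 4. The flat triangle
        enters twice because its gradient is compared with both neighbours.\<close>
      also have "\<dots> \<le> 8 * a\<^sup>2 + 4 * b1\<^sup>2 + 4 * b0\<^sup>2"
      proof -
        have "8 * a\<^sup>2 + 4 * b1\<^sup>2 + 4 * b0\<^sup>2 - (2 * a + b1 + b0)\<^sup>2 = 2 * (a - b1)\<^sup>2 + 2 * (a - b0)\<^sup>2 + (b1 - b0)\<^sup>2"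
          by (simp add: power2_eq_square algebra_simps)
        then show ?thesis
          using zero_le_power2[of "a - b1"] zero_le_power2[of "a - b0"] zero_le_power2[of "b1 - b0"] by linarith
      qed
      finally have "area (?Kt i) * T\<^sup>2 \<le> area (?Kt i) * (8 * a\<^sup>2 + 4 * b1\<^sup>2 + 4 * b0\<^sup>2)"
        by (rule mult_left_mono) simp
      also have "\<dots> = 8 * (area (?Kt i) * a\<^sup>2) + 4 * (area (?Kt i) * b1\<^sup>2) + 4 * (area (?Kt i) * b0\<^sup>2)"
        by (simp add: algebra_simps)
      also have "\<dots> \<le> 8 * E (?Kt i) + 4 * (CK * E (?K i)) + 4 * (CK * E (?K (i - 1)))"
      proof (intro add_mono mult_left_mono)
        show "area (?Kt i) * a\<^sup>2 \<le> E (?Kt i)"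
          unfolding ab g_defs by (rule E[OF KtT[OF i] band_points(6)])
        have "area (?Kt i) * b1\<^sup>2 \<le> CK * area (?K i) * b1\<^sup>2"
          by (rule mult_right_mono[OF area(1)[OF i]]) simp
        also have "\<dots> \<le> CK * E (?K i)"
          using mult_left_mono[OF E[OF KT[OF i'(1)] band_points(1)] CK] unfolding ab g_defs by (simp add: mult.assoc)
        finally show "area (?Kt i) * b1\<^sup>2 \<le> CK * E (?K i)" .
        have "P i \<in> ?K (i - 1)" using band_points(2)[of P "i - 1" Q] unfolding i'(3) .
        then have "CK * (area (?K (i - 1)) * b0\<^sup>2) \<le> CK * E (?K (i - 1))"
          unfolding ab g_defs by (intro mult_left_mono[OF E[OF KT[OF i'(2)]] CK])
        moreover have "area (?Kt i) * b0\<^sup>2 \<le> CK * area (?K (i - 1)) * b0\<^sup>2"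
          by (rule mult_right_mono[OF area(2)[OF i]]) simp
        ultimately show "area (?Kt i) * b0\<^sup>2 \<le> CK * E (?K (i - 1))" by (simp add: mult.assoc)
      qed auto
      finally show ?thesis by (simp add: algebra_simps)
    qed
    then have "4 * (1 + Ca)\<^sup>2 * (area (?Kt i) * T\<^sup>2) \<le>
        4 * (1 + Ca)\<^sup>2 * (8 * E (?Kt i) + 4 * CK * (E (?K i) + E (?K (i - 1))))"
      by (intro mult_left_mono) auto
    also have "\<dots> = 32 * (1 + Ca)\<^sup>2 * (E (?Kt i)) + 16 * (1 + Ca)\<^sup>2 * CK * (E (?K i) + E (?K (i - 1)))"
      by (simp add: algebra_simps)
    finally show ?thesis .
  qed
  have sums: "(\<Sum>i\<in>{1..N}. E (?K i)) \<le> (\<Sum>i\<in>{0..N}. E (?K i))"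
    "(\<Sum>i\<in>{1..N}. E (?K (i - 1))) \<le> (\<Sum>i\<in>{0..N}. E (?K i))"
  proof -
    have nn: "0 \<le> E (?K i)" if "i \<in> {0..N}" for i
      using E0[OF KT band_points(1)] that by simp
    show "(\<Sum>i\<in>{1..N}. E (?K i)) \<le> (\<Sum>i\<in>{0..N}. E (?K i))"
      using nn by (intro sum_mono2) auto
    have "(\<Sum>i\<in>{1..N}. E (?K (i - 1))) = (\<Sum>i\<in>{0..<N}. E (?K i))"
      by (rule sum.reindex_bij_witness[of _ Suc "\<lambda>i. i - 1"]) auto
    also have "\<dots> \<le> (\<Sum>i\<in>{0..N}. E (?K i))"
      using nn by (intro sum_mono2) auto
    finally show "(\<Sum>i\<in>{1..N}. E (?K (i - 1))) \<le> (\<Sum>i\<in>{0..N}. E (?K i))" .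
  qed
  define SK where "SK = (\<Sum>i\<in>{0..N}. E (?K i))"
  define SKt where "SKt = (\<Sum>i\<in>{1..N}. E (?Kt i))"
  \<comment> \<open>The elements of a band are distinct, so the sum over the set splits into the two
    indexed sums without multiplicities.\<close>
  have S: "(\<Sum>K\<in>band_elements N P Q. E K) = SK + SKt"
  proof -
    have inj: "inj_on ?K {0..N}" "inj_on ?Kt {1..N}" "?K ` {0..N} \<inter> ?Kt ` {1..N} = {}"
      using band by (auto simp only: is_band_def)
    show ?thesis
      unfolding band_elements_def SK_def SKt_def
      by (simp only: sum.union_disjoint[OF finite_imageI finite_imageI inj(3)] finite_atLeastAtMost
          sum.reindex[OF inj(1)] sum.reindex[OF inj(2)] comp_def)
  qed
  have S0: "0 \<le> SK" "0 \<le> SKt"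
    unfolding SK_def SKt_def using E0[OF KT band_points(1)] E0[OF KtT band_points(6)]
    by (auto intro!: sum_nonneg)
  have "(\<Sum>i=1..N. \<delta> i)\<^sup>2 \<le> real N * (\<Sum>i=1..N. (\<delta> i)\<^sup>2)"
    using Cauchy_Schwarz_ineq_sum[of "\<lambda>_. 1" \<delta> "{1..N}"] by simp
  moreover have "L\<^sup>2 \<le> (36 * (\<Sum>i=1..N. \<delta> i))\<^sup>2"
    using L unfolding \<delta>_def by (intro power_mono) auto
  ultimately have "L\<^sup>2 \<le> 36\<^sup>2 * (real N * (\<Sum>i=1..N. (\<delta> i)\<^sup>2))"
    by (simp add: power_mult_distrib)
  then have "L\<^sup>2 / real N \<le> 36\<^sup>2 * (\<Sum>i=1..N. (\<delta> i)\<^sup>2)"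
    using N by (simp add: field_simps)
  then have "m1 * m2 * (L\<^sup>2 / real N) \<le> m1 * m2 * (36\<^sup>2 * (\<Sum>i=1..N. (\<delta> i)\<^sup>2))"
    using m by (intro mult_left_mono) auto
  also have "\<dots> = 36\<^sup>2 * (\<Sum>i=1..N. m1 * m2 * (\<delta> i)\<^sup>2)"
    unfolding sum_distrib_left[of "m1 * m2", symmetric] by (simp only: mult_ac)
  also have "\<dots> \<le> 36\<^sup>2 * (\<Sum>i=1..N. 32 * (1 + Ca)\<^sup>2 * (E (?Kt i)) + 16 * (1 + Ca)\<^sup>2 * CK * (E (?K i) + E (?K (i - 1))))"
    by (intro mult_left_mono sum_mono each) auto
  also have "(\<Sum>i=1..N. 32 * (1 + Ca)\<^sup>2 * (E (?Kt i)) + 16 * (1 + Ca)\<^sup>2 * CK * (E (?K i) + E (?K (i - 1)))) =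
      32 * (1 + Ca)\<^sup>2 * SKt + 16 * (1 + Ca)\<^sup>2 * CK * ((\<Sum>i=1..N. E (?K i)) + (\<Sum>i=1..N. E (?K (i - 1))))"
    by (simp add: sum.distrib sum_distrib_left[symmetric] SKt_def)
  also have "36\<^sup>2 * (32 * (1 + Ca)\<^sup>2 * SKt + 16 * (1 + Ca)\<^sup>2 * CK * ((\<Sum>i=1..N. E (?K i)) + (\<Sum>i=1..N. E (?K (i - 1))))) \<le>
      36\<^sup>2 * (32 * (1 + Ca)\<^sup>2 * (1 + CK) * (SK + SKt))"
  proof (rule mult_left_mono)
    define B where "B = 16 * (1 + Ca)\<^sup>2"
    have B0: "B \<ge> 0" by (simp add: B_def)
    \<comment> \<open>Each triangle on the edge takes part in at most two jumps, so 16 doubles to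
      the common factor 32.\<close>
    have "CK * ((\<Sum>i=1..N. E (?K i)) + (\<Sum>i=1..N. E (?K (i - 1)))) \<le> CK * (SK + SK)"
      unfolding SK_def by (intro mult_left_mono add_mono sums CK)
    then have "2 * SKt + CK * ((\<Sum>i=1..N. E (?K i)) + (\<Sum>i=1..N. E (?K (i - 1)))) \<le> 2 * ((1 + CK) * (SK + SKt))"
      using S0 mult_nonneg_nonneg[OF CK S0(2)] by (simp add: algebra_simps)
    then have "B * (2 * SKt + CK * ((\<Sum>i=1..N. E (?K i)) + (\<Sum>i=1..N. E (?K (i - 1))))) \<le> B * (2 * ((1 + CK) * (SK + SKt)))"
      using B0 by (rule mult_left_mono)
    then show "32 * (1 + Ca)\<^sup>2 * SKt + 16 * (1 + Ca)\<^sup>2 * CK * ((\<Sum>i=1..N. E (?K i)) + (\<Sum>i=1..N. E (?K (i - 1)))) \<le>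
        32 * (1 + Ca)\<^sup>2 * (1 + CK) * (SK + SKt)"
      unfolding B_def by (simp only: distrib_left mult.assoc[symmetric]) (simp add: mult_ac)
  qed simp
  finally show ?thesis
    unfolding S m1_def m2_def by (simp add: mult.assoc)
qed

end

section \<open>Meshes as instances, the size of the constants, and the sum over all bands\<close>

lemma conforming_interiors_disjoint:
  assumes "triangulation \<T>" "K \<in> \<T>" "L \<in> \<T>" "K \<noteq> L"
  shows "interior K \<inter> interior L = {}"
proof (rule ccontr)
  assume ne: "interior K \<inter> interior L \<noteq> {}"
  have f: "K \<inter> L face_of K" "L \<inter> K face_of L"
    using assms by (auto simp: triangulation_def)
  have "K \<inter> L \<inter> rel_interior K \<noteq> {}" "L \<inter> K \<inter> rel_interior L \<noteq> {}"
    using ne interior_subset_rel_interior interior_subset by blast+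
  \<comment> \<open>A face that meets the relative interior of a convex set is the whole set, so
    each element would contain the other.\<close>
  then have "K \<subseteq> K \<inter> L" "L \<subseteq> L \<inter> K"
    using subset_of_face_of[OF f(1) subset_refl] subset_of_face_of[OF f(2) subset_refl] by blast+
  then show False using assms(4) by blast
qed

text \<open>In barycentric coordinates the interpolation error of x \<bullet> x is a variance: the
  weighted mean of the squared distances from \<open>z\<close> to the vertices. It therefore lies
  between 0 and h^2.\<close>

lemma lagrange_interpolant_error:
  assumes K: "2 simplex K" and h: "\<And>x y. x \<in> K \<Longrightarrow> y \<in> K \<Longrightarrow> dist x y \<le> h"
    and aff: "\<And>x. x \<in> K \<Longrightarrow> v x = a \<bullet> x + (d :: real)"
    and nodes: "\<And>x. x extreme_point_of K \<Longrightarrow> v x = quad_fun x" and z: "z \<in> K"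
  shows "\<bar>quad_fun z - v z\<bar> \<le> h\<^sup>2"
proof -
  obtain p q r where pqr: "K = convex hull {p, q, r}" "\<not> collinear {p, q, r}"
    using K by (rule triangleE)
  have "\<not> affine_dependent {p, q, r}"
    using pqr(2) affine_dependent_imp_collinear_3 by blast
  then have ext: "v x = x \<bullet> x" if "x \<in> {p, q, r}" for x
    using nodes[of x] that unfolding pqr(1) extreme_point_of_convex_hull_affine_independent quad_fun_eq
    by (simp add: extreme_point_of_convex_hull_affine_independent)
  have inK: "p \<in> K" "q \<in> K" "r \<in> K" unfolding pqr(1) by (auto intro: hull_inc)
  obtain l m n where c: "0 \<le> l" "0 \<le> m" "0 \<le> n" "l + m + n = 1" "z = l *\<^sub>R p + m *\<^sub>R q + n *\<^sub>R r"
    using z unfolding pqr(1) convex_hull_3 by auto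
  have "v z = l * v p + m * v q + n * v r"
  proof -
    have "d = l * d + m * d + n * d" using c(4) by (metis distrib_right mult_1)
    moreover have "a \<bullet> z = l * (a \<bullet> p) + m * (a \<bullet> q) + n * (a \<bullet> r)"
      unfolding c(5) by (simp add: inner_add_right)
    ultimately show ?thesis
      unfolding aff[OF z] aff[OF inK(1)] aff[OF inK(2)] aff[OF inK(3)] by (simp add: distrib_left)
  qed
  also have "\<dots> = l * (p \<bullet> p) + m * (q \<bullet> q) + n * (r \<bullet> r)" using ext by simp
  finally have vz: "v z = l * (p \<bullet> p) + m * (q \<bullet> q) + n * (r \<bullet> r)" .
  have zz: "l * (p \<bullet> z) + m * (q \<bullet> z) + n * (r \<bullet> z) = z \<bullet> z"
    using arg_cong[OF c(5), of "\<lambda>y. y \<bullet> z"] by (simp add: inner_add_left)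
  have "v z = l * ((p - z) \<bullet> (p - z)) + m * ((q - z) \<bullet> (q - z)) + n * ((r - z) \<bullet> (r - z))
      + 2 * (l * (p \<bullet> z) + m * (q \<bullet> z) + n * (r \<bullet> z)) - (l + m + n) * (z \<bullet> z)"
    unfolding vz by (simp add: inner_diff_left inner_diff_right inner_commute algebra_simps)
  then have eq: "v z - z \<bullet> z = l * ((p - z) \<bullet> (p - z)) + m * ((q - z) \<bullet> (q - z)) + n * ((r - z) \<bullet> (r - z))"
    unfolding zz c(4) by simp
  have b: "(x - z) \<bullet> (x - z) \<le> h\<^sup>2" if "x \<in> K" for x
  proof -
    have "norm (x - z) \<le> h" using h[OF that z] by (simp add: dist_norm)
    then show ?thesis
      using power_mono[of "norm (x - z)" h 2] by (simp add: power2_norm_eq_inner)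
  qed
  have "v z - z \<bullet> z \<le> l * h\<^sup>2 + m * h\<^sup>2 + n * h\<^sup>2"
    unfolding eq using c b inK by (intro add_mono mult_left_mono) auto
  also have "\<dots> = h\<^sup>2" using c(4) by (metis distrib_right mult_1)
  finally have "v z - z \<bullet> z \<le> h\<^sup>2" .
  moreover have "0 \<le> v z - z \<bullet> z"
    unfolding eq using c by (intro add_nonneg_nonneg mult_nonneg_nonneg) auto
  ultimately show ?thesis by (simp add: quad_fun_eq)
qed

text \<open>Fixes the threshold for \<open>CL\<close>. Both terms on the left are at most a constant
  times h^(2 \<alpha>): the boundary term because 2 \<alpha> \<le> 4, where \<open>max 1 h0\<close>
  accounts for h > 1. The fifth power of the length bound is CL^5 h^(2 \<alpha>), and CL > 1 gives
  CL^5 \<ge> CL.\<close>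

lemma band_length_dominates:
  fixes h h0 \<alpha> D Cu H CL L :: real
  assumes h: "0 < h" "h < h0" and \<alpha>: "\<alpha> \<in> {0..1}" and D: "0 \<le> D" "L \<le> D"
    and H: "0 \<le> H" "H \<le> Cu * h powr \<alpha>"
    and CL: "CL > max 1 (243 * D * (12 * (max 1 h0) ^ 4 + 36 * Cu\<^sup>2))"
    and L: "L \<ge> CL * h powr (2 * \<alpha> / 5)"
  shows "12 * (h\<^sup>2)\<^sup>2 * L + 36 * D * H\<^sup>2 < L ^ 5 / 243"
proof -
  define r where "r = h powr (2 * \<alpha>)"
  have r: "r > 0" using h by (simp add: r_def)
  define \<kappa> where "\<kappa> = 243 * D * (12 * (max 1 h0) ^ 4 + 36 * Cu\<^sup>2)"
  have "H\<^sup>2 \<le> (Cu * h powr \<alpha>)\<^sup>2" using H by (intro power_mono) auto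
  also have "\<dots> = Cu\<^sup>2 * r"
    using h by (simp add: r_def power_mult_distrib powr_power mult.commute)
  finally have H2: "H\<^sup>2 \<le> Cu\<^sup>2 * r" .
  have "h ^ 4 = h powr 4" using h by simp
  also have "\<dots> = h powr (2 * \<alpha>) * h powr (4 - 2 * \<alpha>)"
    unfolding powr_add[symmetric] by (rule arg_cong[of _ _ "\<lambda>x. h powr x"]) simp
  finally have split: "h ^ 4 = r * h powr (4 - 2 * \<alpha>)" by (simp only: r_def)
  have "h powr (4 - 2 * \<alpha>) \<le> (max 1 h0) powr (4 - 2 * \<alpha>)"
    using h \<alpha> by (intro powr_mono2) auto
  also have "(max 1 h0) powr (4 - 2 * \<alpha>) \<le> (max 1 h0) powr 4"
    using \<alpha> by (intro powr_mono) auto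
  also have "(max 1 h0) powr 4 = (max 1 h0) ^ 4"
    by simp
  finally have h4: "h ^ 4 \<le> r * (max 1 h0) ^ 4"
    unfolding split using r by (intro mult_left_mono) auto
  have "12 * (h\<^sup>2)\<^sup>2 * L + 36 * D * H\<^sup>2 = 12 * (L * h ^ 4) + 36 * (D * H\<^sup>2)"
    by (simp flip: power_mult)
  also have "\<dots> \<le> 12 * (D * (r * (max 1 h0) ^ 4)) + 36 * (D * (Cu\<^sup>2 * r))"
    using D h4 H2 h by (intro add_mono mult_left_mono mult_mono) auto
  also have "\<dots> = \<kappa> * r / 243" by (simp add: \<kappa>_def algebra_simps)
  finally have "12 * (h\<^sup>2)\<^sup>2 * L + 36 * D * H\<^sup>2 \<le> \<kappa> * r / 243" .
  moreover have "\<kappa> * r < L ^ 5"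
  proof -
    have CL1: "CL > 1" "CL > \<kappa>" using CL by (auto simp: \<kappa>_def)
    have "\<kappa> * r < CL * r" using CL1(2) r by (rule mult_strict_right_mono)
    also have "CL * r \<le> CL ^ 5 * r"
      using r CL1 by (intro mult_right_mono self_le_power) auto
    also have "CL ^ 5 * r = (CL * h powr (2 * \<alpha> / 5)) ^ 5"
      using h by (simp add: r_def powr_power power_mult_distrib)
    also have "\<dots> \<le> L ^ 5" using L CL1 by (intro power_mono) auto
    finally show ?thesis .
  qed
  ultimately show ?thesis by simp
qed

text \<open>The theorem in squared form. Two meshes play different parts: the slope variation is
  forced by the error on the whole domain, whereas the amplified jumps are charged to the energy on
  the band elements only.\<close>

lemma band_union_estimate:
  fixes \<Omega> :: "point set" and h h0 \<alpha> Cu CK Ca CL :: real and NB :: nat and N :: "nat \<Rightarrow> nat"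
  assumes \<Omega>: "open \<Omega>" "bounded \<Omega>"
    and h: "0 < h" "h < h0" and \<alpha>: "\<alpha> \<in> {0..1}"
    and \<T>: "conforming_triangulation \<Omega> \<T>" "mesh_size \<T> = h" and U: "U \<in> fe_space \<Omega> \<T>"
    and I: "lagrange_interpolant \<Omega> \<T> quad_fun I" "\<And>x. x \<in> frontier \<Omega> \<Longrightarrow> U x = I x"
    and H: "h1_seminorm \<Omega> (\<lambda>x. quad_fun x - U x) \<le> Cu * h powr \<alpha>"
    and CL: "CL > max 1 (243 * diameter (closure \<Omega>) * (12 * (max 1 h0) ^ 4 + 36 * Cu\<^sup>2))"
    and band: "\<And>b. b \<in> {1..NB} \<Longrightarrow> is_band \<T> (N b) (P b) (Q b)"
    and disj: "disjoint_family_on (\<lambda>b. band_elements (N b) (P b) (Q b)) {1..NB}"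
    and area: "\<And>b i. b \<in> {1..NB} \<Longrightarrow> i \<in> {1..N b} \<Longrightarrow> area (band_Kt (P b) (Q b) i) \<le> CK * area (band_K (P b) (Q b) i)"
      "\<And>b i. b \<in> {1..NB} \<Longrightarrow> i \<in> {1..N b} \<Longrightarrow> area (band_Kt (P b) (Q b) i) \<le> CK * area (band_K (P b) (Q b) (i - 1))"
    and angle: "\<And>b i. b \<in> {1..NB} \<Longrightarrow> i \<in> {1..N b} \<Longrightarrow>
      sin (pi - band_alpha (P b) (Q b) (i - 1)) \<le> Ca * sin (pi - band_alphat (P b) (Q b) i)"
    and len: "\<And>b. b \<in> {1..NB} \<Longrightarrow> band_length (N b) (P b) \<ge> CL * h powr (2 * \<alpha> / 5)"
    and nonneg: "0 \<le> CK" "0 \<le> Ca"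
  defines "B \<equiv> (\<Union>b\<in>{1..NB}. \<Union>(band_elements (N b) (P b) (Q b)))"
  shows "(\<Sum>b=1..NB. (MIN i\<in>{1..N b}. 1 / (sin (pi - band_alphat (P b) (Q b) i))\<^sup>2) *
        (MIN i\<in>{1..N b}. area (band_Kt (P b) (Q b) i)) * (band_length (N b) (P b))\<^sup>2 / real (N b))
    \<le> 36\<^sup>2 * (32 * (1 + Ca)\<^sup>2 * (1 + CK)) *
        (2 * (h1_seminorm B (\<lambda>x. quad_fun x - U x))\<^sup>2 + 8 * h\<^sup>2 * area (closure \<Omega>))"
proof -
  have tri: "triangulation \<T>" and tri2: "\<And>K. K \<in> \<T> \<Longrightarrow> 2 simplex K" and cover: "closure \<Omega> = \<Union>\<T>"
    using \<T>(1) by (auto simp: conforming_triangulation_def)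
  have fin: "finite \<T>" using tri by (simp add: triangulation_def)
  define D where "D = diameter (closure \<Omega>)"
  have bdd: "bounded (closure \<Omega>)" using \<Omega>(2) by (rule bounded_closure)
  have D: "dist x y \<le> D" if "x \<in> closure \<Omega>" "y \<in> closure \<Omega>" for x y
    unfolding D_def using bdd that by (rule diameter_bounded_bound)
  have D0: "D \<ge> 0" unfolding D_def using bdd by (rule diameter_ge_0)
  have diam: "dist x y \<le> h" if "K \<in> \<T>" "x \<in> K" "y \<in> K" for K x y
  proof -
    have "bounded K" using triangle_compact(1)[OF tri2[OF that(1)]] by (rule compact_imp_bounded)
    then have "dist x y \<le> diameter K" using that by (intro diameter_bounded_bound)
    also have "\<dots> \<le> mesh_size \<T>"
      unfolding mesh_size_def using fin that(1) by (intro Max_ge) auto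
    finally show ?thesis using \<T>(2) by simp
  qed
  have "\<forall>K\<in>\<T>. \<exists>a d. \<forall>x\<in>K. U x = a \<bullet> x + d" using U by (simp add: fe_space_def)
  then obtain A c where Ac: "\<And>K x. K \<in> \<T> \<Longrightarrow> x \<in> K \<Longrightarrow> U x = A K \<bullet> x + c K" by metis
  interpret full: piecewise_affine \<T> U A c
    by unfold_locales (use fin tri2 conforming_interiors_disjoint[OF tri] Ac in auto)
  define \<T>' where "\<T>' = (\<Union>b\<in>{1..NB}. band_elements (N b) (P b) (Q b))"
  have "band_elements (N b) (P b) (Q b) \<subseteq> \<T>" if "b \<in> {1..NB}" for b
    using band[OF that] unfolding is_band_def by (elim conjE)
  then have sub: "\<T>' \<subseteq> \<T>" unfolding \<T>'_def by (rule UN_least)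
  \<comment> \<open>\<open>err\<close> depends on \<open>U\<close> alone and is common to both
    instances; \<open>G\<close> depends on the set of triangles, and \<open>bands.G\<close> computes
    the seminorm on the union of the bands.\<close>
  interpret bands: piecewise_affine \<T>' U A c
    by unfold_locales (use sub finite_subset[OF sub fin] tri2 full.interiors_disjoint Ac in blast)+
  have err: "full.err = (\<lambda>x. quad_fun x - U x)" by (rule ext) (simp add: full.err_def)
  have B: "B = \<Union>\<T>'" by (auto simp: B_def \<T>'_def)
  have \<beta>: "\<bar>full.err x\<bar> \<le> h\<^sup>2" if x: "x \<in> frontier \<Omega>" for x
  proof -
    have "x \<in> \<Union>\<T>" using x cover by (auto simp: frontier_def)
    then obtain K where K: "K \<in> \<T>" "x \<in> K" by blast
    obtain a d where "\<forall>y\<in>K. I y = a \<bullet> y + d"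
      using I(1) K(1) unfolding lagrange_interpolant_def fe_space_def by blast
    then have "\<bar>quad_fun x - I x\<bar> \<le> h\<^sup>2"
      using I(1) K by (intro lagrange_interpolant_error[OF tri2[OF K(1)] diam[OF K(1)], of I a d])
        (auto simp: lagrange_interpolant_def)
    then show ?thesis using I(2)[OF x] by (simp add: err)
  qed
  have H0: "0 \<le> h1_seminorm \<Omega> full.err"
    unfolding h1_seminorm_def set_lebesgue_integral_def
    by (intro real_sqrt_ge_zero Bochner_Integration.integral_nonneg) auto
  define E where "E K = 2 * (LINT x:interior K|lborel. (norm (bands.G x))\<^sup>2) + 8 * h\<^sup>2 * area K" for K
  define M where "M = 36\<^sup>2 * (32 * (1 + Ca)\<^sup>2 * (1 + CK))"
  have M0: "M \<ge> 0" using nonneg by (simp add: M_def)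
  have each: "(MIN i\<in>{1..N b}. 1 / (sin (pi - band_alphat (P b) (Q b) i))\<^sup>2) *
        (MIN i\<in>{1..N b}. area (band_Kt (P b) (Q b) i)) * (band_length (N b) (P b))\<^sup>2 / real (N b)
      \<le> M * (\<Sum>K\<in>band_elements (N b) (P b) (Q b). E K)" if b: "b \<in> {1..NB}" for b
  proof -
    note bb = band[OF b]
    obtain p e \<nu> \<tau> where fr: "orthonormal_frame e \<nu>" and mono: "strict_mono_on {0..N b + 1} \<tau>"
      and P: "\<And>i. i \<le> N b + 1 \<Longrightarrow> P b i = p + \<tau> i *\<^sub>R e" and Q: "\<And>i. i \<le> N b \<Longrightarrow> (Q b i - p) \<bullet> \<nu> > 0"
      and L: "band_length (N b) (P b) = \<tau> (N b + 1) - \<tau> 0"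
      by (rule is_band_frame[OF bb]) blast
    define L where "L = band_length (N b) (P b)"
    have Lpos: "0 < L" unfolding L_def L using mono by (auto simp: strict_mono_on_def)
    have PT: "P b 0 \<in> closure \<Omega>" "P b (N b + 1) \<in> closure \<Omega>"
    proof -
      have "band_K (P b) (Q b) 0 \<in> \<T>" "band_K (P b) (Q b) (N b) \<in> \<T>"
        using bb unfolding is_band_def band_elements_def by auto
      then show "P b 0 \<in> closure \<Omega>" "P b (N b + 1) \<in> closure \<Omega>"
        unfolding cover using band_points(1)[of "P b" 0 "Q b"] band_points(2)[of "P b" "N b" "Q b"] by auto
    qed
    have "dist (P b (N b + 1)) (P b 0) = L"
    proof -
      have "P b (N b + 1) - P b 0 = L *\<^sub>R e"
        using P[of "N b + 1"] P[of 0] by (simp add: L_def L scaleR_diff_left)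
      then show ?thesis using fr Lpos by (simp add: dist_norm orthonormal_frame_def)
    qed
    then have LD: "L \<le> D" using D[OF PT(2,1)] by simp
    have large: "12 * (h\<^sup>2)\<^sup>2 * L + 36 * D * (h1_seminorm \<Omega> full.err)\<^sup>2 < L ^ 5 / 243"
      using band_length_dominates[OF h \<alpha> D0 LD H0 _ CL[folded D_def] len[OF b, folded L_def]] H
      unfolding err by blast
    have "L < 36 * (\<Sum>i=1..N b. \<bar>(A (band_K (P b) (Q b) i) - A (band_K (P b) (Q b) (i - 1))) \<bullet> e\<bar>)"
      by (rule full.band_slope_variation[OF bb fr mono P \<Omega> cover D \<beta> _ large]) (auto simp: L_def L)
    then have Lle: "0 \<le> L" "L \<le> 36 * (\<Sum>i=1..N b. \<bar>(A (band_K (P b) (Q b) i) - A (band_K (P b) (Q b) (i - 1))) \<bullet> e\<bar>)"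
      using Lpos by auto
    \<comment> \<open>The bands are also bands of the smaller mesh, so their energy can be estimated
      there.\<close>
    have bb': "is_band \<T>' (N b) (P b) (Q b)"
    proof -
      have "band_elements (N b) (P b) (Q b) \<subseteq> \<T>'" using b by (auto simp: \<T>'_def)
      then show ?thesis using bb unfolding is_band_def by blast
    qed
    show ?thesis
      unfolding M_def L_def[symmetric]
    proof (rule bands.band_energy[OF bb' fr mono P Q nonneg area[OF b] angle[OF b] Lle])
      fix K x assume "K \<in> \<T>'" "x \<in> K"
      then show "area K * (norm (A K - 2 *\<^sub>R x))\<^sup>2 \<le> E K"
        unfolding E_def using diam sub by (intro bands.triangle_gradient_error) auto
    qed
  qed
  have "(\<Sum>b=1..NB. (MIN i\<in>{1..N b}. 1 / (sin (pi - band_alphat (P b) (Q b) i))\<^sup>2) *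
        (MIN i\<in>{1..N b}. area (band_Kt (P b) (Q b) i)) * (band_length (N b) (P b))\<^sup>2 / real (N b))
      \<le> (\<Sum>b=1..NB. M * (\<Sum>K\<in>band_elements (N b) (P b) (Q b). E K))"
    by (intro sum_mono each)
  also have "\<dots> = M * (\<Sum>b=1..NB. \<Sum>K\<in>band_elements (N b) (P b) (Q b). E K)"
    by (rule sum_distrib_left[symmetric])
  \<comment> \<open>Disjointness of the bands: every element is counted once, hence the constant
    does not see the number of bands.\<close>
  also have "(\<Sum>b=1..NB. \<Sum>K\<in>band_elements (N b) (P b) (Q b). E K) = (\<Sum>K\<in>\<T>'. E K)"
    unfolding \<T>'_def
  proof (rule sum.UNION_disjoint[symmetric])
    show "\<forall>b\<in>{1..NB}. finite (band_elements (N b) (P b) (Q b))"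
      by (simp add: band_elements_def)
    show "\<forall>b\<in>{1..NB}. \<forall>b'\<in>{1..NB}. b \<noteq> b' \<longrightarrow> band_elements (N b) (P b) (Q b) \<inter> band_elements (N b') (P b') (Q b') = {}"
      using disj by (simp add: disjoint_family_on_def)
  qed simp
  also have "(\<Sum>K\<in>\<T>'. E K) = 2 * (\<Sum>K\<in>\<T>'. LINT x:interior K|lborel. (norm (bands.G x))\<^sup>2) + 8 * h\<^sup>2 * (\<Sum>K\<in>\<T>'. area K)"
    by (simp add: E_def sum.distrib sum_distrib_left)
  also have "M * \<dots> \<le> M * (2 * (h1_seminorm B (\<lambda>x. quad_fun x - U x))\<^sup>2 + 8 * h\<^sup>2 * area (closure \<Omega>))"
  proof (intro mult_left_mono add_mono)
    show "(\<Sum>K\<in>\<T>'. LINT x:interior K|lborel. (norm (bands.G x))\<^sup>2) \<le> (h1_seminorm B (\<lambda>x. quad_fun x - U x))\<^sup>2"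
      using bands.sum_interior_energy_le unfolding B err .
    show "(\<Sum>K\<in>\<T>'. area K) \<le> area (closure \<Omega>)"
    proof (rule bands.sum_area_le)
      show "compact (closure \<Omega>)" using bdd by (simp add: compact_eq_bounded_closed)
      show "\<Union>\<T>' \<subseteq> closure \<Omega>" unfolding cover using sub by (rule Union_mono)
    qed
  qed (use M0 in auto)
  finally show ?thesis by (simp add: M_def)
qed

theorem theorem2:
  fixes \<Omega> :: "point set" and h0 Cu :: real
  assumes "polygonal_lipschitz_domain \<Omega>" and "0 < h0"
  shows "\<exists>CLmin :: real \<Rightarrow> real. \<forall>CK Ca :: real. \<exists>C1>0. \<exists>C2>0.
    \<forall>\<alpha>\<in>{0..1}. \<forall>(\<T> :: real \<Rightarrow> point set set) (U :: real \<Rightarrow> point \<Rightarrow> real).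
      (\<forall>h\<in>{0<..<h0}.
         conforming_triangulation \<Omega> (\<T> h) \<and> mesh_size (\<T> h) = h \<and>
         U h \<in> fe_space \<Omega> (\<T> h) \<and>
         (\<exists>I. lagrange_interpolant \<Omega> (\<T> h) quad_fun I \<and> (\<forall>x\<in>frontier \<Omega>. U h x = I x)) \<and>
         h1_seminorm \<Omega> (\<lambda>x. quad_fun x - U h x) \<le> Cu * h powr \<alpha>) \<longrightarrow>
      (\<forall>CL>CLmin \<alpha>. \<forall>h\<in>{0<..<h0}.
        \<forall>(NB :: nat) (N :: nat \<Rightarrow> nat) (P :: nat \<Rightarrow> nat \<Rightarrow> point) (Q :: nat \<Rightarrow> nat \<Rightarrow> point).
        (\<forall>b\<in>{1..NB}. is_band (\<T> h) (N b) (P b) (Q b)) \<and>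
        disjoint_family_on (\<lambda>b. band_elements (N b) (P b) (Q b)) {1..NB} \<and>
        (\<forall>b\<in>{1..NB}. \<forall>i\<in>{1..N b}.
           area (band_Kt (P b) (Q b) i) \<le> CK * area (band_K (P b) (Q b) i) \<and>
           area (band_Kt (P b) (Q b) i) \<le> CK * area (band_K (P b) (Q b) (i - 1)) \<and>
           sin (pi - band_alpha (P b) (Q b) (i - 1)) \<le> Ca * sin (pi - band_alphat (P b) (Q b) i)) \<and>
        (\<forall>b\<in>{1..NB}. band_length (N b) (P b) \<ge> CL * h powr (2 * \<alpha> / 5)) \<longrightarrow>
        (\<exists>A1 A2 :: real.
           h1_seminorm (\<Union>b\<in>{1..NB}. \<Union>(band_elements (N b) (P b) (Q b)))
             (\<lambda>x. quad_fun x - U h x) \<ge> A1 - A2 \<and>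
           A1 \<ge> C1 * sqrt (\<Sum>b=1..NB.
                  (MIN i\<in>{1..N b}. 1 / (sin (pi - band_alphat (P b) (Q b) i))\<^sup>2) *
                  (MIN i\<in>{1..N b}. area (band_Kt (P b) (Q b) i)) *
                  (band_length (N b) (P b))\<^sup>2 / real (N b)) \<and>
           \<bar>A2\<bar> \<le> C2 * h powr \<alpha>))"
proof -
  have \<Omega>: "open \<Omega>" "bounded \<Omega>"
    using assms(1) by (auto simp: polygonal_lipschitz_domain_def)
  define Ar where "Ar = area (closure \<Omega>)"
  have Ar: "Ar \<ge> 0" by (simp add: Ar_def)
  \<comment> \<open>\<open>CK\<close> and \<open>Ca\<close> range over all reals, whereas the band
    estimate wants them nonnegative. Absolute values weaken the hypotheses suitably because areas
    and these sines are nonnegative.\<close>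
  define M where "M CK Ca = 36\<^sup>2 * (32 * (1 + \<bar>Ca\<bar>)\<^sup>2 * (1 + \<bar>CK\<bar>))" for CK Ca :: real
  have M: "M CK Ca > 0" for CK Ca
    unfolding M_def by (intro mult_pos_pos zero_less_power) auto
  have constants: "\<exists>C1>0. \<exists>C2>0. X C1 C2" if "X a b" "a > 0" "b > 0" for X and a b :: real
    using that by blast
  show ?thesis
  \<comment> \<open>The threshold comes from \<open>band_length_dominates\<close>; it involves the
    diameter of the domain, \<open>h0\<close> and \<open>Cu\<close>, and is constant in
    \<alpha>.\<close>
  proof (rule exI[of _ "\<lambda>_. max 1 (243 * diameter (closure \<Omega>) * (12 * (max 1 h0) ^ 4 + 36 * Cu\<^sup>2))"],
      intro allI, rule_tac a = "1 / sqrt (2 * M CK Ca)" and b = "2 * sqrt Ar * max 1 h0 + 1" in constants,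
      intro ballI allI impI)
    fix CK Ca :: real
    show "1 / sqrt (2 * M CK Ca) > 0" using M[of CK Ca] by simp
    \<comment> \<open>The summand 1 secures positivity from \<open>Ar \<ge> 0\<close> alone.\<close>
    show "2 * sqrt Ar * max 1 h0 + 1 > 0" using Ar by (simp add: add_nonneg_pos)
    fix \<alpha> :: real and \<T> :: "real \<Rightarrow> point set set" and U :: "real \<Rightarrow> point \<Rightarrow> real" and CL h :: real
      and NB :: nat and N :: "nat \<Rightarrow> nat" and P Q :: "nat \<Rightarrow> nat \<Rightarrow> point"
    assume \<alpha>: "\<alpha> \<in> {0..1}"
      and all: "\<forall>h\<in>{0<..<h0}. conforming_triangulation \<Omega> (\<T> h) \<and> mesh_size (\<T> h) = h \<and>
         U h \<in> fe_space \<Omega> (\<T> h) \<and>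
         (\<exists>I. lagrange_interpolant \<Omega> (\<T> h) quad_fun I \<and> (\<forall>x\<in>frontier \<Omega>. U h x = I x)) \<and>
         h1_seminorm \<Omega> (\<lambda>x. quad_fun x - U h x) \<le> Cu * h powr \<alpha>"
      and CL: "max 1 (243 * diameter (closure \<Omega>) * (12 * (max 1 h0) ^ 4 + 36 * Cu\<^sup>2)) < CL"
      and hh: "h \<in> {0<..<h0}"
      and bands: "(\<forall>b\<in>{1..NB}. is_band (\<T> h) (N b) (P b) (Q b)) \<and>
        disjoint_family_on (\<lambda>b. band_elements (N b) (P b) (Q b)) {1..NB} \<and>
        (\<forall>b\<in>{1..NB}. \<forall>i\<in>{1..N b}.
           area (band_Kt (P b) (Q b) i) \<le> CK * area (band_K (P b) (Q b) i) \<and>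
           area (band_Kt (P b) (Q b) i) \<le> CK * area (band_K (P b) (Q b) (i - 1)) \<and>
           sin (pi - band_alpha (P b) (Q b) (i - 1)) \<le> Ca * sin (pi - band_alphat (P b) (Q b) i)) \<and>
        (\<forall>b\<in>{1..NB}. band_length (N b) (P b) \<ge> CL * h powr (2 * \<alpha> / 5))"
    let ?B = "\<Union>b\<in>{1..NB}. \<Union>(band_elements (N b) (P b) (Q b))"
    let ?v = "\<lambda>x. quad_fun x - U h x"
    define S where "S = (\<Sum>b=1..NB. (MIN i\<in>{1..N b}. 1 / (sin (pi - band_alphat (P b) (Q b) i))\<^sup>2) *
        (MIN i\<in>{1..N b}. area (band_Kt (P b) (Q b) i)) * (band_length (N b) (P b))\<^sup>2 / real (N b))"
    define H where "H = h1_seminorm ?B ?v"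
    have h: "0 < h" "h < h0" using hh by auto
    obtain I where I: "conforming_triangulation \<Omega> (\<T> h)" "mesh_size (\<T> h) = h" "U h \<in> fe_space \<Omega> (\<T> h)"
        "lagrange_interpolant \<Omega> (\<T> h) quad_fun I" "\<And>x. x \<in> frontier \<Omega> \<Longrightarrow> U h x = I x"
        "h1_seminorm \<Omega> ?v \<le> Cu * h powr \<alpha>"
      using all hh by blast
    have H0: "H \<ge> 0"
      unfolding H_def h1_seminorm_def set_lebesgue_integral_def
      by (intro real_sqrt_ge_zero Bochner_Integration.integral_nonneg) auto
    have "S \<le> M CK Ca * (2 * H\<^sup>2 + 8 * h\<^sup>2 * Ar)"
      unfolding S_def H_def M_def Ar_def
    proof (rule band_union_estimate[OF \<Omega> h \<alpha> I CL])
      fix b assume b: "b \<in> {1..NB}"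
      show "is_band (\<T> h) (N b) (P b) (Q b)" "CL * h powr (2 * \<alpha> / 5) \<le> band_length (N b) (P b)"
        using bands b by blast+
      fix i assume i: "i \<in> {1..N b}"
      have *: "area (band_Kt (P b) (Q b) i) \<le> CK * area (band_K (P b) (Q b) i)"
          "area (band_Kt (P b) (Q b) i) \<le> CK * area (band_K (P b) (Q b) (i - 1))"
          "sin (pi - band_alpha (P b) (Q b) (i - 1)) \<le> Ca * sin (pi - band_alphat (P b) (Q b) i)"
        using bands b i by blast+
      have le: "x * y \<le> \<bar>x\<bar> * y" if "y \<ge> 0" for x y :: real
        using that by (intro mult_right_mono) auto
      have s: "0 \<le> sin (pi - band_alphat (P b) (Q b) i)"
        using sin_vertex_angle_nonneg by (simp add: band_alphat_def)
      show "area (band_Kt (P b) (Q b) i) \<le> \<bar>CK\<bar> * area (band_K (P b) (Q b) i)"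
        using *(1) le by (rule order_trans) simp
      show "area (band_Kt (P b) (Q b) i) \<le> \<bar>CK\<bar> * area (band_K (P b) (Q b) (i - 1))"
        using *(2) le by (rule order_trans) simp
      show "sin (pi - band_alpha (P b) (Q b) (i - 1)) \<le> \<bar>Ca\<bar> * sin (pi - band_alphat (P b) (Q b) i)"
        using *(3) le[OF s] by (rule order_trans)
    next
      show "disjoint_family_on (\<lambda>b. band_elements (N b) (P b) (Q b)) {1..NB}"
        using bands by blast
    qed auto
    also have "\<dots> = 2 * M CK Ca * (H\<^sup>2 + 4 * h\<^sup>2 * Ar)" by (simp add: algebra_simps)
    \<comment> \<open>Completing the square makes the root linear, which separates the seminorm from
      the O(h) term.\<close>
    also have "\<dots> \<le> 2 * M CK Ca * (H + 2 * h * sqrt Ar)\<^sup>2"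
    proof (rule mult_left_mono)
      have "(H + 2 * h * sqrt Ar)\<^sup>2 = H\<^sup>2 + 4 * h\<^sup>2 * (sqrt Ar)\<^sup>2 + 4 * (H * (h * sqrt Ar))"
        by (simp add: power2_eq_square algebra_simps)
      then show "H\<^sup>2 + 4 * h\<^sup>2 * Ar \<le> (H + 2 * h * sqrt Ar)\<^sup>2"
        using H0 h Ar by simp
    qed (use M[of CK Ca] in simp)
    finally have "sqrt S \<le> sqrt (2 * M CK Ca * (H + 2 * h * sqrt Ar)\<^sup>2)"
      by (rule real_sqrt_le_mono)
    also have "\<dots> = sqrt (2 * M CK Ca) * (H + 2 * h * sqrt Ar)"
      using H0 h Ar by (simp only: real_sqrt_mult real_sqrt_abs) simp
    finally have "1 / sqrt (2 * M CK Ca) * sqrt S \<le> H + 2 * h * sqrt Ar"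
      using M[of CK Ca] by (simp add: field_simps)
    moreover have "2 * h * sqrt Ar \<le> (2 * sqrt Ar * max 1 h0 + 1) * h powr \<alpha>"
    proof -
      \<comment> \<open>Since \<alpha> \<le> 1, an error of order h is of order h^\<alpha>; the
        factor \<open>max 1 h0\<close> covers h > 1.\<close>
      have "h = h powr \<alpha> * h powr (1 - \<alpha>)"
        unfolding powr_add[symmetric] using h by simp
      moreover have "h powr (1 - \<alpha>) \<le> max 1 h0"
      proof -
        have "h powr (1 - \<alpha>) \<le> (max 1 h0) powr (1 - \<alpha>)"
          using h \<alpha> by (intro powr_mono2) auto
        also have "\<dots> \<le> (max 1 h0) powr 1"
          using \<alpha> by (intro powr_mono) auto
        finally show ?thesis by simp
      qed
      ultimately have "h \<le> h powr \<alpha> * max 1 h0"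
        by (metis mult_left_mono powr_ge_zero)
      then have "2 * sqrt Ar * h \<le> 2 * sqrt Ar * (h powr \<alpha> * max 1 h0)"
        using Ar by (intro mult_left_mono) auto
      also have "\<dots> \<le> 2 * sqrt Ar * (h powr \<alpha> * max 1 h0) + h powr \<alpha>" by simp
      finally show ?thesis by (simp add: algebra_simps)
    qed
    \<comment> \<open>The witnesses are \<open>A1 = C1 * sqrt S\<close>, with equality in its bound,
      and \<open>A2 = 2 * h * sqrt Ar\<close>.\<close>
    ultimately show "\<exists>A1 A2. h1_seminorm ?B ?v \<ge> A1 - A2 \<and>
        A1 \<ge> 1 / sqrt (2 * M CK Ca) * sqrt (\<Sum>b=1..NB. (MIN i\<in>{1..N b}. 1 / (sin (pi - band_alphat (P b) (Q b) i))\<^sup>2) *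
          (MIN i\<in>{1..N b}. area (band_Kt (P b) (Q b) i)) * (band_length (N b) (P b))\<^sup>2 / real (N b)) \<and>
        \<bar>A2\<bar> \<le> (2 * sqrt Ar * max 1 h0 + 1) * h powr \<alpha>"
      using h Ar unfolding H_def[symmetric] S_def[symmetric]
      by (intro exI[of _ "1 / sqrt (2 * M CK Ca) * sqrt S"] exI[of _ "2 * h * sqrt Ar"]) auto
  qed
qed

end
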